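(* Let $X$ be a Tychonoff space. The following conditions are equivalent: (1) $C_p(X)$ satisfies the Josefson-Nissenzweig property (JNP); (2) $C_p(X)$ contains a complemented subspace isomorphic to $c_0$; (3) $C_p(X)$ has a quotient isomorphic to $c_0$. If moreover the space $X$ is pseudocompact, then the conditions (1)--(3) are equivalent to each of the following: (4) $C_p(X)$ contains a complemented infinite-dimensional metrizable subspace; (5) $C_p(X)$ contains a complemented infinite-dimensional separable subspace; (6) $C_p(X)$ has an infinite-dimensional Polishable quotient.
   Context: For a Tychonoff space $X$, $C_p(X)$ is the space of continuous real-valued functions on $X$ with the topology of pointwise convergence (the subspace topology from $\mathbb{R}^X$). Here $c_0$ denotes the linear subspace $\{(x_n)_{n\in\mathbb{N}}\in\mathbb{R}^{\mathbb{N}}: x_n\to 0\}$ of $\mathbb{R}^{\mathbb{N}}$ endowed with the topology inherited from the product topology of $\mathbb{R}^{\mathbb{N}}$ (not the sup-norm topology). "Isomorphic" means linearly homeomorphic. "Subspace" means linear subspace with the induced topology; it is complemented if it is the range of a continuous linear projection of the whole space. A quotient of $C_p(X)$ is a space $C_p(X)/Z$ with the quotient topology, where $Z$ is a closed linear subspace. A finitely supported sign-measure on $X$ is a finite linear combination $\mu=\sum_{x\in F}\alpha_x\delta_x$ of Dirac measures $\delta_x:f\mapsto f(x)$, where $F\subset X$ is finite and the $\alpha_x$ are non-zero reals; it acts on functions by $\mu(f)=\sum_{x\in F}\alpha_x f(x)$ and has norm $\|\mu\|=\sum_{x\in F}|\alpha_x|$. The space $C_p(X)$ satisfies the Josefson-Nissenzweig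 property (JNP) if there exists a sequence $(\mu_n)_{n\in\mathbb{N}}$ of finitely supported sign-measures on $X$ such that $\|\mu_n\|=1$ for all $n\in\mathbb{N}$ and $\mu_n(f)\to 0$ as $n\to\infty$ for every $f\in C_p(X)$. A topological space is pseudocompact if it is Tychonoff and every continuous real-valued function on it is bounded. A locally convex space is Polishable if it admits a stronger (i.e. finer) separable Fréchet (complete metrizable locally convex) vector space topology. *)

theory Defs
  imports "HOL-Analysis.Analysis" "HOL-Library.Poly_Mapping"
begin

(* Real vector spaces with a topology are represented on an explicit carrier, the topspace of the
   topology field: linear subspaces, cosets and retopologized spaces are not types. *)

record 'v tvs =
  vtop :: "'v topology"
  vzero :: 'v
  vadd :: "'v \<Rightarrow> 'v \<Rightarrow> 'v"
  vscale :: "real \<Rightarrow> 'v \<Rightarrow> 'v"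

abbreviation vcarrier :: "'v tvs \<Rightarrow> 'v set" where
  "vcarrier V \<equiv> topspace (vtop V)"

definition real_vector_space :: "'v tvs \<Rightarrow> bool" where
  "real_vector_space V \<longleftrightarrow>
     vzero V \<in> vcarrier V \<and>
     (\<forall>x\<in>vcarrier V. \<forall>y\<in>vcarrier V. vadd V x y \<in> vcarrier V) \<and>
     (\<forall>a. \<forall>x\<in>vcarrier V. vscale V a x \<in> vcarrier V) \<and>
     (\<forall>x\<in>vcarrier V. \<forall>y\<in>vcarrier V. \<forall>z\<in>vcarrier V.
        vadd V (vadd V x y) z = vadd V x (vadd V y z)) \<and>
     (\<forall>x\<in>vcarrier V. \<forall>y\<in>vcarrier V. vadd V x y = vadd V y x) \<and>
     (\<forall>x\<in>vcarrier V. vadd V (vzero V) x = x) \<and>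
     (\<forall>x\<in>vcarrier V. \<exists>y\<in>vcarrier V. vadd V x y = vzero V) \<and>
     (\<forall>a. \<forall>x\<in>vcarrier V. \<forall>y\<in>vcarrier V.
        vscale V a (vadd V x y) = vadd V (vscale V a x) (vscale V a y)) \<and>
     (\<forall>a b. \<forall>x\<in>vcarrier V. vscale V (a + b) x = vadd V (vscale V a x) (vscale V b x)) \<and>
     (\<forall>a b. \<forall>x\<in>vcarrier V. vscale V a (vscale V b x) = vscale V (a * b) x) \<and>
     (\<forall>x\<in>vcarrier V. vscale V 1 x = x)"

definition topological_vector_space :: "'v tvs \<Rightarrow> bool" where
  "topological_vector_space V \<longleftrightarrow>
     real_vector_space V \<and>
     continuous_map (prod_topology (vtop V) (vtop V)) (vtop V) (\<lambda>(x, y). vadd V x y) \<and>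
     continuous_map (prod_topology euclideanreal (vtop V)) (vtop V) (\<lambda>(a, x). vscale V a x)"

definition convex_in :: "'v tvs \<Rightarrow> 'v set \<Rightarrow> bool" where
  "convex_in V S \<longleftrightarrow>
     (\<forall>x\<in>S. \<forall>y\<in>S. \<forall>t\<in>{0..1}. vadd V (vscale V (1 - t) x) (vscale V t y) \<in> S)"

definition locally_convex_space :: "'v tvs \<Rightarrow> bool" where
  "locally_convex_space V \<longleftrightarrow>
     topological_vector_space V \<and>
     (\<forall>U. openin (vtop V) U \<and> vzero V \<in> U \<longrightarrow>
        (\<exists>W. openin (vtop V) W \<and> vzero V \<in> W \<and> W \<subseteq> U \<and> convex_in V W))"

definition frechet_space :: "'v tvs \<Rightarrow> bool" where
  "frechet_space V \<longleftrightarrow>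
     locally_convex_space V \<and>
     (\<exists>d. Metric_space (vcarrier V) d \<and>
          vtop V = Metric_space.mtopology (vcarrier V) d \<and>
          (\<forall>x\<in>vcarrier V. \<forall>y\<in>vcarrier V. \<forall>z\<in>vcarrier V.
             d (vadd V x z) (vadd V y z) = d x y) \<and>
          Metric_space.mcomplete (vcarrier V) d)"

definition polishable :: "'v tvs \<Rightarrow> bool" where
  "polishable V \<longleftrightarrow>
     locally_convex_space V \<and>
     (\<exists>T. topspace T = vcarrier V \<and>
          (\<forall>U. openin (vtop V) U \<longrightarrow> openin T U) \<and>
          separable_space T \<and>
          frechet_space (V\<lparr>vtop := T\<rparr>))"

definition linear_subspace :: "'v tvs \<Rightarrow> 'v set \<Rightarrow> bool" where
  "linear_subspace V L \<longleftrightarrow>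
     L \<subseteq> vcarrier V \<and> vzero V \<in> L \<and>
     (\<forall>x\<in>L. \<forall>y\<in>L. vadd V x y \<in> L) \<and>
     (\<forall>a. \<forall>x\<in>L. vscale V a x \<in> L)"

definition sub_tvs :: "'v tvs \<Rightarrow> 'v set \<Rightarrow> 'v tvs" where
  "sub_tvs V L = V\<lparr>vtop := subtopology (vtop V) L\<rparr>"

(* linear_subspace V hull B is the linear span of B. *)
definition infinite_dimensional :: "'v tvs \<Rightarrow> bool" where
  "infinite_dimensional V \<longleftrightarrow>
     \<not> (\<exists>B. finite B \<and> B \<subseteq> vcarrier V \<and> linear_subspace V hull B = vcarrier V)"

definition linear_map_on :: "'v tvs \<Rightarrow> 'w tvs \<Rightarrow> ('v \<Rightarrow> 'w) \<Rightarrow> bool" where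
  "linear_map_on V W T \<longleftrightarrow>
     T ` vcarrier V \<subseteq> vcarrier W \<and>
     (\<forall>x\<in>vcarrier V. \<forall>y\<in>vcarrier V. T (vadd V x y) = vadd W (T x) (T y)) \<and>
     (\<forall>a. \<forall>x\<in>vcarrier V. T (vscale V a x) = vscale W a (T x))"

definition isomorphic_tvs :: "'v tvs \<Rightarrow> 'w tvs \<Rightarrow> bool" where
  "isomorphic_tvs V W \<longleftrightarrow>
     (\<exists>T. linear_map_on V W T \<and> homeomorphic_map (vtop V) (vtop W) T)"

definition complemented_subspace :: "'v tvs \<Rightarrow> 'v set \<Rightarrow> bool" where
  "complemented_subspace V L \<longleftrightarrow>
     linear_subspace V L \<and>
     (\<exists>P. linear_map_on V V P \<and> continuous_map (vtop V) (vtop V) P \<and>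
          (\<forall>x\<in>vcarrier V. P (P x) = P x) \<and> P ` vcarrier V = L)"

definition vcoset :: "'v tvs \<Rightarrow> 'v set \<Rightarrow> 'v \<Rightarrow> 'v set" where
  "vcoset V Z x = (\<lambda>z. vadd V x z) ` Z"

definition quotient_topology :: "'v tvs \<Rightarrow> 'v set \<Rightarrow> 'v set topology" where
  "quotient_topology V Z =
     topology (\<lambda>U. U \<subseteq> vcoset V Z ` vcarrier V \<and>
                   openin (vtop V) {x \<in> vcarrier V. vcoset V Z x \<in> U})"

(* The summand z in vscale only matters for a = 0: there a * A is {0} instead of the coset Z. *)
definition quotient_tvs :: "'v tvs \<Rightarrow> 'v set \<Rightarrow> 'v set tvs" where
  "quotient_tvs V Z =
     \<lparr>vtop = quotient_topology V Z,
      vzero = Z,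
      vadd = (\<lambda>A B. {vadd V x y |x y. x \<in> A \<and> y \<in> B}),
      vscale = (\<lambda>a A. {vadd V (vscale V a x) z |x z. x \<in> A \<and> z \<in> Z})\<rparr>"

definition closed_linear_subspace :: "'v tvs \<Rightarrow> 'v set \<Rightarrow> bool" where
  "closed_linear_subspace V Z \<longleftrightarrow> linear_subspace V Z \<and> closedin (vtop V) Z"

definition tychonoff_space :: "'a topology \<Rightarrow> bool" where
  "tychonoff_space X \<longleftrightarrow> completely_regular_space X \<and> Hausdorff_space X"

definition pseudocompact_space :: "'a topology \<Rightarrow> bool" where
  "pseudocompact_space X \<longleftrightarrow>
     tychonoff_space X \<and>
     (\<forall>f. continuous_map X euclideanreal f \<longrightarrow> bounded (f ` topspace X))"

(* Functions on X are extensional (undefined outside topspace X), so that equality in C_p(X) is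
   equality on X; powertop_real I is the product topology on the extensional functions on I. *)
definition Cp :: "'a topology \<Rightarrow> ('a \<Rightarrow> real) tvs" where
  "Cp X =
     \<lparr>vtop = subtopology (powertop_real (topspace X)) {f. continuous_map X euclideanreal f},
      vzero = (\<lambda>x\<in>topspace X. 0),
      vadd = (\<lambda>f g. \<lambda>x\<in>topspace X. f x + g x),
      vscale = (\<lambda>a f. \<lambda>x\<in>topspace X. a * f x)\<rparr>"

definition c0_space :: "(nat \<Rightarrow> real) tvs" where
  "c0_space =
     \<lparr>vtop = subtopology (powertop_real UNIV) {s. s \<longlonglongrightarrow> 0},
      vzero = (\<lambda>n. 0),
      vadd = (\<lambda>s t n. s n + t n),
      vscale = (\<lambda>a s n. a * s n)\<rparr>"

(* A finitely supported sign-measure is a finitely supported function: lookup m x is the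
   coefficient of the Dirac measure at x, and keys m is the set of points with non-zero
   coefficient. *)
definition sign_measure_on :: "'a topology \<Rightarrow> ('a \<Rightarrow>\<^sub>0 real) \<Rightarrow> bool" where
  "sign_measure_on X m \<longleftrightarrow> Poly_Mapping.keys m \<subseteq> topspace X"

definition sign_measure_apply :: "('a \<Rightarrow>\<^sub>0 real) \<Rightarrow> ('a \<Rightarrow> real) \<Rightarrow> real" where
  "sign_measure_apply m f = (\<Sum>x\<in>Poly_Mapping.keys m. Poly_Mapping.lookup m x * f x)"

definition sign_measure_norm :: "('a \<Rightarrow>\<^sub>0 real) \<Rightarrow> real" where
  "sign_measure_norm m = (\<Sum>x\<in>Poly_Mapping.keys m. \<bar>Poly_Mapping.lookup m x\<bar>)"

definition JNP :: "'a topology \<Rightarrow> bool" where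
  "JNP X \<longleftrightarrow>
     (\<exists>m :: nat \<Rightarrow> 'a \<Rightarrow>\<^sub>0 real.
        (\<forall>n. sign_measure_on X (m n) \<and> sign_measure_norm (m n) = 1) \<and>
        (\<forall>f\<in>vcarrier (Cp X). (\<lambda>n. sign_measure_apply (m n) f) \<longlonglongrightarrow> 0))"

lemma vcarrier_Cp:
  "vcarrier (Cp X) = {f \<in> extensional (topspace X). continuous_map X euclideanreal f}"
  by (auto simp: Cp_def PiE_def)

lemma vcarrier_c0_space: "vcarrier c0_space = {s. s \<longlonglongrightarrow> 0}"
  by (simp add: c0_space_def)

lemma vcarrier_sub_tvs: "linear_subspace V L \<Longrightarrow> vcarrier (sub_tvs V L) = L"
  by (auto simp: sub_tvs_def linear_subspace_def)

lemma openin_quotient_topology: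
  "openin (quotient_topology V Z) U \<longleftrightarrow>
     U \<subseteq> vcoset V Z ` vcarrier V \<and> openin (vtop V) {x \<in> vcarrier V. vcoset V Z x \<in> U}"
proof -
  have "istopology (\<lambda>U. U \<subseteq> vcoset V Z ` vcarrier V \<and>
          openin (vtop V) {x \<in> vcarrier V. vcoset V Z x \<in> U})"
    unfolding istopology_def
  proof (intro conjI allI impI)
    fix S T
    assume "S \<subseteq> vcoset V Z ` vcarrier V \<and> openin (vtop V) {x \<in> vcarrier V. vcoset V Z x \<in> S}"
      and "T \<subseteq> vcoset V Z ` vcarrier V \<and> openin (vtop V) {x \<in> vcarrier V. vcoset V Z x \<in> T}"
    moreover have "{x \<in> vcarrier V. vcoset V Z x \<in> S \<inter> T} =
        {x \<in> vcarrier V. vcoset V Z x \<in> S} \<inter> {x \<in> vcarrier V. vcoset V Z x \<in> T}"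
      by auto
    ultimately show "S \<inter> T \<subseteq> vcoset V Z ` vcarrier V"
      and "openin (vtop V) {x \<in> vcarrier V. vcoset V Z x \<in> S \<inter> T}"
      by auto
  next
    fix K
    assume K: "\<forall>S\<in>K. S \<subseteq> vcoset V Z ` vcarrier V \<and>
                 openin (vtop V) {x \<in> vcarrier V. vcoset V Z x \<in> S}"
    then show "\<Union>K \<subseteq> vcoset V Z ` vcarrier V"
      by auto
    have "{x \<in> vcarrier V. vcoset V Z x \<in> \<Union>K} =
        (\<Union>S\<in>K. {x \<in> vcarrier V. vcoset V Z x \<in> S})"
      by auto
    with K show "openin (vtop V) {x \<in> vcarrier V. vcoset V Z x \<in> \<Union>K}"
      by auto
  qed
  then show ?thesis
    by (simp add: quotient_topology_def)
qed

lemma topspace_quotient_topology: "topspace (quotient_topology V Z) = vcoset V Z ` vcarrier V"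
proof -
  have "{x \<in> vcarrier V. vcoset V Z x \<in> vcoset V Z ` vcarrier V} = vcarrier V"
    by auto
  then have "openin (quotient_topology V Z) (vcoset V Z ` vcarrier V)"
    by (simp add: openin_quotient_topology)
  then show ?thesis
    by (metis openin_quotient_topology openin_subset openin_topspace subset_antisym)
qed

lemma quotient_map_vcoset: "quotient_map (vtop V) (vtop (quotient_tvs V Z)) (vcoset V Z)"
  by (simp add: quotient_map_def quotient_tvs_def topspace_quotient_topology
      openin_quotient_topology)

lemma real_vector_space_c0_space: "real_vector_space c0_space"
proof -
  have "\<exists>t. t \<longlonglongrightarrow> 0 \<and> (\<forall>n. s n + t n = 0)" if "s \<longlonglongrightarrow> 0" for s :: "nat \<Rightarrow> real"
    using tendsto_minus[OF that] by (intro exI[of _ "\<lambda>n. - s n"]) auto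
  then show ?thesis
    unfolding real_vector_space_def vcarrier_c0_space
    by (auto simp: c0_space_def algebra_simps fun_eq_iff tendsto_add_zero tendsto_mult_right_zero)
qed

lemma real_vector_space_Cp: "real_vector_space (Cp X)"
proof -
  have cont: "continuous_map X euclideanreal (restrict h (topspace X))"
    if "continuous_map X euclideanreal h" for h
    using that by (rule continuous_map_eq) simp
  have ex: "\<exists>g. g \<in> extensional (topspace X) \<and> continuous_map X euclideanreal g \<and>
          (\<lambda>x\<in>topspace X. f x + g x) = (\<lambda>x\<in>topspace X. 0)"
    if "continuous_map X euclideanreal f" for f
    using cont[OF continuous_map_minus[OF that]]
    by (intro exI[of _ "\<lambda>x\<in>topspace X. - f x"]) (auto simp: fun_eq_iff)
  show ?thesis
    unfolding real_vector_space_def vcarrier_Cp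
    using ex
    by (auto simp: Cp_def algebra_simps fun_eq_iff extensional_def
        intro!: cont continuous_map_add continuous_map_real_mult)
qed

lemma
  assumes V: "real_vector_space V" and Z: "linear_subspace V Z"
    and x: "x \<in> vcarrier V"
  shows vadd_quotient_tvs: "y \<in> vcarrier V \<Longrightarrow>
      vadd (quotient_tvs V Z) (vcoset V Z x) (vcoset V Z y) = vcoset V Z (vadd V x y)"
    and vscale_quotient_tvs:
      "vscale (quotient_tvs V Z) a (vcoset V Z x) = vcoset V Z (vscale V a x)"
proof -
  have ZV: "z \<in> vcarrier V" if "z \<in> Z" for z
    using Z that by (auto simp: linear_subspace_def)
  have Z0: "vzero V \<in> Z" and Zadd: "\<And>u v. u \<in> Z \<Longrightarrow> v \<in> Z \<Longrightarrow> vadd V u v \<in> Z"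
    and Zscale: "\<And>a u. u \<in> Z \<Longrightarrow> vscale V a u \<in> Z"
    using Z by (auto simp: linear_subspace_def)
  have clo: "\<And>u v. u \<in> vcarrier V \<Longrightarrow> v \<in> vcarrier V \<Longrightarrow> vadd V u v \<in> vcarrier V"
    and sclo: "\<And>a u. u \<in> vcarrier V \<Longrightarrow> vscale V a u \<in> vcarrier V"
    and assoc: "\<And>u v w. u \<in> vcarrier V \<Longrightarrow> v \<in> vcarrier V \<Longrightarrow> w \<in> vcarrier V \<Longrightarrow>
          vadd V (vadd V u v) w = vadd V u (vadd V v w)"
    and comm: "\<And>u v. u \<in> vcarrier V \<Longrightarrow> v \<in> vcarrier V \<Longrightarrow> vadd V u v = vadd V v u"
    and zero: "\<And>u. u \<in> vcarrier V \<Longrightarrow> vadd V (vzero V) u = u"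
    and z_in: "vzero V \<in> vcarrier V"
    and distrib: "\<And>a u v. u \<in> vcarrier V \<Longrightarrow> v \<in> vcarrier V \<Longrightarrow>
          vscale V a (vadd V u v) = vadd V (vscale V a u) (vscale V a v)"
    using V by (auto simp: real_vector_space_def)
  have zero': "vadd V u (vzero V) = u" if "u \<in> vcarrier V" for u
    using that comm zero z_in by metis
  show "vadd (quotient_tvs V Z) (vcoset V Z x) (vcoset V Z y) = vcoset V Z (vadd V x y)"
    if y: "y \<in> vcarrier V"
  proof -
    have swap: "vadd V (vadd V x u) (vadd V y v) = vadd V (vadd V x y) (vadd V u v)"
      if "u \<in> Z" "v \<in> Z" for u v
    proof -
      have uV: "u \<in> vcarrier V" and vV: "v \<in> vcarrier V"
        using that ZV by auto
      have "vadd V (vadd V x u) (vadd V y v) = vadd V x (vadd V u (vadd V y v))"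
        by (rule assoc[OF x uV clo[OF y vV]])
      also have "vadd V u (vadd V y v) = vadd V (vadd V u y) v"
        by (rule assoc[OF uV y vV, symmetric])
      also have "vadd V u y = vadd V y u"
        by (rule comm[OF uV y])
      also have "vadd V (vadd V y u) v = vadd V y (vadd V u v)"
        by (rule assoc[OF y uV vV])
      also have "vadd V x (vadd V y (vadd V u v)) = vadd V (vadd V x y) (vadd V u v)"
        by (rule assoc[OF x y clo[OF uV vV], symmetric])
      finally show ?thesis .
    qed
    have "\<exists>u\<in>Z. \<exists>v\<in>Z. vadd V (vadd V x y) w = vadd V (vadd V x u) (vadd V y v)" if "w \<in> Z" for w
      using swap[OF that Z0] zero'[OF ZV[OF that]] that Z0 by metis
    then have "vcoset V Z (vadd V x y) \<subseteq> {vadd V (vadd V x u) (vadd V y v) |u v. u \<in> Z \<and> v \<in> Z}"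
      unfolding vcoset_def by blast
    moreover have "{vadd V (vadd V x u) (vadd V y v) |u v. u \<in> Z \<and> v \<in> Z} \<subseteq> vcoset V Z (vadd V x y)"
      by (auto simp: vcoset_def swap Zadd)
    moreover have "vadd (quotient_tvs V Z) (vcoset V Z x) (vcoset V Z y) =
        {vadd V (vadd V x u) (vadd V y v) |u v. u \<in> Z \<and> v \<in> Z}"
      unfolding quotient_tvs_def vcoset_def tvs.simps by blast
    ultimately show ?thesis
      by (metis subset_antisym)
  qed
  show "vscale (quotient_tvs V Z) a (vcoset V Z x) = vcoset V Z (vscale V a x)"
  proof -
    have eq: "vadd V (vscale V a (vadd V x u)) v = vadd V (vscale V a x) (vadd V (vscale V a u) v)"
      if "u \<in> Z" "v \<in> Z" for u v
      using distrib[OF x ZV[OF that(1)]] assoc[OF sclo[OF x] sclo[OF ZV[OF that(1)]] ZV[OF that(2)]]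
      by simp
    have "\<exists>u\<in>Z. \<exists>v\<in>Z. vadd V (vscale V a x) w = vadd V (vscale V a (vadd V x u)) v"
      if "w \<in> Z" for w
      by (rule bexI[OF _ Z0], rule bexI[OF _ that]) (simp add: zero'[OF x])
    then have "vcoset V Z (vscale V a x) \<subseteq>
        {vadd V (vscale V a (vadd V x u)) v |u v. u \<in> Z \<and> v \<in> Z}"
      unfolding vcoset_def by blast
    moreover have "{vadd V (vscale V a (vadd V x u)) v |u v. u \<in> Z \<and> v \<in> Z} \<subseteq>
        vcoset V Z (vscale V a x)"
      by (auto simp: vcoset_def eq Zadd Zscale)
    moreover have "vscale (quotient_tvs V Z) a (vcoset V Z x) =
        {vadd V (vscale V a (vadd V x u)) v |u v. u \<in> Z \<and> v \<in> Z}"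
      unfolding quotient_tvs_def vcoset_def tvs.simps by blast
    ultimately show ?thesis
      by (metis subset_antisym)
  qed
qed

end

theory Submission
  imports Defs
begin

text \<open>
  All conditions are translated into statements about sequences of finitely supported measures.

  From a null sequence to c_0. Suppose that norm-one measures tend to 0 on every continuous function.
  Differences of a pointwise convergent subsequence, normalised, still tend to 0 on every continuous
  function and now tend to 0 at each point too (\<open>JNP_imp_pointwise_null\<close>). A gliding hump argument
  extracts a subsequence and continuous functions f_k of modulus at most 1 that are pairwise disjoint
  and almost dual to it; the pairing matrix is triangular, and solving the triangular system
  gives measures a_k exactly dual to the f_k that still form a null sequence
  (\<open>JNP_imp_biorthogonal_system\<close>). For s in c_0 the series of the s_k f_k converges uniformly, and
  g -> (a_k(g)) and s -> sum s_k f_k are continuous linear maps whose composition is the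
  identity of c_0. Hence c_0 is a complemented subspace and a quotient of C_p(X) at once.

  From c_0 to a null sequence. A projection onto a copy of c_0 and a quotient map onto c_0 are both
  continuous linear surjections from C_p(X) to c_0. The coordinates of such a surjection are
  finitely supported measures that tend to 0 on every continuous function, so only a lower bound of
  their norms is missing. If the norms came close to 0, some element of c_0 would be too large to be
  the image of a function bounded on the supports of these measures; and all continuous functions are
  bounded there, whether or not they are bounded on X (\<open>bounded_on_supports\<close>, \<open>c0_image_imp_JNP\<close>).

  Pseudocompact spaces. Since c_0 is metrizable, and separable and complete in the sup norm, the
  property implies the remaining three conditions. Conversely each of these gives a closed subspace Z of
  infinite codimension. Finite-dimensional linear algebra shows that, for any countable family of functions,
  there are norm-one measures that annihilate Z, the n-th of which also annihilates the first n members of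
  the family (\<open>annihilating_measures\<close>). It remains to choose the family so that these measures tend
  to 0. For a Polishable quotient it represents a sequence dense in the Frechet topology,
  and the Banach-Steinhaus theorem applies because norm-one measures are pointwise bounded when X is
  pseudocompact. For a separable complement L, a dense sequence cuts X into countably many kinds
  of cells, and the family consists of their indicator functions; pseudocompactness makes each element
  of L uniformly close to a combination of finitely many of them. A metrizable complement is
  separable, because its neighbourhoods of 0 depend on countably many points only.
\<close>

section \<open>Finitely supported measures and functions on Tychonoff spaces\<close>

text \<open>A sign-measure is handled through its density, a plain real function with finite support in X.
  Sums, multiples and infinite families of measures are then ordinary pointwise expressions, and a
  measure can be paired with any function at all, continuous or not. The freedom to pair with
  discontinuous functions is used for separable complements.\<close>

definition fin_measure :: "'a topology \<Rightarrow> ('a \<Rightarrow> real) \<Rightarrow> bool" where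
  "fin_measure X c \<longleftrightarrow> finite {x. c x \<noteq> 0} \<and> {x. c x \<noteq> 0} \<subseteq> topspace X"

definition pairing :: "('a \<Rightarrow> real) \<Rightarrow> ('a \<Rightarrow> real) \<Rightarrow> real" where
  "pairing c f = (\<Sum>x | c x \<noteq> 0. c x * f x)"

definition mass :: "('a \<Rightarrow> real) \<Rightarrow> 'a set \<Rightarrow> real" where
  "mass c A = (\<Sum>x \<in> {x. c x \<noteq> 0} \<inter> A. \<bar>c x\<bar>)"

definition weakly_null :: "'a topology \<Rightarrow> (nat \<Rightarrow> 'a \<Rightarrow> real) \<Rightarrow> bool" where
  "weakly_null X c \<longleftrightarrow>
     (\<forall>f. continuous_map X euclideanreal f \<longrightarrow> (\<lambda>n. pairing (c n) f) \<longlonglongrightarrow> 0)"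

lemma pairing_superset:
  assumes "finite S" "{x. c x \<noteq> 0} \<subseteq> S"
  shows "pairing c f = (\<Sum>x\<in>S. c x * f x)"
  unfolding pairing_def by (rule sum.mono_neutral_left) (use assms in auto)

lemma fin_measure_finite: "fin_measure X c \<Longrightarrow> finite {x. c x \<noteq> 0}"
  by (simp add: fin_measure_def)

lemma fin_measure_zero: "fin_measure X (\<lambda>x. 0)"
  by (simp add: fin_measure_def)

lemma fin_measure_add:
  assumes "fin_measure X c" "fin_measure X d"
  shows "fin_measure X (\<lambda>x. c x + d x)"
proof -
  have "{x. c x + d x \<noteq> 0} \<subseteq> {x. c x \<noteq> 0} \<union> {x. d x \<noteq> 0}" by auto
  with assms show ?thesis unfolding fin_measure_def by (meson finite_subset finite_UnI subset_trans Un_least)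
qed

lemma fin_measure_scale:
  assumes "fin_measure X c"
  shows "fin_measure X (\<lambda>x. a * c x)"
proof -
  have "{x. a * c x \<noteq> 0} \<subseteq> {x. c x \<noteq> 0}" by auto
  with assms show ?thesis unfolding fin_measure_def by (meson finite_subset subset_trans)
qed

lemma fin_measure_diff:
  assumes "fin_measure X c" "fin_measure X d"
  shows "fin_measure X (\<lambda>x. c x - d x)"
  using fin_measure_add[OF assms(1) fin_measure_scale[OF assms(2), of "-1"]] by simp

lemma fin_measure_sum:
  assumes "finite I" "\<And>i. i \<in> I \<Longrightarrow> fin_measure X (c i)"
  shows "fin_measure X (\<lambda>x. \<Sum>i\<in>I. c i x)"
  using assms by (induction I rule: finite_induct) (auto intro: fin_measure_zero fin_measure_add)

lemma pairing_add_left: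
  assumes "finite {x. c x \<noteq> 0}" "finite {x. d x \<noteq> 0}"
  shows "pairing (\<lambda>x. c x + d x) f = pairing c f + pairing d f"
proof -
  let ?S = "{x. c x \<noteq> 0} \<union> {x. d x \<noteq> 0}"
  have "pairing (\<lambda>x. c x + d x) f = (\<Sum>x\<in>?S. (c x + d x) * f x)"
    by (rule pairing_superset) (use assms in auto)
  moreover have "pairing c f = (\<Sum>x\<in>?S. c x * f x)" "pairing d f = (\<Sum>x\<in>?S. d x * f x)"
    by (rule pairing_superset; use assms in auto)+
  ultimately show ?thesis by (simp add: sum.distrib algebra_simps)
qed

lemma pairing_scale_left: "pairing (\<lambda>x. a * c x) f = a * pairing c f"
  by (cases "a = 0") (simp_all add: pairing_def sum_distrib_left mult.assoc)

lemma pairing_diff_left: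
  assumes "finite {x. c x \<noteq> 0}" "finite {x. d x \<noteq> 0}"
  shows "pairing (\<lambda>x. c x - d x) f = pairing c f - pairing d f"
  using pairing_add_left[OF assms(1), of "\<lambda>x. -1 * d x" f] assms(2) pairing_scale_left[of "-1" d f]
  by simp

lemma pairing_add: "pairing c (\<lambda>x. f x + g x) = pairing c f + pairing c g"
  by (simp add: pairing_def algebra_simps sum.distrib)

lemma pairing_diff: "pairing c (\<lambda>x. f x - g x) = pairing c f - pairing c g"
  by (simp add: pairing_def algebra_simps sum_subtractf)

lemma pairing_scale: "pairing c (\<lambda>x. a * f x) = a * pairing c f"
  by (simp add: pairing_def algebra_simps sum_distrib_left)

lemma pairing_sum: "pairing c (\<lambda>x. \<Sum>i\<in>I. f i x) = (\<Sum>i\<in>I. pairing c (f i))"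
  unfolding pairing_def sum_distrib_left by (rule sum.swap)

lemma pairing_cong: "(\<And>x. c x \<noteq> 0 \<Longrightarrow> f x = g x) \<Longrightarrow> pairing c f = pairing c g"
  by (auto simp: pairing_def intro: sum.cong)

lemma pairing_restrict:
  "fin_measure X c \<Longrightarrow> pairing c (restrict f (topspace X)) = pairing c f"
  by (rule pairing_cong) (auto simp: fin_measure_def)

lemma mass_nonneg: "0 \<le> mass c A"
  by (simp add: mass_def sum_nonneg)

lemma mass_mono:
  assumes "finite {x. c x \<noteq> 0}" "{x. c x \<noteq> 0} \<inter> A \<subseteq> B"
  shows "mass c A \<le> mass c B"
  unfolding mass_def by (rule sum_mono2) (use assms in auto)

lemma mass_Un_le:
  assumes "finite {x. c x \<noteq> 0}"
  shows "mass c (A \<union> B) \<le> mass c A + mass c B"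
  unfolding mass_def Int_Un_distrib
  using sum_Un[of "{x. c x \<noteq> 0} \<inter> A" "{x. c x \<noteq> 0} \<inter> B" "\<lambda>x. \<bar>c x\<bar>"] assms
  by (simp add: sum_nonneg)

text \<open>With unit total mass, N disjoint sets cannot all carry more than 1/N. This is the counting
  behind every selection in the gliding hump.\<close>

lemma sum_mass_disjoint_le:
  assumes fin: "finite {x. c x \<noteq> 0}" and I: "finite I"
    and disj: "\<And>i j. i \<in> I \<Longrightarrow> j \<in> I \<Longrightarrow> i \<noteq> j \<Longrightarrow> A i \<inter> A j = {}"
  shows "(\<Sum>i\<in>I. mass c (A i)) \<le> mass c UNIV"
proof -
  have "(\<Sum>i\<in>I. mass c (A i)) = (\<Sum>x\<in>(\<Union>i\<in>I. {x. c x \<noteq> 0} \<inter> A i). \<bar>c x\<bar>)"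
    unfolding mass_def by (rule sum.UNION_disjoint[symmetric]) (use fin I disj in blast)+
  also have "\<dots> \<le> mass c UNIV"
    unfolding mass_def by (rule sum_mono2) (use fin in auto)
  finally show ?thesis .
qed

lemma mass_scale: "mass (\<lambda>x. a * c x) A = \<bar>a\<bar> * mass c A"
  by (cases "a = 0") (simp_all add: mass_def sum_distrib_left abs_mult)

lemma mass_pos_iff:
  assumes "finite {x. c x \<noteq> 0}"
  shows "0 < mass c UNIV \<longleftrightarrow> (\<exists>x. c x \<noteq> 0)"
proof
  assume "\<exists>x. c x \<noteq> 0"
  then obtain x where x: "c x \<noteq> 0" by blast
  then have "\<bar>c x\<bar> \<le> mass c UNIV"
    unfolding mass_def using assms by (intro member_le_sum) auto
  then show "0 < mass c UNIV" using x by linarith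
qed (rule ccontr, auto simp: mass_def)

lemma abs_le_mass:
  assumes "finite {x. c x \<noteq> 0}"
  shows "\<bar>c x\<bar> \<le> mass c UNIV"
  using assms mass_nonneg[of c UNIV] unfolding mass_def
  by (cases "c x = 0") (auto intro: member_le_sum)

lemma abs_pairing_le:
  assumes "finite {x. c x \<noteq> 0}" and B: "\<And>x. c x \<noteq> 0 \<Longrightarrow> \<bar>f x\<bar> \<le> B"
  shows "\<bar>pairing c f\<bar> \<le> B * mass c {x. f x \<noteq> 0}"
proof -
  have "pairing c f = (\<Sum>x\<in>{x. c x \<noteq> 0} \<inter> {x. f x \<noteq> 0}. c x * f x)"
    unfolding pairing_def by (rule sum.mono_neutral_right) (use assms in auto)
  also have "\<bar>\<dots>\<bar> \<le> (\<Sum>x\<in>{x. c x \<noteq> 0} \<inter> {x. f x \<noteq> 0}. B * \<bar>c x\<bar>)"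
    by (rule order_trans[OF sum_abs], rule sum_mono)
       (auto simp: abs_mult mult.commute intro!: mult_right_mono B)
  finally show ?thesis by (simp add: mass_def sum_distrib_left)
qed

lemma abs_pairing_le_norm:
  assumes "finite {x. c x \<noteq> 0}" "\<And>x. c x \<noteq> 0 \<Longrightarrow> \<bar>f x\<bar> \<le> B" "0 \<le> B"
  shows "\<bar>pairing c f\<bar> \<le> B * mass c UNIV"
  using abs_pairing_le[OF assms(1,2)] mass_mono[OF assms(1), of "{x. f x \<noteq> 0}" UNIV] assms(3)
  by (meson mult_left_mono order_trans subset_UNIV)

lemma JNP_iff:
  "JNP X \<longleftrightarrow> (\<exists>c. (\<forall>n. fin_measure X (c n) \<and> mass (c n) UNIV = 1) \<and> weakly_null X c)"
  unfolding weakly_null_def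
proof
  assume "JNP X"
  then obtain m :: "nat \<Rightarrow> 'a \<Rightarrow>\<^sub>0 real" where m:
      "\<And>n. sign_measure_on X (m n)" "\<And>n. sign_measure_norm (m n) = 1"
      "\<And>f. f \<in> vcarrier (Cp X) \<Longrightarrow> (\<lambda>n. sign_measure_apply (m n) f) \<longlonglongrightarrow> 0"
    unfolding JNP_def by blast
  have 1: "fin_measure X (Poly_Mapping.lookup (m n))" for n
    using m(1)[of n] by (auto simp: fin_measure_def sign_measure_on_def Poly_Mapping.keys.rep_eq)
  have 2: "mass (Poly_Mapping.lookup (m n)) UNIV = 1" for n
    using m(2)[of n] by (simp add: mass_def sign_measure_norm_def Poly_Mapping.keys.rep_eq)
  have 3: "(\<lambda>n. pairing (Poly_Mapping.lookup (m n)) f) \<longlonglongrightarrow> 0"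
    if "continuous_map X euclideanreal f" for f
  proof -
    have "restrict f (topspace X) \<in> vcarrier (Cp X)"
      using continuous_map_eq[OF that, of "restrict f (topspace X)"] by (simp add: vcarrier_Cp)
    from m(3)[OF this] show ?thesis
      using pairing_restrict[OF 1]
      by (simp add: sign_measure_apply_def pairing_def Poly_Mapping.keys.rep_eq)
  qed
  show "\<exists>c. (\<forall>n. fin_measure X (c n) \<and> mass (c n) UNIV = 1) \<and>
      (\<forall>f. continuous_map X euclideanreal f \<longrightarrow> (\<lambda>n. pairing (c n) f) \<longlonglongrightarrow> 0)"
    using 1 2 3 by (intro exI[of _ "\<lambda>n. Poly_Mapping.lookup (m n)"]) blast
next
  assume "\<exists>c. (\<forall>n. fin_measure X (c n) \<and> mass (c n) UNIV = 1) \<and>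
      (\<forall>f. continuous_map X euclideanreal f \<longrightarrow> (\<lambda>n. pairing (c n) f) \<longlonglongrightarrow> 0)"
  then obtain c where c: "\<And>n::nat. fin_measure X (c n)" "\<And>n. mass (c n) UNIV = 1"
     "\<And>f. continuous_map X euclideanreal f \<Longrightarrow> (\<lambda>n. pairing (c n) f) \<longlonglongrightarrow> 0" by blast
  define m where "m n = Abs_poly_mapping (c n)" for n
  have l: "Poly_Mapping.lookup (m n) = c n" for n
    unfolding m_def by (rule Abs_poly_mapping_inverse) (use c(1)[of n] in \<open>simp add: fin_measure_def\<close>)
  show "JNP X" unfolding JNP_def
    using c by (intro exI[of _ m])
     (auto simp: sign_measure_on_def sign_measure_norm_def sign_measure_apply_def pairing_def mass_def
       Poly_Mapping.keys.rep_eq l fin_measure_def vcarrier_Cp)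
qed

text \<open>Complete regularity separates a point from a closed set; finite sets are closed, so finitely many
  further points can be avoided at no cost.\<close>

lemma tychonoff_vanish_off_point:
  assumes X: "tychonoff_space X" and C: "closedin X C" and F: "finite F" "F \<subseteq> topspace X"
    and x: "x \<in> topspace X" "x \<notin> C" "x \<notin> F"
  obtains g where "continuous_map X euclideanreal g" "g x = 1" "\<And>y. y \<in> C \<union> F \<Longrightarrow> g y = 0"
proof -
  have "closedin X F"
    using X F by (simp add: tychonoff_space_def Hausdorff_imp_t1_space closedin_t1_singleton
        closedin_Hausdorff_finite)
  with C have "closedin X (C \<union> F)" by blast
  then obtain f where f: "continuous_map X (top_of_set {0..1::real}) f" "f x = 0" "f ` (C \<union> F) \<subseteq> {1}"
    using X x unfolding tychonoff_space_def completely_regular_space_def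
    by (metis DiffI UnE)
  show thesis
  proof
    show "continuous_map X euclideanreal (\<lambda>y. 1 - f y)"
      using f(1) by (intro continuous_intros) (auto simp: continuous_map_in_subtopology)
  qed (use f in auto)
qed

lemma tychonoff_interpolation:
  fixes v :: "'a \<Rightarrow> real"
  assumes X: "tychonoff_space X" and F: "finite F" "F \<subseteq> topspace X"
  obtains u where "continuous_map X euclideanreal u" "\<And>x. x \<in> F \<Longrightarrow> u x = v x"
proof -
  have "\<exists>g. continuous_map X euclideanreal g \<and> g x = 1 \<and> (\<forall>y\<in>F - {x}. g y = 0)" if "x \<in> F" for x
    by (rule tychonoff_vanish_off_point[OF X closedin_empty, of "F - {x}" x]) (use F that in auto)
  then obtain g where g: "\<And>x. x \<in> F \<Longrightarrow> continuous_map X euclideanreal (g x)"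
     "\<And>x. x \<in> F \<Longrightarrow> g x x = 1" "\<And>x y. x \<in> F \<Longrightarrow> y \<in> F \<Longrightarrow> y \<noteq> x \<Longrightarrow> g x y = 0"
    by (metis DiffI singletonD)
  show thesis
  proof
    show "continuous_map X euclideanreal (\<lambda>y. \<Sum>x\<in>F. v x * g x y)"
      using F g(1) by (intro continuous_intros) auto
    show "(\<Sum>x\<in>F. v x * g x y) = v y" if "y \<in> F" for y
    proof -
      have "(\<Sum>x\<in>F. v x * g x y) = (\<Sum>x\<in>F. if x = y then v y else 0)"
        by (rule sum.cong) (use g that in auto)
      then show ?thesis using F that by simp
    qed
  qed
qed

lemma tychonoff_interpolation_bounded:
  fixes v :: "'a \<Rightarrow> real"
  assumes X: "tychonoff_space X" and F: "finite F" "F \<subseteq> topspace X"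
    and B: "\<And>x. x \<in> F \<Longrightarrow> \<bar>v x\<bar> \<le> B" "0 \<le> B"
  obtains u where "continuous_map X euclideanreal u" "\<And>x. x \<in> F \<Longrightarrow> u x = v x" "\<And>x. \<bar>u x\<bar> \<le> B"
proof -
  obtain u where u: "continuous_map X euclideanreal u" "\<And>x. x \<in> F \<Longrightarrow> u x = v x"
    using tychonoff_interpolation[OF X F] by blast
  show thesis
  proof
    show "continuous_map X euclideanreal (\<lambda>x. max (- B) (min B (u x)))"
      using u(1) by (intro continuous_intros) auto
    show "max (- B) (min B (u x)) = v x" if "x \<in> F" for x
      using u(2)[OF that] B(1)[OF that] by auto
    show "\<bar>max (- B) (min B (u x))\<bar> \<le> B" for x using B(2) by auto
  qed
qed

section \<open>Continuous linear images of C_p(X)\<close>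

text \<open>A continuous function need not be bounded on X, but it is bounded on the union of the supports of
  a pointwise bounded sequence of measures. Otherwise the function f is unbounded on the supports,
  and one builds continuous functions h_k and a rapidly growing sequence t_k such that h_{k+1} agrees
  with h_k where |f| is at most t_k, while some measure supported in that region takes the value k
  on h_k. The functions h_k stabilise locally, so they have a continuous limit, and the measures are
  unbounded on it.\<close>

lemma bounded_on_supports:
  fixes c :: "nat \<Rightarrow> 'a \<Rightarrow> real"
  assumes X: "tychonoff_space X" and c: "\<And>n. fin_measure X (c n)"
    and bd: "\<And>f. continuous_map X euclideanreal f \<Longrightarrow> \<exists>K. \<forall>n. \<bar>pairing (c n) f\<bar> \<le> K"
    and f: "continuous_map X euclideanreal f"
  shows "\<exists>K. \<forall>n x. c n x \<noteq> 0 \<longrightarrow> \<bar>f x\<bar> \<le> K"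
proof (rule ccontr)
  assume "\<not> ?thesis"
  then have unb: "\<exists>n x. c n x \<noteq> 0 \<and> \<bar>f x\<bar> > K" for K
    by (meson not_le)
  have fin: "finite {x. c n x \<noteq> 0}" for n using c fin_measure_finite by blast
  have supp: "x \<in> topspace X" if "c n x \<noteq> 0" for n x
    using c[of n] that by (auto simp: fin_measure_def)
  have ub: "\<exists>t \<ge> s. \<forall>x. c n x \<noteq> 0 \<longrightarrow> \<bar>f x\<bar> \<le> t" for s n
  proof -
    have "bdd_above ((\<lambda>x. \<bar>f x\<bar>) ` {x. c n x \<noteq> 0})" using fin by simp
    then obtain t where "\<forall>x. c n x \<noteq> 0 \<longrightarrow> \<bar>f x\<bar> \<le> t" by (auto simp: bdd_above_def)
    then show ?thesis by (intro exI[of _ "max s t"]) auto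
  qed
  \<comment> \<open>A state (t, h, n) records the region where |f| <= t, on which h is final, and the index n of a measure that is supported there.\<close>
  define P where "P k = (\<lambda>(t::real, h, n). continuous_map X euclideanreal h \<and>
      (\<forall>x. c n x \<noteq> 0 \<longrightarrow> \<bar>f x\<bar> \<le> t) \<and> pairing (c n) h = real k)" for k
  define Q where "Q = (\<lambda>(t::real, h, n::nat) (t', h'::'a \<Rightarrow> real, n'::nat).
      t' \<ge> t + 1 \<and> (\<forall>x\<in>topspace X. \<bar>f x\<bar> \<le> t \<longrightarrow> h' x = h x))"
  have "\<exists>s. \<forall>k. P k (s k) \<and> Q (s k) (s (Suc k))"
  proof (rule dependent_nat_choice)
    obtain t where "\<forall>x. c 0 x \<noteq> 0 \<longrightarrow> \<bar>f x\<bar> \<le> t" using ub by blast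
    then have "P 0 (t, \<lambda>x. 0, 0)" by (simp add: P_def pairing_def)
    then show "\<exists>x. P 0 x" by blast
  next
    fix s k assume "P k s"
    then obtain t h n where s: "s = (t,h,n)" and h: "continuous_map X euclideanreal h"
      by (auto simp: P_def)
    obtain n' x where x: "c n' x \<noteq> 0" "\<bar>f x\<bar> > t" using unb by blast
    have clo: "closedin X {y \<in> topspace X. \<bar>f y\<bar> \<in> {..t}}"
      by (rule closedin_continuous_map_preimage[of X euclideanreal])
         (use f in \<open>auto intro!: continuous_map_real_abs\<close>)
    obtain g where g: "continuous_map X euclideanreal g" "g x = 1"
        "\<And>y. y \<in> {y \<in> topspace X. \<bar>f y\<bar> \<in> {..t}} \<union> ({y. c n' y \<noteq> 0} - {x}) \<Longrightarrow> g y = 0"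
      by (rule tychonoff_vanish_off_point[OF X clo, of "{y. c n' y \<noteq> 0} - {x}" x])
         (use x fin supp in auto)
    \<comment> \<open>On the support of the new measure g is the indicator of x, so this multiple of g corrects the value on h to k + 1.\<close>
    define a where "a = (real (Suc k) - pairing (c n') h) / c n' x"
    obtain t' where t': "t' \<ge> t + 1" "\<forall>y. c n' y \<noteq> 0 \<longrightarrow> \<bar>f y\<bar> \<le> t'" using ub by blast
    have "pairing (c n') g = (\<Sum>y\<in>{x}. c n' y * g y)"
      unfolding pairing_def by (rule sum.mono_neutral_right) (use fin x g(3) in auto)
    then have "pairing (c n') (\<lambda>y. h y + a * g y) = real (Suc k)"
      using x by (simp only: pairing_add pairing_scale) (simp add: g(2) a_def)
    moreover have "continuous_map X euclideanreal (\<lambda>y. h y + a * g y)"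
      using h g(1) by (intro continuous_intros)
    ultimately have "P (Suc k) (t', \<lambda>y. h y + a * g y, n')" "Q s (t', \<lambda>y. h y + a * g y, n')"
      using t' g(3) by (auto simp: P_def Q_def s)
    then show "\<exists>s'. P (Suc k) s' \<and> Q s s'" by blast
  qed
  then obtain s where s: "\<forall>k. P k (s k) \<and> Q (s k) (s (Suc k))" by (rule exE)
  define T H N where "T k = fst (s k)" and "H k = fst (snd (s k))" and "N k = snd (snd (s k))" for k
  have sk: "s k = (T k, H k, N k)" for k by (simp add: T_def H_def N_def)
  have PQ: "P k (T k, H k, N k)" "Q (T k, H k, N k) (T (Suc k), H (Suc k), N (Suc k))" for k
    using s sk by metis+
  have H: "continuous_map X euclideanreal (H k)"
    and N: "\<And>x. c (N k) x \<noteq> 0 \<Longrightarrow> \<bar>f x\<bar> \<le> T k" "pairing (c (N k)) (H k) = real k" for k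
    using PQ(1)[of k] by (simp_all add: P_def)
  have T: "T (Suc k) \<ge> T k + 1"
    and HS: "\<And>x. x \<in> topspace X \<Longrightarrow> \<bar>f x\<bar> \<le> T k \<Longrightarrow> H (Suc k) x = H k x" for k
    using PQ(2)[of k] by (simp_all add: Q_def)
  have Tge: "T k \<ge> T 0 + real k" for k
  proof (induction k)
    case (Suc k)
    then show ?case using T[of k] by simp
  qed simp
  have Tmono: "T i \<le> T j" if "i \<le> j" for i j
  proof (rule lift_Suc_mono_le[OF _ that])
    show "T n \<le> T (Suc n)" for n using T[of n] by linarith
  qed
  have Hagree: "H j x = H i x" if "x \<in> topspace X" "\<bar>f x\<bar> \<le> T i" "i \<le> j" for i j x
    using that(3)
  proof (induction j rule: dec_induct)
    case (step j)
    then show ?case using HS[of x j] that Tmono[of i j] by simp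
  qed simp
  have ex: "\<exists>k. \<bar>f x\<bar> < T k" for x
  proof -
    obtain k where "\<bar>f x\<bar> - T 0 < real k" using reals_Archimedean2 by blast
    then show ?thesis using Tge[of k] by (intro exI[of _ k]) linarith
  qed
  define K where "K x = (LEAST k. \<bar>f x\<bar> < T k)" for x
  have K: "\<bar>f x\<bar> < T (K x)" for x unfolding K_def by (rule LeastI_ex[OF ex])
  define g where "g x = H (K x) x" for x
  have gH: "g x = H k x" if "x \<in> topspace X" "\<bar>f x\<bar> \<le> T k" for x k
  proof (cases "k \<le> K x")
    case True
    then show ?thesis unfolding g_def by (rule Hagree[OF that])
  next
    case False
    then show ?thesis using Hagree[OF that(1), of "K x" k] K[of x] unfolding g_def by simp
  qed
  have "continuous_map X euclideanreal g"
  proof (rule pasting_lemma[where I=UNIV and T="\<lambda>k. {x \<in> topspace X. \<bar>f x\<bar> \<in> {..<T k}}" and f=H])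
    show "openin X {x \<in> topspace X. \<bar>f x\<bar> \<in> {..<T k}}" for k
      by (rule openin_continuous_map_preimage[of X euclideanreal])
         (use f in \<open>auto intro!: continuous_map_real_abs\<close>)
    show "continuous_map (subtopology X {x \<in> topspace X. \<bar>f x\<bar> \<in> {..<T k}}) euclideanreal (H k)" for k
      by (rule continuous_map_from_subtopology[OF H])
    show "H i x = H j x" if "x \<in> topspace X \<inter> {x \<in> topspace X. \<bar>f x\<bar> \<in> {..<T i}} \<inter> {x \<in> topspace X. \<bar>f x\<bar> \<in> {..<T j}}" for i j x
      using gH[of x i] gH[of x j] that by simp
    show "\<exists>j. j \<in> UNIV \<and> x \<in> {x \<in> topspace X. \<bar>f x\<bar> \<in> {..<T j}} \<and> g x = H j x" if "x \<in> topspace X" for x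
      using K[of x] that by (intro exI[of _ "K x"]) (simp add: g_def)
  qed
  then obtain B where B: "\<And>n. \<bar>pairing (c n) g\<bar> \<le> B" using bd by blast
  have "pairing (c (N k)) g = real k" for k
  proof -
    have "pairing (c (N k)) g = pairing (c (N k)) (H k)"
      by (rule pairing_cong) (use gH N(1) supp in blast)
    then show ?thesis using N(2) by simp
  qed
  then have "real k \<le> B" for k using B[of "N k"] by simp
  then show False using reals_Archimedean2[of B] by (meson not_less)
qed

lemma Cp_simps:
  "vzero (Cp X) = (\<lambda>x\<in>topspace X. 0)"
  "vadd (Cp X) f g = (\<lambda>x\<in>topspace X. f x + g x)"
  "vscale (Cp X) a f = (\<lambda>x\<in>topspace X. a * f x)"
  by (simp_all add: Cp_def)

lemma restrict_in_Cp:
  "continuous_map X euclideanreal f \<Longrightarrow> restrict f (topspace X) \<in> vcarrier (Cp X)"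
  using continuous_map_eq[of X euclideanreal f "restrict f (topspace X)"] by (simp add: vcarrier_Cp)

lemma Cp_continuous: "f \<in> vcarrier (Cp X) \<Longrightarrow> continuous_map X euclideanreal f"
  by (simp add: vcarrier_Cp)

lemma Cp_neighbourhood:
  assumes U: "openin (vtop (Cp X)) U" and f: "f \<in> U"
  obtains F e where "finite F" "F \<subseteq> topspace X" "0 < e"
    "\<And>g. g \<in> vcarrier (Cp X) \<Longrightarrow> (\<And>x. x \<in> F \<Longrightarrow> \<bar>g x - f x\<bar> < e) \<Longrightarrow> g \<in> U"
proof -
  obtain W where W: "openin (powertop_real (topspace X)) W" "U = W \<inter> {f. continuous_map X euclideanreal f}"
    using U by (auto simp: Cp_def openin_subtopology)
  then obtain V where V: "finite {i \<in> topspace X. V i \<noteq> UNIV}" "\<And>i. i \<in> topspace X \<Longrightarrow> open (V i)"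
      "f \<in> Pi\<^sub>E (topspace X) V" "Pi\<^sub>E (topspace X) V \<subseteq> W"
    using f by (auto simp: openin_product_topology_alt)
  let ?F = "{i \<in> topspace X. V i \<noteq> UNIV}"
  have "\<exists>e>0. \<forall>y. \<bar>y - f i\<bar> < e \<longrightarrow> y \<in> V i" if "i \<in> topspace X" for i
    using V(2)[OF that] V(3) that by (metis PiE_mem dist_real_def open_dist)
  then obtain e where e: "\<And>i. i \<in> topspace X \<Longrightarrow> e i > 0"
      "\<And>i y. i \<in> topspace X \<Longrightarrow> \<bar>y - f i\<bar> < e i \<Longrightarrow> y \<in> V i" by metis
  show thesis
  proof
    show "0 < Min (insert 1 (e ` ?F))" using V(1) e(1) by (subst Min_gr_iff) auto
    fix g assume g: "g \<in> vcarrier (Cp X)" "\<And>x. x \<in> ?F \<Longrightarrow> \<bar>g x - f x\<bar> < Min (insert 1 (e ` ?F))"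
    have "g i \<in> V i" if "i \<in> topspace X" for i
    proof (cases "V i = UNIV")
      case False
      then have "Min (insert 1 (e ` ?F)) \<le> e i" using V(1) that by (intro Min_le) auto
      then show ?thesis using g(2)[of i] e(2)[OF that] False that by auto
    qed simp
    then show "g \<in> U" using V(4) W(2) g(1) by (auto simp: vcarrier_Cp PiE_def)
  qed (use V(1) in auto)
qed

lemma continuous_map_Cp_eval:
  assumes "x \<in> topspace X"
  shows "continuous_map (vtop (Cp X)) euclideanreal (\<lambda>f. f x)"
  unfolding Cp_def
  using continuous_map_product_projection[of x "topspace X" "\<lambda>_. euclideanreal"] assms
  by (simp add: continuous_map_from_subtopology)

lemma continuous_map_pairing:
  assumes "fin_measure X c"
  shows "continuous_map (vtop (Cp X)) euclideanreal (pairing c)"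
proof -
  have "continuous_map (vtop (Cp X)) euclideanreal (\<lambda>f. \<Sum>x | c x \<noteq> 0. c x * f x)"
    using assms by (intro continuous_intros continuous_map_Cp_eval) (auto simp: fin_measure_def)
  then show ?thesis by (simp add: pairing_def[abs_def])
qed

text \<open>Near 0 a continuous functional is bounded on a basic neighbourhood, which restricts only the values
  on a finite set F. By homogeneity it vanishes on every function vanishing on F, so it is
  determined by its values on functions dual to the points of F.\<close>

lemma Cp_functional_is_measure:
  assumes X: "tychonoff_space X"
    and cont: "continuous_map (vtop (Cp X)) euclideanreal \<phi>"
    and add: "\<And>f g. f \<in> vcarrier (Cp X) \<Longrightarrow> g \<in> vcarrier (Cp X) \<Longrightarrow> \<phi> (vadd (Cp X) f g) = \<phi> f + \<phi> g"
    and scale: "\<And>a f. f \<in> vcarrier (Cp X) \<Longrightarrow> \<phi> (vscale (Cp X) a f) = a * \<phi> f"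
  obtains c where "fin_measure X c" "\<And>f. f \<in> vcarrier (Cp X) \<Longrightarrow> \<phi> f = pairing c f"
proof -
  let ?V = "Cp X"
  let ?r = "\<lambda>f. restrict f (topspace X)"
  have add': "\<phi> (?r (\<lambda>x. f x + g x)) = \<phi> (?r f) + \<phi> (?r g)"
    if "continuous_map X euclideanreal f" "continuous_map X euclideanreal g" for f g
    using add[OF restrict_in_Cp[OF that(1)] restrict_in_Cp[OF that(2)]] by (simp add: Cp_simps cong: restrict_cong)
  have scale': "\<phi> (?r (\<lambda>x. a * f x)) = a * \<phi> (?r f)" if "continuous_map X euclideanreal f" for a f
    using scale[OF restrict_in_Cp[OF that]] by (simp add: Cp_simps cong: restrict_cong)
  have zero: "\<phi> (?r (\<lambda>x. 0)) = 0" using scale'[of "\<lambda>x. 0" 0] by simp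
  have sum': "\<phi> (?r (\<lambda>x. \<Sum>i\<in>I. a i * g i x)) = (\<Sum>i\<in>I. a i * \<phi> (?r (g i)))"
    if "finite I" "\<And>i. i \<in> I \<Longrightarrow> continuous_map X euclideanreal (g i)" for I and a :: "'a \<Rightarrow> real" and g
    using that
  proof (induction I rule: finite_induct)
    case (insert i I)
    have "continuous_map X euclideanreal (\<lambda>x. \<Sum>i\<in>I. a i * g i x)"
      using insert by (intro continuous_intros) auto
    moreover have "continuous_map X euclideanreal (\<lambda>x. a i * g i x)"
      using insert by (intro continuous_intros) auto
    ultimately have "\<phi> (?r (\<lambda>x. a i * g i x + (\<Sum>i\<in>I. a i * g i x))) =
        \<phi> (?r (\<lambda>x. a i * g i x)) + \<phi> (?r (\<lambda>x. \<Sum>i\<in>I. a i * g i x))"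
      by (rule add'[rotated])
    then show ?case using insert scale'[of "g i" "a i"] by (simp del: restrict_apply)
  qed (simp add: zero)
  have op: "openin (vtop ?V) {f \<in> vcarrier ?V. \<phi> f \<in> {-1<..<1}}"
    by (rule openin_continuous_map_preimage[OF cont]) simp
  have z: "?r (\<lambda>x. 0) \<in> {f \<in> vcarrier ?V. \<phi> f \<in> {-1<..<1}}"
    using zero by (simp add: restrict_in_Cp)
  obtain F e where F: "finite F" "F \<subseteq> topspace X" "0 < e" and
    e: "\<And>g. g \<in> vcarrier ?V \<Longrightarrow> (\<And>x. x \<in> F \<Longrightarrow> \<bar>g x - ?r (\<lambda>x. 0) x\<bar> < e) \<Longrightarrow>
          g \<in> {f \<in> vcarrier ?V. \<phi> f \<in> {-1<..<1}}"
    by (rule Cp_neighbourhood[OF op z]) blast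
  have vanish: "\<phi> (?r f) = 0" if f: "continuous_map X euclideanreal f" "\<And>x. x \<in> F \<Longrightarrow> f x = 0" for f
  proof (rule ccontr)
    assume nz: "\<phi> (?r f) \<noteq> 0"
    let ?g = "?r (\<lambda>x. (1 / \<phi> (?r f)) * f x)"
    have "?g \<in> {f \<in> vcarrier ?V. \<phi> f \<in> {-1<..<1}}"
    proof (rule e)
      show "?g \<in> vcarrier ?V" by (intro restrict_in_Cp continuous_map_real_mult f(1)) simp
    qed (use f(2) F in auto)
    moreover have "\<phi> ?g = 1" using scale'[OF f(1), of "1 / \<phi> (?r f)"] nz by simp
    ultimately show False by simp
  qed
  have "\<exists>g. continuous_map X euclideanreal g \<and> (\<forall>y\<in>F. g y = (if y = x then 1 else 0))" for x
    by (rule tychonoff_interpolation[OF X F(1,2), of "\<lambda>y. if y = x then 1 else 0"]) blast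
  then obtain g where g: "\<And>x. continuous_map X euclideanreal (g x)"
     "\<And>x y. y \<in> F \<Longrightarrow> g x y = (if y = x then 1 else 0)" by metis
  define c where "c x = (if x \<in> F then \<phi> (?r (g x)) else 0)" for x
  have cF: "{x. c x \<noteq> 0} \<subseteq> F" by (auto simp: c_def)
  show thesis
  proof
    show "fin_measure X c" using cF F finite_subset unfolding fin_measure_def by blast
    fix f assume f: "f \<in> vcarrier ?V"
    let ?d = "\<lambda>y. f y + (- 1) * (\<Sum>x\<in>F. f x * g x y)"
    have cs: "continuous_map X euclideanreal (\<lambda>y. \<Sum>x\<in>F. f x * g x y)"
      using F g(1) by (intro continuous_intros) auto
    have cf: "continuous_map X euclideanreal f" using f by (rule Cp_continuous)
    have "\<phi> (?r ?d) = 0"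
    proof (rule vanish)
      show "continuous_map X euclideanreal ?d" by (intro continuous_intros cs cf)
      fix y assume y: "y \<in> F"
      have "(\<Sum>x\<in>F. f x * g x y) = (\<Sum>x\<in>F. if y = x then f y else 0)"
        by (rule sum.cong) (use g(2)[OF y] in auto)
      then show "?d y = 0" using F y by simp
    qed
    also have "\<phi> (?r ?d) = \<phi> (?r f) - (\<Sum>x\<in>F. f x * \<phi> (?r (g x)))"
      using add'[OF cf, of "\<lambda>y. (- 1) * (\<Sum>x\<in>F. f x * g x y)"] scale'[OF cs, of "-1"] cs sum'[OF F(1), of g f] g(1)
      by (simp add: continuous_map_minus)
    finally show "\<phi> f = pairing c f"
      using f unfolding pairing_superset[OF F(1) cF]
      by (simp add: c_def[abs_def] vcarrier_Cp extensional_restrict mult.commute)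
  qed
qed

text \<open>The coordinates of a continuous linear surjection onto c_0 are measures c_n that tend to 0 on every
  function, and the c_n divided by their norms are the required sequence as soon as the norms w_n
  stay away from 0. If they did not, the running minima m_n of the w_n would tend to 0 and the
  sequence sqrt(m_n) would lie in c_0, hence be the image of some f. At an index with w_n = m_n the
  estimate |c_n(f)| <= w_n sup |f| fails once w_n is small; the supremum is over the supports only and
  is finite by \<open>bounded_on_supports\<close>.\<close>

lemma c0_image_imp_JNP:
  assumes X: "tychonoff_space X"
    and lin: "linear_map_on (Cp X) c0_space Q"
    and cont: "continuous_map (vtop (Cp X)) (vtop c0_space) Q"
    and surj: "Q ` vcarrier (Cp X) = vcarrier c0_space"
  shows "JNP X"
proof -
  have coord: "continuous_map (vtop c0_space) euclideanreal (\<lambda>s. s n)" for n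
    unfolding c0_space_def
    using continuous_map_product_projection[of n UNIV "\<lambda>_. euclideanreal"]
    by (simp add: continuous_map_from_subtopology)
  have "\<exists>c. fin_measure X c \<and> (\<forall>f\<in>vcarrier (Cp X). Q f n = pairing c f)" for n
  proof -
    have "continuous_map (vtop (Cp X)) euclideanreal (\<lambda>f. Q f n)"
      using continuous_map_compose[OF cont coord[of n]] by (simp add: o_def)
    then show ?thesis
      by (rule Cp_functional_is_measure[OF X])
         (use lin in \<open>auto simp: linear_map_on_def c0_space_def\<close>)
  qed
  then obtain c where c: "\<And>n. fin_measure X (c n)"
      "\<And>n f. f \<in> vcarrier (Cp X) \<Longrightarrow> Q f n = pairing (c n) f" by metis
  have fin: "finite {x. c n x \<noteq> 0}" for n using c fin_measure_finite by blast
  have onto: "\<exists>f. continuous_map X euclideanreal f \<and> (\<forall>n. pairing (c n) f = s n)" if "s \<longlonglongrightarrow> 0" for s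
  proof -
    have "s \<in> Q ` vcarrier (Cp X)" using that surj by (simp add: vcarrier_c0_space)
    then show ?thesis using c(2) Cp_continuous by fastforce
  qed
  have null: "(\<lambda>n. pairing (c n) f) \<longlonglongrightarrow> 0" if "continuous_map X euclideanreal f" for f
  proof -
    have r: "restrict f (topspace X) \<in> vcarrier (Cp X)" using that by (rule restrict_in_Cp)
    then have "Q (restrict f (topspace X)) \<in> vcarrier c0_space" using surj by blast
    moreover have "Q (restrict f (topspace X)) = (\<lambda>n. pairing (c n) f)"
      using c(2)[OF r] pairing_restrict[OF c(1), of _ f] by (intro ext) (simp only:)
    ultimately show ?thesis by (simp add: vcarrier_c0_space)
  qed
  have bdd: "\<exists>K. \<forall>n. \<bar>pairing (c n) f\<bar> \<le> K" if "continuous_map X euclideanreal f" for f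
    using convergent_imp_Bseq[OF convergentI[OF null[OF that]]] by (auto simp: Bseq_def)
  define w where "w n = mass (c n) UNIV" for n
  have wpos: "w n > 0" for n
  proof -
    have "(\<lambda>k. if k = n then 1 else 0 :: real) \<longlonglongrightarrow> 0"
      by (rule tendsto_eventually) (use eventually_gt_at_top[of n] in \<open>eventually_elim, auto\<close>)
    from onto[OF this] obtain f where "\<forall>k. pairing (c k) f = (if k = n then 1 else 0)" by blast
    then have "pairing (c n) f = 1" by simp
    then have "\<exists>x. c n x \<noteq> 0" by (rule_tac ccontr) (simp add: pairing_def)
    then show ?thesis unfolding w_def using mass_pos_iff[OF fin] by blast
  qed
  have "\<exists>\<delta>>0. \<forall>n. \<delta> \<le> w n"
  proof (rule ccontr)
    assume "\<not> ?thesis"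
    then have small: "\<exists>n. w n < \<delta>" if "\<delta> > 0" for \<delta> using that by (meson not_le)
    \<comment> \<open>Running minima tend to 0 although the w n themselves need not.\<close>
    define m where "m n = Min (w ` {..n})" for n
    have mpos: "m n > 0" for n unfolding m_def using wpos by (subst Min_gr_iff) auto
    have mle: "m n \<le> w i" if "i \<le> n" for i n unfolding m_def using that by (intro Min_le) auto
    have "m \<longlonglongrightarrow> 0"
    proof (rule LIMSEQ_I)
      fix r :: real assume "0 < r"
      then obtain n where "w n < r" using small by blast
      then show "\<exists>no. \<forall>n\<ge>no. norm (m n - 0) < r"
        using mle[of n] mpos by (intro exI[of _ n]) (smt (verit) real_norm_def)
    qed
    then have "(\<lambda>n. sqrt (m n)) \<longlonglongrightarrow> sqrt 0" by (intro tendsto_real_sqrt)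
    then obtain f where f: "continuous_map X euclideanreal f" "\<And>n. pairing (c n) f = sqrt (m n)"
      using onto[of "\<lambda>n. sqrt (m n)"] by auto
    obtain K where K: "\<And>n x. c n x \<noteq> 0 \<Longrightarrow> \<bar>f x\<bar> \<le> K"
      using bounded_on_supports[OF X c(1) bdd f(1)] by blast
    define L where "L = max K 1"
    have "(1 / L)\<^sup>2 > 0" by (simp add: L_def)
    then obtain n where n: "w n < (1 / L)\<^sup>2" using small by blast
    have "m n \<in> w ` {..n}" unfolding m_def by (rule Min_in) auto
    then obtain i where i: "i \<le> n" "w i = m n" by auto
    have "m n = m i"
    proof (rule antisym)
      show "m n \<le> m i" unfolding m_def using i by (intro Min_antimono) auto
      show "m i \<le> m n" using mle[of i i] i by simp
    qed
    then have "sqrt (w i) = pairing (c i) f" using f(2) i by simp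
    also have "\<dots> \<le> L * w i"
    proof -
      have "\<bar>f x\<bar> \<le> L" if "c i x \<noteq> 0" for x using K[OF that] by (simp add: L_def)
      then have "\<bar>pairing (c i) f\<bar> \<le> L * w i"
        unfolding w_def by (rule abs_pairing_le_norm[OF fin]) (simp_all add: L_def)
      then show ?thesis by linarith
    qed
    also have "\<dots> = (L * sqrt (w i)) * sqrt (w i)" using wpos[of i] by simp
    finally have "1 \<le> L * sqrt (w i)" using wpos[of i] by simp
    moreover have "sqrt (w i) < 1 / L"
    proof -
      have "w i < (1/L)\<^sup>2" using n i mle[of n n] by simp
      then have "sqrt (w i) < sqrt ((1/L)\<^sup>2)" by (rule real_sqrt_less_mono)
      then show ?thesis by (simp add: L_def)
    qed
    then have "L * sqrt (w i) < 1" by (simp add: L_def field_simps)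
    ultimately show False by simp
  qed
  then obtain \<delta> where \<delta>: "\<delta> > 0" "\<And>n. \<delta> \<le> w n" by blast
  have "(\<lambda>n. pairing (\<lambda>x. 1 / w n * c n x) f) \<longlonglongrightarrow> 0" if f: "continuous_map X euclideanreal f" for f
  proof (rule Lim_null_comparison)
    show "\<forall>\<^sub>F n in sequentially. norm (pairing (\<lambda>x. 1 / w n * c n x) f) \<le> \<bar>pairing (c n) f\<bar> / \<delta>"
    proof (rule always_eventually, rule allI)
      fix n
      have "norm (pairing (\<lambda>x. 1 / w n * c n x) f) = \<bar>pairing (c n) f\<bar> / w n"
        unfolding pairing_scale_left using wpos[of n] by (simp add: abs_mult)
      also have "\<dots> \<le> \<bar>pairing (c n) f\<bar> / \<delta>" using \<delta> wpos[of n] by (intro divide_left_mono) auto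
      finally show "norm (pairing (\<lambda>x. 1 / w n * c n x) f) \<le> \<bar>pairing (c n) f\<bar> / \<delta>" .
    qed
    show "(\<lambda>n. \<bar>pairing (c n) f\<bar> / \<delta>) \<longlonglongrightarrow> 0"
      using null[OF f] by (auto intro!: tendsto_divide_zero tendsto_rabs_zero)
  qed
  moreover have "fin_measure X (\<lambda>x. 1 / w n * c n x)" for n by (rule fin_measure_scale[OF c(1)])
  moreover have "mass (\<lambda>x. 1 / w n * c n x) UNIV = 1" for n
    unfolding mass_scale using wpos[of n] by (simp add: w_def)
  ultimately show ?thesis unfolding JNP_iff weakly_null_def
    by (intro exI[of _ "\<lambda>n x. 1 / w n * c n x"]) blast
qed

section \<open>From the Josefson-Nissenzweig property to a biorthogonal system\<close>

text \<open>Sequential compactness of a countable product of intervals, in coordinates.\<close>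

lemma pointwise_convergent_subsequence:
  fixes a :: "nat \<Rightarrow> nat \<Rightarrow> real"
  assumes "\<And>n i. \<bar>a n i\<bar> \<le> B i"
  obtains r :: "nat \<Rightarrow> nat" and l where "strict_mono r" "\<And>i. (\<lambda>n. a (r n) i) \<longlonglongrightarrow> l i"
proof -
  let ?K = "PiE UNIV (\<lambda>i. {- B i..B i})"
  have "compactin (product_topology (\<lambda>_. euclidean) UNIV) ?K"
    by (subst compactin_PiE) auto
  then have "seq_compact ?K"
    by (intro compact_imp_seq_compact) (simp add: euclidean_product_topology)
  moreover have "a n \<in> ?K" for n
  proof -
    have "a n i \<in> {- B i..B i}" for i using assms[of n i] by (simp add: abs_le_iff)
    then show ?thesis by (intro PiE_I) auto
  qed
  ultimately obtain l r where r: "strict_mono r" "(a \<circ> r) \<longlonglongrightarrow> l"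
    unfolding seq_compact_def by meson
  have "(\<lambda>n. a (r n) i) \<longlonglongrightarrow> l i" for i
  proof -
    have "continuous_on UNIV (\<lambda>x::nat \<Rightarrow> real. x i)" by (rule continuous_on_product_coordinates)
    from continuous_on_tendsto_compose[OF this r(2)] show ?thesis by (simp add: o_def)
  qed
  with r(1) show thesis by (rule that)
qed

lemma weakly_null_subseq:
  assumes "weakly_null X c" "strict_mono r"
  shows "weakly_null X (\<lambda>n. c (r n))"
  unfolding weakly_null_def
proof (intro allI impI)
  fix f assume "continuous_map X euclideanreal f"
  then have "(\<lambda>n. pairing (c n) f) \<longlonglongrightarrow> 0" using assms(1) by (simp add: weakly_null_def)
  from LIMSEQ_subseq_LIMSEQ[OF this assms(2)] show "(\<lambda>n. pairing (c (r n)) f) \<longlonglongrightarrow> 0"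
    by (simp add: o_def)
qed

lemma norming_function:
  assumes X: "tychonoff_space X" and c: "fin_measure X c"
  obtains f where "continuous_map X euclideanreal f" "\<And>x. \<bar>f x\<bar> \<le> 1" "pairing c f = mass c UNIV"
proof -
  have "{x. c x \<noteq> 0} \<subseteq> topspace X" using c by (simp add: fin_measure_def)
  from tychonoff_interpolation_bounded[OF X fin_measure_finite[OF c] this, of "\<lambda>x. sgn (c x)" 1]
  obtain f where f: "continuous_map X euclideanreal f" "\<And>x. c x \<noteq> 0 \<Longrightarrow> f x = sgn (c x)" "\<And>x. \<bar>f x\<bar> \<le> 1"
    by (auto simp: abs_sgn_eq)
  have "pairing c f = mass c UNIV"
    unfolding pairing_def mass_def using f(2) by (intro sum.cong) (auto simp: abs_sgn)
  with f show thesis by (intro that)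
qed

text \<open>The supports form a countable set, so a subsequence p_n converges at every point; the differences
  of its members then tend to 0 at every point. They cannot become small in norm: a continuous f of
  modulus at most 1 that norms p_n satisfies p_n(f) = 1 and p_k(f) < 1/2 for large k, so p_k - p_n
  has norm at least 1/2 and can be normalised without losing convergence to 0.\<close>

lemma JNP_imp_pointwise_null:
  assumes X: "tychonoff_space X" and J: "JNP X"
  obtains c where "\<And>n. fin_measure X (c n)" "\<And>n. mass (c n) UNIV = 1" "weakly_null X c"
    "\<And>x. (\<lambda>n. c n x) \<longlonglongrightarrow> 0"
proof -
  obtain m where m: "\<And>n. fin_measure X (m n)" "\<And>n. mass (m n) UNIV = 1" "weakly_null X m"
    using J unfolding JNP_iff by metis
  note fin = m(1)[THEN fin_measure_finite]
  define S where "S = (\<Union>n. {x. m n x \<noteq> 0})"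
  have S: "countable S" unfolding S_def by (intro countable_UN[OF countableI_type] countable_finite fin)
  have "\<bar>m n x\<bar> \<le> 1" for n x using abs_le_mass[OF fin, of n x] m(2) by simp
  then obtain r l where r: "strict_mono r" "\<And>i. (\<lambda>n. m (r n) (from_nat_into S i)) \<longlonglongrightarrow> l i"
    using pointwise_convergent_subsequence[of "\<lambda>n i. m n (from_nat_into S i)" "\<lambda>_. 1"] by blast
  have conv: "\<exists>L. (\<lambda>n. m (r n) x) \<longlonglongrightarrow> L" for x
  proof (cases "x \<in> S")
    case True
    then show ?thesis using r(2)[of "to_nat_on S x"] S by auto
  next
    case False
    then have "(\<lambda>n. m (r n) x) = (\<lambda>n. 0)" by (auto simp: S_def)
    then show ?thesis by auto
  qed
  define p where "p n = m (r n)" for n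
  have p: "\<And>n. fin_measure X (p n)" "\<And>n. mass (p n) UNIV = 1" "weakly_null X p"
    using m r weakly_null_subseq by (auto simp: p_def[abs_def])
  note pfin = p(1)[THEN fin_measure_finite]
  have "\<exists>k>n. 1/2 \<le> mass (\<lambda>x. p k x - p n x) UNIV" for n
  proof -
    obtain f where f: "continuous_map X euclideanreal f" "\<And>x. \<bar>f x\<bar> \<le> 1" "pairing (p n) f = mass (p n) UNIV"
      using norming_function[OF X p(1)[of n]] by blast
    have "(\<lambda>k. pairing (p k) f) \<longlonglongrightarrow> 0" using p(3) f(1) by (simp add: weakly_null_def)
    then have "\<forall>\<^sub>F k in sequentially. pairing (p k) f < 1/2" by (rule order_tendstoD) simp
    with eventually_gt_at_top[of n] have "\<forall>\<^sub>F k in sequentially. k > n \<and> pairing (p k) f < 1/2"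
      by eventually_elim simp
    then obtain k where k: "k > n" "pairing (p k) f < 1/2"
      using eventually_happens trivial_limit_sequentially by blast
    have "finite {x. p k x - p n x \<noteq> 0}"
      using fin_measure_finite[OF fin_measure_diff[OF p(1) p(1)]] .
    then have "\<bar>pairing (\<lambda>x. p k x - p n x) f\<bar> \<le> 1 * mass (\<lambda>x. p k x - p n x) UNIV"
      by (rule abs_pairing_le_norm) (use f(2) in auto)
    moreover have "pairing (\<lambda>x. p k x - p n x) f = pairing (p k) f - 1"
      using pairing_diff_left[OF pfin pfin] f(3) p(2) by simp
    ultimately show ?thesis using k by (intro exI[of _ k]) auto
  qed
  then obtain s where s: "\<And>n. s n > n" "\<And>n. 1/2 \<le> mass (\<lambda>x. p (s n) x - p n x) UNIV" by metis
  have slim: "filterlim s sequentially sequentially"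
    by (rule filterlim_at_top_mono[OF filterlim_ident]) (use s(1) less_imp_le in \<open>auto intro!: always_eventually\<close>)
  define w where "w n = mass (\<lambda>x. p (s n) x - p n x) UNIV" for n
  have w: "1/2 \<le> w n" for n using s(2) by (simp add: w_def)
  define c where "c n = (\<lambda>x. (1 / w n) * (p (s n) x - p n x))" for n
  have small: "(\<lambda>n. (1 / w n) * t n) \<longlonglongrightarrow> 0" if "t \<longlonglongrightarrow> 0" for t
  proof (rule Lim_null_comparison)
    show "\<forall>\<^sub>F n in sequentially. norm ((1 / w n) * t n) \<le> 2 * \<bar>t n\<bar>"
    proof (intro always_eventually allI)
      fix n
      have "\<bar>1 / w n\<bar> \<le> 2" using w[of n] by (simp add: field_simps)
      then show "norm ((1 / w n) * t n) \<le> 2 * \<bar>t n\<bar>"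
        unfolding real_norm_def abs_mult by (rule mult_right_mono) simp
    qed
    show "(\<lambda>n. 2 * \<bar>t n\<bar>) \<longlonglongrightarrow> 0" using that by (auto intro!: tendsto_mult_right_zero tendsto_rabs_zero)
  qed
  show thesis
  proof
    show "fin_measure X (c n)" for n unfolding c_def by (intro fin_measure_scale fin_measure_diff p)
    show "mass (c n) UNIV = 1" for n
      unfolding c_def mass_scale using w[of n] by (simp add: w_def)
    show "weakly_null X c" unfolding weakly_null_def
    proof (intro allI impI)
      fix f assume "continuous_map X euclideanreal f"
      then have t: "(\<lambda>n. pairing (p n) f) \<longlonglongrightarrow> 0" using p(3) by (simp add: weakly_null_def)
      have "(\<lambda>n. pairing (p (s n)) f - pairing (p n) f) \<longlonglongrightarrow> 0 - 0"
        by (intro tendsto_diff t filterlim_compose[OF t slim])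
      then have "(\<lambda>n. (1 / w n) * (pairing (p (s n)) f - pairing (p n) f)) \<longlonglongrightarrow> 0"
        by (intro small) simp
      then show "(\<lambda>n. pairing (c n) f) \<longlonglongrightarrow> 0"
        unfolding c_def pairing_scale_left pairing_diff_left[OF pfin pfin] .
    qed
    show "(\<lambda>n. c n x) \<longlonglongrightarrow> 0" for x
    proof -
      obtain L where L: "(\<lambda>n. p n x) \<longlonglongrightarrow> L" using conv[of x] by (auto simp: p_def)
      have "(\<lambda>n. p (s n) x - p n x) \<longlonglongrightarrow> L - L"
        by (intro tendsto_diff L filterlim_compose[OF L slim])
      then show ?thesis unfolding c_def by (intro small) simp
    qed
  qed
qed

lemma mass_finite_tendsto_zero:
  assumes "finite F" and c: "\<And>x. (\<lambda>n. c n x) \<longlonglongrightarrow> 0"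
  shows "(\<lambda>n. mass (c n) F) \<longlonglongrightarrow> 0"
proof -
  have "mass (c n) F = (\<Sum>x\<in>F. \<bar>c n x\<bar>)" for n
    unfolding mass_def by (rule sum.mono_neutral_left) (use assms in auto)
  moreover have "(\<lambda>n. \<Sum>x\<in>F. \<bar>c n x\<bar>) \<longlonglongrightarrow> (\<Sum>x\<in>F. 0)"
    by (intro tendsto_sum tendsto_rabs_zero c)
  ultimately show ?thesis by simp
qed

text \<open>Finitely many points carry less and less mass, so each measure can be chosen nearly null on the
  finitely many points used before.\<close>

lemma almost_disjoint_subsequence:
  assumes fin: "\<And>n. finite {x. c n x \<noteq> 0}" and c: "\<And>x. (\<lambda>n. c n x) \<longlonglongrightarrow> 0" and e: "0 < (e::real)"
  obtains r :: "nat \<Rightarrow> nat" where "strict_mono r" "\<And>k. mass (c (r k)) (\<Union>j<k. {x. c (r j) x \<noteq> 0}) \<le> e"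
proof -
  define P where "P = (\<lambda>(n::nat, F::'a set). finite F)"
  define Q where "Q = (\<lambda>(n, F) (n', F'). n < n' \<and> F' = F \<union> {x. c n x \<noteq> 0} \<and> mass (c n') F' \<le> e)"
  have "\<exists>s. \<forall>k. P (s k) \<and> Q (s k) (s (Suc k))"
  proof (rule dependent_nat_choice)
    show "\<exists>s. P s" by (rule exI[of _ "(0, {})"]) (simp add: P_def)
  next
    fix s and k :: nat assume "P s"
    then obtain n F where s: "s = (n, F)" "finite F" by (auto simp: P_def)
    let ?F = "F \<union> {x. c n x \<noteq> 0}"
    have "\<forall>\<^sub>F n' in sequentially. mass (c n') ?F < e"
      by (rule order_tendstoD[OF mass_finite_tendsto_zero]) (use s fin c e in auto)
    with eventually_gt_at_top[of n] have "\<forall>\<^sub>F n' in sequentially. n < n' \<and> mass (c n') ?F \<le> e"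
      by eventually_elim simp
    then obtain n' where "n < n'" "mass (c n') ?F \<le> e"
      using eventually_happens trivial_limit_sequentially by blast
    then show "\<exists>s'. P s' \<and> Q s s'"
      using fin s by (intro exI[of _ "(n', ?F)"]) (simp add: P_def Q_def)
  qed
  then obtain s where s: "\<forall>k. P (s k) \<and> Q (s k) (s (Suc k))" by (rule exE)
  define R G where "R k = fst (s k)" and "G k = snd (s k)" for k
  have "Q (R k, G k) (R (Suc k), G (Suc k))" for k using s by (simp add: R_def G_def)
  then have R: "R k < R (Suc k)" and G: "G (Suc k) = G k \<union> {x. c (R k) x \<noteq> 0}"
    and m: "mass (c (R (Suc k))) (G (Suc k)) \<le> e" for k
    unfolding Q_def prod.case by blast+
  have sub: "(\<Union>j<k. {x. c (R j) x \<noteq> 0}) \<subseteq> G k" for k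
  proof (induction k)
    case (Suc k)
    then show ?case unfolding lessThan_Suc G[of k] by blast
  qed simp
  show thesis
  proof
    show "strict_mono R" using R by (simp add: strict_mono_Suc_iff)
    show "mass (c (R k)) (\<Union>j<k. {x. c (R j) x \<noteq> 0}) \<le> e" for k
    proof (cases k)
      case 0
      then show ?thesis using e by (simp add: mass_def)
    next
      case (Suc k')
      have "mass (c (R k)) (\<Union>j<k. {x. c (R j) x \<noteq> 0}) \<le> mass (c (R k)) (G k)"
        by (rule mass_mono[OF fin]) (use sub[of k] in blast)
      then show ?thesis using m[of k'] Suc by simp
    qed
  qed
qed

text \<open>One hump. A is the set of indices still available and h, with values in [0,1], marks the region
  still available: a new hump must live where h is nonzero, and the remaining measures have mass at
  most beta where h differs from 1. Choosing the next index in A arbitrarily would not do, because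
  the later measures may crowd around its support. Instead N candidates are taken at once, their
  essential supports G_i are separated by disjoint tents p_i, and every later measure is light
  on at least one tent; by the pigeonhole principle one tent is light for infinitely many indices, and
  this is the one to use. The new hump f lives where its tent exceeds 1/2, the new region h' where
  the tent is below 1/2, so all later humps are disjoint from f.\<close>

lemma gliding_hump_step:
  fixes c :: "nat \<Rightarrow> 'a \<Rightarrow> real"
  assumes X: "tychonoff_space X" and c: "\<And>n. fin_measure X (c n)" "\<And>n. mass (c n) UNIV = 1"
    and old: "\<And>n. mass (c n) (\<Union>j<n. {x. c j x \<noteq> 0}) \<le> 1/8"
    and A: "infinite A" and h: "continuous_map X euclideanreal h"
    and hm: "\<And>m. m \<in> A \<Longrightarrow> mass (c m) {x. h x \<noteq> 1} \<le> \<beta>" and \<beta>: "\<beta> \<le> 1/8"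
    and h01: "\<And>x. 0 \<le> h x \<and> h x \<le> 1" and N: "0 < N"
  obtains n A' f h' where "n \<in> A" "A' \<subseteq> A" "infinite A'" "\<And>m. m \<in> A' \<Longrightarrow> n < m"
    "continuous_map X euclideanreal f" "\<And>x. \<bar>f x\<bar> \<le> 1" "\<And>x. f x \<noteq> 0 \<Longrightarrow> h x \<noteq> 0"
    "\<And>j x. j < n \<Longrightarrow> c j x \<noteq> 0 \<Longrightarrow> f x = 0" "3/4 \<le> pairing (c n) f"
    "\<And>m. m \<in> A' \<Longrightarrow> mass (c m) {x. f x \<noteq> 0} \<le> 1 / real N"
    "continuous_map X euclideanreal h'" "\<And>x. 0 \<le> h' x \<and> h' x \<le> 1"
    "\<And>x. h' x \<noteq> 0 \<Longrightarrow> h x \<noteq> 0 \<and> f x = 0"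
    "\<And>m. m \<in> A' \<Longrightarrow> mass (c m) {x. h' x \<noteq> 1} \<le> \<beta> + 1 / real N"
proof -
  have fin: "finite {x. c n x \<noteq> 0}" for n using c fin_measure_finite by blast
  have supp: "{x. c n x \<noteq> 0} \<subseteq> topspace X" for n using c(1) by (simp add: fin_measure_def)
  \<comment> \<open>G n is the part of the support of c n that is new and freely available; it carries most of the mass, and these sets are pairwise disjoint.\<close>
  define G where "G n = {x. c n x \<noteq> 0} \<inter> {x. h x = 1} - (\<Union>j<n. {x. c j x \<noteq> 0})" for n
  have Gfin: "finite (G n)" for n using fin by (simp add: G_def)
  have Gdisj: "i = j" if "x \<in> G i" "x \<in> G j" for i j x
    using that linorder_less_linear[of i j] by (auto simp: G_def)
  obtain I where I: "finite I" "card I = N" "I \<subseteq> A"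
    using infinite_arbitrarily_large[OF A] by blast
  have "\<exists>u. continuous_map X euclideanreal u \<and> (\<forall>i\<in>I. \<forall>x\<in>G i. u x = real i)"
  proof -
    have 1: "finite (\<Union>i\<in>I. G i)" "(\<Union>i\<in>I. G i) \<subseteq> topspace X"
      using I Gfin supp by (auto simp: G_def)
    obtain u where u: "continuous_map X euclideanreal u"
        "\<And>x. x \<in> (\<Union>i\<in>I. G i) \<Longrightarrow> u x = real (SOME i. i \<in> I \<and> x \<in> G i)"
      using tychonoff_interpolation[OF X 1, of "\<lambda>x. real (SOME i. i \<in> I \<and> x \<in> G i)"] by blast
    have "u x = real i" if "i \<in> I" "x \<in> G i" for i x
    proof -
      have "(SOME i. i \<in> I \<and> x \<in> G i) = i" by (rule some_equality) (use that Gdisj in auto)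
      then show ?thesis using u(2)[of x] that by auto
    qed
    then show ?thesis using u(1) by blast
  qed
  then obtain u where u: "continuous_map X euclideanreal u" "\<And>i x. i \<in> I \<Longrightarrow> x \<in> G i \<Longrightarrow> u x = real i"
    by blast
  \<comment> \<open>A single function u with value i on G i yields all the tents; those of different integers are disjoint.\<close>
  define p where "p i x = max 0 (1 - 2 * \<bar>u x - real i\<bar>)" for i x
  have pc: "continuous_map X euclideanreal (p i)" for i
    unfolding p_def using u(1) by (intro continuous_intros) auto
  have p01: "0 \<le> p i x \<and> p i x \<le> 1" for i x by (auto simp: p_def)
  have pdisj: "i = j" if "p i x \<noteq> 0" "p j x \<noteq> 0" for i j x
  proof -
    have "\<bar>u x - real i\<bar> < 1/2" "\<bar>u x - real j\<bar> < 1/2"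
      using that by (auto simp: p_def max_def split: if_splits)
    then have "\<bar>real i - real j\<bar> < 1" by linarith
    then show ?thesis by linarith
  qed
  have pG: "p i x = 1" if "i \<in> I" "x \<in> G i" for i x using u(2)[OF that] by (simp add: p_def)
  have light: "\<exists>i\<in>I. mass (c m) {x. p i x \<noteq> 0} \<le> 1 / real N" for m
  proof (rule ccontr)
    assume "\<not> ?thesis"
    then have "1 / real N < mass (c m) {x. p i x \<noteq> 0}" if "i \<in> I" for i using that by auto
    moreover have "I \<noteq> {}" using I N by auto
    ultimately have "(\<Sum>i\<in>I. 1 / real N) < (\<Sum>i\<in>I. mass (c m) {x. p i x \<noteq> 0})"
      using I(1) by (intro sum_strict_mono) auto
    also have "\<dots> \<le> mass (c m) UNIV"
      by (rule sum_mass_disjoint_le[OF fin I(1)]) (use pdisj in blast)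
    finally show False using I(2) N c(2) by simp
  qed
  have "\<exists>i\<in>I. infinite {m \<in> A. mass (c m) {x. p i x \<noteq> 0} \<le> 1 / real N}"
  proof (rule ccontr)
    assume "\<not> ?thesis"
    then have "finite (\<Union>i\<in>I. {m \<in> A. mass (c m) {x. p i x \<noteq> 0} \<le> 1 / real N})" using I(1) by blast
    moreover have "A \<subseteq> (\<Union>i\<in>I. {m \<in> A. mass (c m) {x. p i x \<noteq> 0} \<le> 1 / real N})" using light by blast
    ultimately show False using A finite_subset by blast
  qed
  then obtain n where n: "n \<in> I" and inf: "infinite {m \<in> A. mass (c m) {x. p n x \<noteq> 0} \<le> 1 / real N}"
    by blast
  define A' where "A' = {m \<in> A. mass (c m) {x. p n x \<noteq> 0} \<le> 1 / real N} - {..n}"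
  define F where "F = {x. c n x \<noteq> 0} \<union> (\<Union>j<n. {x. c j x \<noteq> 0})"
  have F: "finite F" "F \<subseteq> topspace X" using fin supp by (auto simp: F_def)
  obtain w where w: "continuous_map X euclideanreal w"
      "\<And>x. x \<in> F \<Longrightarrow> w x = (if x \<in> G n then sgn (c n x) else 0)" "\<And>x. \<bar>w x\<bar> \<le> 1"
    by (rule tychonoff_interpolation_bounded[OF X F, of "\<lambda>x. if x \<in> G n then sgn (c n x) else 0" 1])
       (auto simp: abs_sgn_eq)
  define f where "f x = w x * (max 0 (2 * p n x - 1) * h x)" for x
  define h' where "h' x = h x * max 0 (1 - 2 * p n x)" for x
  have fp: "p n x > 1/2 \<and> h x \<noteq> 0 \<and> w x \<noteq> 0" if "f x \<noteq> 0" for x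
    using that by (auto simp: f_def max_def split: if_splits)
  have fG: "f x = sgn (c n x)" if "x \<in> G n" for x
    using pG[OF n that] w(2)[of x] that by (simp add: f_def F_def G_def)
  have f0: "f x = 0" if "x \<in> F" "x \<notin> G n" for x using w(2)[OF that(1)] that(2) by (simp add: f_def)
  show thesis
  proof
    show "n \<in> A" using n I by blast
    show "A' \<subseteq> A" by (auto simp: A'_def)
    show "infinite A'" unfolding A'_def using inf by (rule Diff_infinite_finite[rotated]) simp
    show "n < m" if "m \<in> A'" for m using that by (auto simp: A'_def)
    show "continuous_map X euclideanreal f"
      unfolding f_def using w(1) pc h by (intro continuous_intros) auto
    show "\<bar>f x\<bar> \<le> 1" for x
    proof -
      have "\<bar>w x\<bar> * \<bar>max 0 (2 * p n x - 1) * h x\<bar> \<le> 1 * 1"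
        using w(3)[of x] p01[of n x] h01[of x]
        by (intro mult_mono) (auto simp: abs_mult intro!: mult_le_one)
      then show ?thesis by (simp add: f_def abs_mult)
    qed
    show "h x \<noteq> 0" if "f x \<noteq> 0" for x using fp[OF that] by simp
    show "f x = 0" if "j < n" "c j x \<noteq> 0" for j x
    proof (rule f0)
      show "x \<in> F" using that by (auto simp: F_def)
      show "x \<notin> G n" using that by (auto simp: G_def)
    qed
    show "3/4 \<le> pairing (c n) f"
    proof -
      have "pairing (c n) f = (\<Sum>x\<in>{x. c n x \<noteq> 0} \<inter> G n. c n x * f x)"
        unfolding pairing_def by (rule sum.mono_neutral_right) (use fin f0 in \<open>auto simp: F_def\<close>)
      also have "\<dots> = mass (c n) (G n)"
        unfolding mass_def by (rule sum.cong) (auto simp: fG abs_sgn)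
      finally have 1: "pairing (c n) f = mass (c n) (G n)" .
      have "1 = mass (c n) UNIV" using c(2) by simp
      also have "\<dots> \<le> mass (c n) (G n \<union> ((\<Union>j<n. {x. c j x \<noteq> 0}) \<union> {x. h x \<noteq> 1}))"
        by (rule mass_mono[OF fin]) (auto simp: G_def)
      also have "\<dots> \<le> mass (c n) (G n) + mass (c n) ((\<Union>j<n. {x. c j x \<noteq> 0}) \<union> {x. h x \<noteq> 1})"
        by (rule mass_Un_le[OF fin])
      also have "mass (c n) ((\<Union>j<n. {x. c j x \<noteq> 0}) \<union> {x. h x \<noteq> 1}) \<le>
          mass (c n) (\<Union>j<n. {x. c j x \<noteq> 0}) + mass (c n) {x. h x \<noteq> 1}"
        by (rule mass_Un_le[OF fin])
      finally have "1 \<le> mass (c n) (G n) + 1/8 + \<beta>" using old[of n] hm[of n] n I by auto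
      then show ?thesis using 1 \<beta> by simp
    qed
    show "mass (c m) {x. f x \<noteq> 0} \<le> 1 / real N" if "m \<in> A'" for m
    proof -
      have "mass (c m) {x. f x \<noteq> 0} \<le> mass (c m) {x. p n x \<noteq> 0}"
        by (rule mass_mono[OF fin]) (use fp in fastforce)
      then show ?thesis using that by (auto simp: A'_def)
    qed
    show "continuous_map X euclideanreal h'"
      unfolding h'_def using pc h by (intro continuous_intros) auto
    show "0 \<le> h' x \<and> h' x \<le> 1" for x
      using p01[of n x] h01[of x] unfolding h'_def by (auto intro!: mult_le_one)
    show "h x \<noteq> 0 \<and> f x = 0" if "h' x \<noteq> 0" for x
    proof -
      have "h x \<noteq> 0" "p n x < 1/2" using that by (auto simp: h'_def max_def split: if_splits)
      then show ?thesis using fp[of x] by auto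
    qed
    show "mass (c m) {x. h' x \<noteq> 1} \<le> \<beta> + 1 / real N" if "m \<in> A'" for m
    proof -
      have "mass (c m) {x. h' x \<noteq> 1} \<le> mass (c m) ({x. h x \<noteq> 1} \<union> {x. p n x \<noteq> 0})"
        by (rule mass_mono[OF fin]) (auto simp: h'_def)
      also have "\<dots> \<le> mass (c m) {x. h x \<noteq> 1} + mass (c m) {x. p n x \<noteq> 0}"
        by (rule mass_Un_le[OF fin])
      finally show ?thesis using that hm[of m] by (auto simp: A'_def)
    qed
  qed
qed

text \<open>Iterating the step with N = 2^(k+4) keeps the total mass lost to earlier humps below 1/8. The
  matrix of the measures against the humps is then lower triangular, with diagonal at least 3/4 and
  geometrically small entries below it.\<close>

lemma gliding_hump:
  fixes c :: "nat \<Rightarrow> 'a \<Rightarrow> real"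
  assumes X: "tychonoff_space X" and c: "\<And>n. fin_measure X (c n)" "\<And>n. mass (c n) UNIV = 1"
    and old: "\<And>n. mass (c n) (\<Union>j<n. {x. c j x \<noteq> 0}) \<le> 1/8"
  obtains n :: "nat \<Rightarrow> nat" and f where "strict_mono n" "\<And>k. continuous_map X euclideanreal (f k)" "\<And>k x. \<bar>f k x\<bar> \<le> 1"
    "\<And>j k x. f j x \<noteq> 0 \<Longrightarrow> f k x \<noteq> 0 \<Longrightarrow> j = k" "\<And>k. 3/4 \<le> pairing (c (n k)) (f k)"
    "\<And>j k. j < k \<Longrightarrow> pairing (c (n j)) (f k) = 0"
    "\<And>j k. j < k \<Longrightarrow> \<bar>pairing (c (n k)) (f j)\<bar> \<le> (1/2) ^ j / 16"
proof -
  have fin: "finite {x. c n x \<noteq> 0}" for n using c fin_measure_finite by blast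
  define P where "P k = (\<lambda>(A, h, n::nat, f::'a \<Rightarrow> real). infinite A \<and> continuous_map X euclideanreal h \<and>
      (\<forall>x. 0 \<le> h x \<and> h x \<le> 1) \<and> (\<forall>m\<in>A. mass (c m) {x. h x \<noteq> 1} \<le> (1 - (1/2)^k) / 8))" for k
  define Q where "Q k = (\<lambda>(A, h, n::nat, f::'a \<Rightarrow> real) (A', h', n', f'). n' \<in> A \<and> A' \<subseteq> A \<and>
      (\<forall>m\<in>A'. n' < m) \<and> continuous_map X euclideanreal f' \<and> (\<forall>x. \<bar>f' x\<bar> \<le> 1) \<and>
      (\<forall>x::'a. f' x \<noteq> 0 \<longrightarrow> h x \<noteq> (0::real)) \<and> (\<forall>j x. j < n' \<longrightarrow> c j x \<noteq> 0 \<longrightarrow> f' x = 0) \<and>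
      3/4 \<le> pairing (c n') f' \<and> (\<forall>m\<in>A'. mass (c m) {x. f' x \<noteq> 0} \<le> (1/2)^k/16) \<and>
      (\<forall>x. h' x \<noteq> (0::real) \<longrightarrow> h x \<noteq> 0 \<and> f' x = 0))" for k :: nat
  \<comment> \<open>Stages are chosen one by one; the state at stage k + 1 contains the k-th hump and its index, so the components n and f of the initial state are dummies.\<close>
  have "\<exists>s. \<forall>k. P k (s k) \<and> Q k (s k) (s (Suc k))"
  proof (rule dependent_nat_choice)
    have "P 0 (UNIV, \<lambda>x. 1, 0, \<lambda>x. 0)" by (simp add: P_def mass_def)
    then show "\<exists>s. P 0 s" by blast
  next
    fix s k assume Ps: "P k s"
    obtain A h n f where s: "s = (A, h, n, f)" by (rule prod_cases4)
    have A: "infinite A" and h: "continuous_map X euclideanreal h" and h01: "\<And>x. 0 \<le> h x \<and> h x \<le> 1"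
      and hm: "\<And>m. m \<in> A \<Longrightarrow> mass (c m) {x. h x \<noteq> 1} \<le> (1 - (1/2)^k) / 8"
      using Ps by (simp_all add: P_def s)
    \<comment> \<open>The bound (1 - (1/2)^k)/8 leaves room for exactly (1/2)^k/16 = 1/2^(k+4) at stage k.\<close>
    have N: "0 < (2::nat) ^ (k + 4)" by simp
    have e: "1 / real (2 ^ (k + 4)) = (1/2)^k / 16" by (simp add: power_add power_divide)
    obtain n' A' f' h' where 1: "n' \<in> A" "A' \<subseteq> A" "infinite A'" "\<And>m. m \<in> A' \<Longrightarrow> n' < m"
      "continuous_map X euclideanreal f'" "\<And>x. \<bar>f' x\<bar> \<le> 1" "\<And>x. f' x \<noteq> 0 \<Longrightarrow> h x \<noteq> 0"
      "\<And>j x. j < n' \<Longrightarrow> c j x \<noteq> 0 \<Longrightarrow> f' x = 0" "3/4 \<le> pairing (c n') f'"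
      "\<And>m. m \<in> A' \<Longrightarrow> mass (c m) {x. f' x \<noteq> 0} \<le> 1 / real (2 ^ (k + 4))"
      "continuous_map X euclideanreal h'" "\<And>x. 0 \<le> h' x \<and> h' x \<le> 1"
      "\<And>x. h' x \<noteq> 0 \<Longrightarrow> h x \<noteq> 0 \<and> f' x = 0"
      "\<And>m. m \<in> A' \<Longrightarrow> mass (c m) {x. h' x \<noteq> 1} \<le> (1 - (1/2)^k) / 8 + 1 / real (2 ^ (k + 4))"
      by (rule gliding_hump_step[OF X c old A h hm _ h01 N]) simp_all
    have "(1 - (1/2)^k) / 8 + 1 / real (2 ^ (k + 4)) = (1 - (1/2)^Suc k) / (8::real)"
      unfolding e by (simp add: field_simps)
    then have "mass (c m) {x. h' x \<noteq> 1} \<le> (1 - (1/2)^Suc k) / 8" if "m \<in> A'" for m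
      using 1(14)[OF that] by linarith
    then have "P (Suc k) (A', h', n', f')" unfolding P_def prod.case using 1(3,11,12) by blast
    moreover have "Q k s (A', h', n', f')"
      unfolding Q_def s prod.case using 1 unfolding e by blast
    ultimately show "\<exists>s'. P (Suc k) s' \<and> Q k s s'" by blast
  qed
  then obtain s where s: "\<forall>k. P k (s k) \<and> Q k (s k) (s (Suc k))" by (rule exE)
  define A H n f where "A k = fst (s k)" and "H k = fst (snd (s k))"
    and "n k = fst (snd (snd (s (Suc k))))" and "f k = snd (snd (snd (s (Suc k))))" for k
  have Q: "Q k (A k, H k, fst (snd (snd (s k))), snd (snd (snd (s k)))) (A (Suc k), H (Suc k), n k, f k)" for k
    using s by (simp add: A_def H_def n_def f_def)
  have nA: "n k \<in> A k" and Asub: "A (Suc k) \<subseteq> A k" and nless: "\<And>m. m \<in> A (Suc k) \<Longrightarrow> n k < m"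
    and f: "continuous_map X euclideanreal (f k)" "\<And>x. \<bar>f k x\<bar> \<le> 1"
    and fH: "\<And>x. f k x \<noteq> 0 \<Longrightarrow> H k x \<noteq> 0" and f0: "\<And>j x. j < n k \<Longrightarrow> c j x \<noteq> 0 \<Longrightarrow> f k x = 0"
    and big: "3/4 \<le> pairing (c (n k)) (f k)"
    and light: "\<And>m. m \<in> A (Suc k) \<Longrightarrow> mass (c m) {x. f k x \<noteq> 0} \<le> (1/2)^k/16"
    and HS: "\<And>x. H (Suc k) x \<noteq> 0 \<Longrightarrow> H k x \<noteq> 0 \<and> f k x = 0" for k
    using Q[of k] unfolding Q_def prod.case by blast+
  have Amono: "A j \<subseteq> A i" if "i \<le> j" for i j
    using that by (induction j rule: dec_induct) (use Asub in blast)+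
  have Hmono: "H i x \<noteq> 0" if "i \<le> j" "H j x \<noteq> 0" for i j x
    using that by (induction j rule: dec_induct) (use HS in blast)+
  have disj: "f j x = 0" if "j < k" "f k x \<noteq> 0" for j k x
  proof -
    have "H (Suc j) x \<noteq> 0" using Hmono[of "Suc j" k x] fH[OF that(2)] that(1) by simp
    then show ?thesis using HS by blast
  qed
  have nmono: "strict_mono n"
    unfolding strict_mono_Suc_iff using nless nA by blast
  show thesis
  proof
    show "j = k" if "f j x \<noteq> 0" "f k x \<noteq> 0" for j k x
      using disj[of j k x] disj[of k j x] that linorder_less_linear[of j k] by blast
    show "pairing (c (n j)) (f k) = 0" if "j < k" for j k
    proof -
      have "n j < n k" using nmono that by (simp add: strict_mono_less)
      then show ?thesis unfolding pairing_def using f0 by (intro sum.neutral) auto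
    qed
    show "\<bar>pairing (c (n k)) (f j)\<bar> \<le> (1/2) ^ j / 16" if "j < k" for j k
    proof -
      have "n k \<in> A (Suc j)" using nA[of k] Amono[of "Suc j" k] that by auto
      then have "mass (c (n k)) {x. f j x \<noteq> 0} \<le> (1/2)^j/16" by (rule light)
      moreover have "\<bar>pairing (c (n k)) (f j)\<bar> \<le> 1 * mass (c (n k)) {x. f j x \<noteq> 0}"
        by (rule abs_pairing_le[OF fin]) (rule f(2))
      ultimately show ?thesis by simp
    qed
  qed (use nmono f big in auto)
qed

context
  \<comment> \<open>The recursive calls occur under a sum; this congruence rule shows that their arguments are below k.\<close>
  notes sum.cong [fundef_cong]
begin

text \<open>Forward substitution for a lower triangular system with matrix b and right-hand side a. The right-hand
  side consists of functions, so that the solution of a system of measures is again a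
  sequence of measures.\<close>

fun forward_subst :: "(nat \<Rightarrow> nat \<Rightarrow> real) \<Rightarrow> (nat \<Rightarrow> 'a \<Rightarrow> real) \<Rightarrow> nat \<Rightarrow> 'a \<Rightarrow> real" where
  "forward_subst b a k = (\<lambda>x. (1 / b k k) * (a k x - (\<Sum>j<k. b k j * forward_subst b a j x)))"

end

declare forward_subst.simps [simp del]

lemma fin_measure_forward_subst:
  assumes "\<And>k. fin_measure X (a k)"
  shows "fin_measure X (forward_subst b a k)"
proof (induction k rule: less_induct)
  case (less k)
  show ?case unfolding forward_subst.simps[of b a k]
    by (intro fin_measure_scale fin_measure_diff assms fin_measure_sum) (use less in auto)
qed

lemma pairing_sum_left:
  assumes "finite I" "\<And>i. i \<in> I \<Longrightarrow> fin_measure X (c i)"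
  shows "pairing (\<lambda>x. \<Sum>i\<in>I. c i x) f = (\<Sum>i\<in>I. pairing (c i) f)"
  using assms
proof (induction I rule: finite_induct)
  case (insert i I)
  have "pairing (\<lambda>x. c i x + (\<Sum>i\<in>I. c i x)) f = pairing (c i) f + pairing (\<lambda>x. \<Sum>i\<in>I. c i x) f"
    by (rule pairing_add_left) (use insert in \<open>auto intro!: fin_measure_finite[of X] fin_measure_sum\<close>)
  with insert show ?case by simp
qed (simp add: pairing_def)

lemma pairing_forward_subst:
  assumes a: "\<And>k. fin_measure X (a k)"
  shows "pairing (forward_subst b a k) f =
     (1 / b k k) * (pairing (a k) f - (\<Sum>j<k. b k j * pairing (forward_subst b a j) f))"
proof -
  note fs = fin_measure_scale[OF fin_measure_forward_subst[of X a b, OF a]]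
  have "pairing (\<lambda>x. \<Sum>j<k. b k j * forward_subst b a j x) f = (\<Sum>j<k. b k j * pairing (forward_subst b a j) f)"
    unfolding pairing_scale_left[symmetric] by (rule pairing_sum_left[where X=X]) (use fs in auto)
  moreover have "finite {x. (\<Sum>j<k. b k j * forward_subst b a j x) \<noteq> 0}"
    by (rule fin_measure_finite[of X], rule fin_measure_sum) (use fs in auto)
  ultimately show ?thesis
    unfolding forward_subst.simps[of b a k] pairing_scale_left
    using pairing_diff_left[OF fin_measure_finite[OF a]] by simp
qed

text \<open>The inverse of the triangular matrix maps null sequences to null sequences. The entries below the
  diagonal are dominated by a summable sequence independent of the row, so the solution is bounded,
  and then the sums over a row tend to 0 by Tannery's theorem, since each column does.\<close>

lemma triangular_solution_tendsto_zero:
  fixes y s :: "nat \<Rightarrow> real" and b :: "nat \<Rightarrow> nat \<Rightarrow> real"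
  assumes y: "\<And>k. y k = (1 / b k k) * (s k - (\<Sum>j<k. b k j * y j))"
    and diag: "\<And>k. 3/4 \<le> b k k" and off: "\<And>j k. j < k \<Longrightarrow> \<bar>b k j\<bar> \<le> (1/2)^j / 16"
    and col: "\<And>j. (\<lambda>k. b k j) \<longlonglongrightarrow> 0" and s: "s \<longlonglongrightarrow> 0"
  shows "y \<longlonglongrightarrow> 0"
proof -
  have inv: "\<bar>(1 / b k k) * t\<bar> \<le> 4/3 * \<bar>t\<bar>" for k t
  proof -
    have "\<bar>1 / b k k\<bar> \<le> 4/3" using diag[of k] by (simp add: field_simps)
    then show ?thesis unfolding abs_mult by (rule mult_right_mono) simp
  qed
  have half: "summable (\<lambda>j. (1/2::real)^j)" by (rule summable_geometric) simp
  have half_sum: "(\<Sum>j<k. (1/2::real)^j) \<le> 2" for k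
    using sum_le_suminf[OF half, of "{..<k}"] suminf_geometric[of "1/2::real"] by simp
  obtain S where S: "S > 0" "\<And>k. \<bar>s k\<bar> \<le> S"
    using convergent_imp_Bseq[OF convergentI[OF s]] by (auto simp: Bseq_def)
  have bound: "\<bar>y k\<bar> \<le> 2 * S" for k
  proof (induction k rule: less_induct)
    case (less k)
    have "\<bar>b k j * y j\<bar> \<le> (1/2)^j / 16 * (2 * S)" if "j < k" for j
      unfolding abs_mult by (rule mult_mono[OF off[OF that] less[OF that]]) auto
    then have "\<bar>\<Sum>j<k. b k j * y j\<bar> \<le> (\<Sum>j<k. (1/2)^j / 16 * (2 * S))"
      by (intro order_trans[OF sum_abs] sum_mono) auto
    also have "\<dots> = (\<Sum>j<k. (1/2)^j) * (S / 8)"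
      unfolding sum_distrib_right by (rule sum.cong) simp_all
    also have "\<dots> \<le> 2 * (S / 8)" using half_sum S by (intro mult_right_mono) auto
    finally have "\<bar>s k - (\<Sum>j<k. b k j * y j)\<bar> \<le> S + S / 4" using S(2)[of k] by linarith
    moreover have "\<bar>y k\<bar> \<le> 4/3 * \<bar>s k - (\<Sum>j<k. b k j * y j)\<bar>" by (subst y[of k]) (rule inv)
    moreover have "4/3 * \<bar>s k - (\<Sum>j<k. b k j * y j)\<bar> \<le> 4/3 * (S + S / 4)"
      using calculation(1) by (rule mult_left_mono) simp
    ultimately have "\<bar>y k\<bar> \<le> 4/3 * (S + S / 4)" by (meson order_trans)
    then show ?case using S(1) by simp
  qed
  \<comment> \<open>The finite row sums as series with a common summable majorant.\<close>
  define a where "a j k = (if j < k then b k j * y j else 0)" for j k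
  have "((\<lambda>k. suminf (\<lambda>j. a j k)) \<longlongrightarrow> suminf (\<lambda>j. 0)) sequentially"
  proof (rule tannerys_theorem[where a=a and b="\<lambda>_. 0" and F=sequentially and
        M="\<lambda>j. (1/2)^j / 16 * (2 * S)", THEN conjunct2, THEN conjunct2])
    show "(\<lambda>k. a j k) \<longlonglongrightarrow> 0" for j
    proof (rule Lim_null_comparison)
      show "\<forall>\<^sub>F k in sequentially. norm (a j k) \<le> \<bar>b k j\<bar> * (2 * S)"
      proof (intro always_eventually allI)
        fix k
        have "\<bar>b k j\<bar> * \<bar>y j\<bar> \<le> \<bar>b k j\<bar> * (2 * S)" using bound by (rule mult_left_mono) simp
        then show "norm (a j k) \<le> \<bar>b k j\<bar> * (2 * S)" using S(1) by (simp add: a_def abs_mult)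
      qed
      show "(\<lambda>k. \<bar>b k j\<bar> * (2 * S)) \<longlonglongrightarrow> 0"
        using col by (intro tendsto_mult_left_zero tendsto_rabs_zero)
    qed
    have "norm (a j k) \<le> (1/2)^j / 16 * (2 * S)" for j k
    proof (cases "j < k")
      case True
      have "\<bar>b k j\<bar> * \<bar>y j\<bar> \<le> (1/2)^j / 16 * (2 * S)"
        by (rule mult_mono[OF off[OF True] bound]) auto
      then show ?thesis using True by (simp add: a_def abs_mult)
    qed (use S(1) in \<open>simp add: a_def\<close>)
    then show "\<forall>\<^sub>F (j, k) in sequentially \<times>\<^sub>F sequentially. norm (a j k) \<le> (1/2)^j / 16 * (2 * S)"
      by (intro always_eventually) (simp add: split_def)
    show "summable (\<lambda>j. (1/2)^j / 16 * (2 * S))"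
      using half by (intro summable_mult2 summable_divide)
  qed simp
  moreover have "suminf (\<lambda>j. a j k) = (\<Sum>j<k. b k j * y j)" for k
    using suminf_finite[of "{..<k}" "\<lambda>j. a j k"] by (simp add: a_def)
  ultimately have "(\<lambda>k. \<Sum>j<k. b k j * y j) \<longlonglongrightarrow> 0" by simp
  from tendsto_diff[OF s this] have "(\<lambda>k. 4/3 * \<bar>s k - (\<Sum>j<k. b k j * y j)\<bar>) \<longlonglongrightarrow> 0"
    by (intro tendsto_mult_right_zero tendsto_rabs_zero) simp
  then show ?thesis
  proof (rule Lim_null_comparison[rotated])
    have "norm (y k) \<le> 4/3 * \<bar>s k - (\<Sum>j<k. b k j * y j)\<bar>" for k
      unfolding real_norm_def by (subst y[of k]) (rule inv)
    then show "\<forall>\<^sub>F k in sequentially. norm (y k) \<le> 4/3 * \<bar>s k - (\<Sum>j<k. b k j * y j)\<bar>"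
      by (rule always_eventually[OF allI])
  qed
qed

text \<open>Solving the triangular system produced by the gliding hump replaces the measures by combinations
  that are exactly dual to the humps.\<close>

lemma JNP_imp_biorthogonal_system:
  assumes X: "tychonoff_space X" and J: "JNP X"
  obtains a f where "\<And>k. fin_measure X (a k)" "weakly_null X a"
    "\<And>k. continuous_map X euclideanreal (f k)" "\<And>k x. \<bar>f k x\<bar> \<le> 1"
    "\<And>j k x. f j x \<noteq> 0 \<Longrightarrow> f k x \<noteq> 0 \<Longrightarrow> j = k"
    "\<And>j k. pairing (a k) (f j) = (if j = k then 1 else 0)"
proof -
  obtain m where m: "\<And>n. fin_measure X (m n)" "\<And>n. mass (m n) UNIV = 1" "weakly_null X m"
      "\<And>x. (\<lambda>n. m n x) \<longlonglongrightarrow> 0"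
    by (rule JNP_imp_pointwise_null[OF X J]) (rule that; assumption)
  have "0 < (1/8::real)" by simp
  then obtain r :: "nat \<Rightarrow> nat" where r: "strict_mono r" "\<And>k. mass (m (r k)) (\<Union>j<k. {x. m (r j) x \<noteq> 0}) \<le> 1/8"
    by (rule almost_disjoint_subsequence[OF m(1)[THEN fin_measure_finite] m(4)]) (rule that; assumption)
  note gh = gliding_hump[of X "\<lambda>k. m (r k)", OF X m(1) m(2) r(2)]
  obtain n :: "nat \<Rightarrow> nat" and f where n: "strict_mono n" and f: "\<And>k. continuous_map X euclideanreal (f k)" "\<And>k x. \<bar>f k x\<bar> \<le> 1"
    "\<And>j k x. f j x \<noteq> 0 \<Longrightarrow> f k x \<noteq> 0 \<Longrightarrow> j = k" and big: "\<And>k. 3/4 \<le> pairing (m (r (n k))) (f k)"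
    and up: "\<And>j k. j < k \<Longrightarrow> pairing (m (r (n j))) (f k) = 0"
    and low: "\<And>j k. j < k \<Longrightarrow> \<bar>pairing (m (r (n k))) (f j)\<bar> \<le> (1/2) ^ j / 16"
    by (rule gh) (rule that; assumption)
  define c where "c k = m (r (n k))" for k
  have c: "fin_measure X (c k)" for k by (simp add: c_def m(1))
  have cnull: "weakly_null X c"
    unfolding c_def using weakly_null_subseq[OF weakly_null_subseq[OF m(3) r(1)] n] .
  define b where "b k j = pairing (c k) (f j)" for k j
  have diag: "3/4 \<le> b k k" for k using big by (simp add: b_def c_def)
  define a where "a = forward_subst b c"
  have a_pair: "pairing (a k) g = (1 / b k k) * (pairing (c k) g - (\<Sum>j<k. b k j * pairing (a j) g))" for k g
    unfolding a_def by (rule pairing_forward_subst[OF c])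
  show thesis
  proof
    show "fin_measure X (a k)" for k unfolding a_def by (rule fin_measure_forward_subst[OF c])
    show "weakly_null X a" unfolding weakly_null_def
    proof (intro allI impI)
      fix g assume g: "continuous_map X euclideanreal g"
      show "(\<lambda>k. pairing (a k) g) \<longlonglongrightarrow> 0"
      proof (rule triangular_solution_tendsto_zero[where b=b and s="\<lambda>k. pairing (c k) g"])
        show "pairing (a k) g = (1 / b k k) * (pairing (c k) g - (\<Sum>j<k. b k j * pairing (a j) g))" for k
          by (rule a_pair)
        show "3/4 \<le> b k k" for k by (rule diag)
        show "\<bar>b k j\<bar> \<le> (1/2)^j / 16" if "j < k" for j k using low[OF that] by (simp add: b_def c_def)
        show "(\<lambda>k. b k j) \<longlonglongrightarrow> 0" for j
          using cnull f(1) by (simp add: b_def weakly_null_def)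
        show "(\<lambda>k. pairing (c k) g) \<longlonglongrightarrow> 0" using cnull g by (simp add: weakly_null_def)
      qed
    qed
    show "pairing (a k) (f j) = (if j = k then 1 else 0)" for j k
    proof (induction k rule: less_induct)
      case (less k)
      have "(\<Sum>i<k. b k i * pairing (a i) (f j)) = (\<Sum>i<k. if i = j then b k j else 0)"
        by (rule sum.cong) (use less in auto)
      also have "\<dots> = (if j < k then b k j else 0)" by simp
      finally have "pairing (a k) (f j) = (1 / b k k) * (b k j - (if j < k then b k j else 0))"
        unfolding a_pair[of k] by (simp add: b_def)
      then show ?case using diag[of k] up[of k j] by (auto simp: b_def c_def)
    qed
  qed (use f in auto)
qed

section \<open>Finite dimension and codimension\<close>

text \<open>If finitely many functions separate the elements of a space M of measures, then M is
  finite-dimensional. The conclusion is phrased through common zeros of finitely many elements of M,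
  which is what the applications need and avoids bases. The induction removes one function e at a time by
  passing to the measures that vanish on e, at the cost of one further measure.\<close>

lemma finitely_many_functions_detect:
  fixes M :: "('a \<Rightarrow> real) set"
  assumes "\<And>c. c \<in> M \<Longrightarrow> finite {x. c x \<noteq> 0}"
    and "\<And>c d a. c \<in> M \<Longrightarrow> d \<in> M \<Longrightarrow> (\<lambda>x. c x - a * d x) \<in> M"
    and "\<And>c. c \<in> M \<Longrightarrow> (\<And>e. e \<in> set es \<Longrightarrow> pairing c e = 0) \<Longrightarrow> c = (\<lambda>x. 0)"
  shows "\<exists>\<Lambda>\<subseteq>M. finite \<Lambda> \<and> (\<forall>f. (\<forall>c\<in>\<Lambda>. pairing c f = 0) \<longrightarrow> (\<forall>c\<in>M. pairing c f = 0))"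
  using assms
proof (induction es arbitrary: M)
  case Nil
  then have "c = (\<lambda>x. 0)" if "c \<in> M" for c using that by simp
  moreover have "pairing (\<lambda>x. 0) f = 0" for f :: "'a \<Rightarrow> real" by (simp add: pairing_def)
  ultimately have "\<forall>c\<in>M. pairing c f = 0" for f by metis
  then show ?case by (intro exI[of _ "{}"]) auto
next
  case (Cons e es)
  have sub: "pairing (\<lambda>x. c x - a * d x) f = pairing c f - a * pairing d f"
    if "c \<in> M" "d \<in> M" for c d a f
  proof -
    have "finite {x. a * d x \<noteq> 0}" using Cons.prems(1)[OF that(2)] by (rule rev_finite_subset) auto
    then show ?thesis
      using pairing_diff_left[OF Cons.prems(1)[OF that(1)], of "\<lambda>x. a * d x" f] by (simp add: pairing_scale_left)
  qed
  define M' where "M' = {c \<in> M. pairing c e = 0}"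
  have "\<exists>\<Lambda>\<subseteq>M'. finite \<Lambda> \<and> (\<forall>f. (\<forall>c\<in>\<Lambda>. pairing c f = 0) \<longrightarrow> (\<forall>c\<in>M'. pairing c f = 0))"
  proof (rule Cons.IH)
    show "finite {x. c x \<noteq> 0}" if "c \<in> M'" for c using that Cons.prems(1) by (simp add: M'_def)
    show "(\<lambda>x. c x - a * d x) \<in> M'" if "c \<in> M'" "d \<in> M'" for c d a
      using that Cons.prems(2) sub by (simp add: M'_def)
    show "c = (\<lambda>x. 0)" if "c \<in> M'" "\<And>e. e \<in> set es \<Longrightarrow> pairing c e = 0" for c
      by (rule Cons.prems(3)) (use that in \<open>auto simp: M'_def\<close>)
  qed
  then obtain \<Lambda> where \<Lambda>: "\<Lambda> \<subseteq> M'" "finite \<Lambda>"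
    "\<And>f. (\<forall>c\<in>\<Lambda>. pairing c f = 0) \<Longrightarrow> (\<forall>c\<in>M'. pairing c f = 0)" by blast
  show ?case
  proof (cases "M' = M")
    case True
    then show ?thesis using \<Lambda> by blast
  next
    case False
    then obtain d where d: "d \<in> M" "pairing d e \<noteq> 0" by (auto simp: M'_def)
    have "pairing c f = 0" if "\<forall>c\<in>insert d \<Lambda>. pairing c f = 0" "c \<in> M" for c f
    proof -
      define t where "t = pairing c e / pairing d e"
      have "t * pairing d e = pairing c e" using d(2) by (simp add: t_def)
      then have "(\<lambda>x. c x - t * d x) \<in> M'"
        using sub[OF that(2) d(1)] Cons.prems(2)[OF that(2) d(1)] by (simp add: M'_def)
      then have "pairing (\<lambda>x. c x - t * d x) f = 0" using \<Lambda>(3) that(1) by blast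
      then show ?thesis using sub[OF that(2) d(1)] that(1) by simp
    qed
    moreover have "insert d \<Lambda> \<subseteq> M" using \<Lambda>(1) d(1) by (auto simp: M'_def)
    ultimately show ?thesis using \<Lambda>(2) by (intro exI[of _ "insert d \<Lambda>"]) blast
  qed
qed

text \<open>Hahn-Banach for functions on a finite set, by Gaussian elimination of one point after the other.\<close>

lemma separating_functional:
  fixes N :: "('a \<Rightarrow> real) set"
  assumes "finite F" "N \<noteq> {}" "\<And>g h a. g \<in> N \<Longrightarrow> h \<in> N \<Longrightarrow> (\<lambda>x. g x - a * h x) \<in> N"
    and "\<not> (\<exists>g\<in>N. \<forall>x\<in>F. g x = v x)"
  shows "\<exists>c. {x. c x \<noteq> 0} \<subseteq> F \<and> (\<forall>g\<in>N. pairing c g = 0) \<and> pairing c v \<noteq> 0"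
  using assms
proof (induction F arbitrary: N v rule: finite_induct)
  case (insert p F)
  note N = insert.prems(2)
  have delta: "pairing (\<lambda>x. if x = p then 1 else 0) g = g p" for g :: "'a \<Rightarrow> real"
    by (simp add: pairing_def)
  show ?case
  proof (cases "\<exists>g\<in>N. g p \<noteq> 0")
    case False
    then have g0: "g p = 0" if "g \<in> N" for g using that by blast
    show ?thesis
    proof (cases "v p = 0")
      case True
      with insert.prems(3) g0 have "\<not> (\<exists>g\<in>N. \<forall>x\<in>F. g x = v x)" by auto
      from insert.IH[OF insert.prems(1) N this] show ?thesis by blast
    next
      case False
      then show ?thesis
        by (intro exI[of _ "\<lambda>x. if x = p then 1 else 0"]) (use g0 in \<open>auto simp: delta\<close>)
    qed
  next
    case True
    then obtain h where h: "h \<in> N" "h p \<noteq> 0" by blast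
    define N' where "N' = {g \<in> N. g p = 0}"
    define v' where "v' x = v x - (v p / h p) * h x" for x
    have proj: "(\<lambda>x. g x - (g p / h p) * h x) \<in> N'" if "g \<in> N" for g
      using N[OF that h(1), of "g p / h p"] h(2) by (simp add: N'_def)
    have "\<not> (\<exists>g\<in>N'. \<forall>x\<in>F. g x = v' x)"
    proof
      assume "\<exists>g\<in>N'. \<forall>x\<in>F. g x = v' x"
      then obtain g where g: "g \<in> N" "g p = 0" "\<And>x. x \<in> F \<Longrightarrow> g x = v' x" by (auto simp: N'_def)
      have "(\<lambda>x. g x - (- (v p / h p)) * h x) \<in> N" by (rule N[OF g(1) h(1)])
      moreover have "\<forall>x\<in>insert p F. g x - (- (v p / h p)) * h x = v x"
        using g h(2) by (auto simp: v'_def)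
      ultimately show False using insert.prems(3) by (meson)
    qed
    moreover have "(\<lambda>x. g x - a * k x) \<in> N'" if "g \<in> N'" "k \<in> N'" for g k a
      using that N by (simp add: N'_def)
    moreover have "N' \<noteq> {}" using proj h by blast
    ultimately obtain c where c: "{x. c x \<noteq> 0} \<subseteq> F" "\<And>g. g \<in> N' \<Longrightarrow> pairing c g = 0" "pairing c v' \<noteq> 0"
      using insert.IH[of N' v'] by blast
    have fin: "finite {x. c x \<noteq> 0}" using c(1) insert.hyps(1) finite_subset by blast
    \<comment> \<open>The weight at p is chosen so that d sees only the part of a function left after eliminating p with h.\<close>
    define d where "d x = c x + (- (pairing c h / h p)) * (if x = p then 1 else 0)" for x
    have d: "pairing d g = pairing c (\<lambda>x. g x - (g p / h p) * h x)" for g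
    proof -
      have "finite {x. (- (pairing c h / h p)) * (if x = p then 1 else 0) \<noteq> 0}"
        by (rule finite_subset[of _ "{p}"]) auto
      from pairing_add_left[OF fin this] have "pairing d g = pairing c g + - (pairing c h / h p) * g p"
        unfolding d_def by (simp only: pairing_scale_left delta)
      then show ?thesis by (simp only: pairing_diff pairing_scale) simp
    qed
    have "{x. d x \<noteq> 0} \<subseteq> insert p F" using c(1) by (auto simp: d_def)
    moreover have "pairing d g = 0" if "g \<in> N" for g using c(2)[OF proj[OF that]] d by simp
    moreover have "pairing d v \<noteq> 0" using c(3) d[of v] by (simp add: v'_def[abs_def])
    ultimately show ?thesis by blast
  qed
qed auto

lemma
  assumes "real_vector_space V"
  shows rvs_zero: "vzero V \<in> vcarrier V"
    and rvs_add: "x \<in> vcarrier V \<Longrightarrow> y \<in> vcarrier V \<Longrightarrow> vadd V x y \<in> vcarrier V"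
    and rvs_scale: "x \<in> vcarrier V \<Longrightarrow> vscale V a x \<in> vcarrier V"
    and rvs_assoc: "x \<in> vcarrier V \<Longrightarrow> y \<in> vcarrier V \<Longrightarrow> z \<in> vcarrier V \<Longrightarrow>
      vadd V (vadd V x y) z = vadd V x (vadd V y z)"
    and rvs_comm: "x \<in> vcarrier V \<Longrightarrow> y \<in> vcarrier V \<Longrightarrow> vadd V x y = vadd V y x"
    and rvs_zero_left: "x \<in> vcarrier V \<Longrightarrow> vadd V (vzero V) x = x"
    and rvs_inverse: "x \<in> vcarrier V \<Longrightarrow> \<exists>y\<in>vcarrier V. vadd V x y = vzero V"
    and rvs_distrib: "x \<in> vcarrier V \<Longrightarrow> y \<in> vcarrier V \<Longrightarrow>
      vscale V a (vadd V x y) = vadd V (vscale V a x) (vscale V a y)"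
    and rvs_distrib_scalar: "x \<in> vcarrier V \<Longrightarrow>
      vscale V (a + b) x = vadd V (vscale V a x) (vscale V b x)"
    and rvs_scale_scale: "x \<in> vcarrier V \<Longrightarrow> vscale V a (vscale V b x) = vscale V (a * b) x"
    and rvs_one: "x \<in> vcarrier V \<Longrightarrow> vscale V 1 x = x"
  using assms unfolding real_vector_space_def by meson+

lemma
  assumes V: "real_vector_space V" and x: "x \<in> vcarrier V"
  shows rvs_zero_right: "vadd V x (vzero V) = x"
    and vscale_0: "vscale V 0 x = vzero V"
    and vadd_uminus: "vadd V x (vscale V (-1) x) = vzero V"
proof -
  note z = rvs_zero[OF V]
  have zr: "vadd V u (vzero V) = u" if "u \<in> vcarrier V" for u
    using rvs_comm[OF V that z] rvs_zero_left[OF V that] by simp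
  show "vadd V x (vzero V) = x" using zr[OF x] .
  have o: "vscale V 0 x \<in> vcarrier V" by (rule rvs_scale[OF V x])
  then obtain y where y: "y \<in> vcarrier V" "vadd V (vscale V 0 x) y = vzero V"
    using rvs_inverse[OF V] by blast
  have e: "vadd V (vscale V 0 x) (vscale V 0 x) = vscale V 0 x"
    using rvs_distrib_scalar[OF V x, of 0 0] by simp
  show 0: "vscale V 0 x = vzero V"
    using rvs_assoc[OF V o o y(1)] e y(2) zr[OF o] by simp
  show "vadd V x (vscale V (-1) x) = vzero V"
    using rvs_distrib_scalar[OF V x, of 1 "-1"] rvs_one[OF V x] 0 by simp
qed

lemma linear_map_vzero:
  assumes V: "real_vector_space V" and W: "real_vector_space W" and T: "linear_map_on V W T"
  shows "T (vzero V) = vzero W"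
proof -
  note z = rvs_zero[OF V]
  have "T (vscale V 0 (vzero V)) = vscale W 0 (T (vzero V))" "T (vzero V) \<in> vcarrier W"
    using T z unfolding linear_map_on_def by blast+
  then show ?thesis using vscale_0[OF V z] vscale_0[OF W] by simp
qed

lemma linear_subspace_vcarrier: "real_vector_space V \<Longrightarrow> linear_subspace V (vcarrier V)"
  by (simp add: linear_subspace_def rvs_zero rvs_add rvs_scale)

lemma vadd_scale_cancel:
  assumes V: "real_vector_space V" and x: "x \<in> vcarrier V" "b \<in> vcarrier V"
  shows "vadd V (vadd V x (vscale V (- t) b)) (vscale V t b) = x"
  using rvs_assoc[OF V x(1) rvs_scale[OF V x(2)] rvs_scale[OF V x(2)], of "- t" t]
    rvs_distrib_scalar[OF V x(2), of "- t" t] vscale_0[OF V x(2)] rvs_zero_right[OF V x(1)]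
  by simp

text \<open>Finite codimension is expressed by a finite set that spans the whole space together with Z. Every
  quotient map or projection with kernel Z carries such a set to a finite spanning set of its image.\<close>

definition finite_codimension :: "'v tvs \<Rightarrow> 'v set \<Rightarrow> bool" where
  "finite_codimension V Z \<longleftrightarrow>
     (\<exists>B. finite B \<and> B \<subseteq> vcarrier V \<and> (\<forall>H. linear_subspace V H \<and> B \<union> Z \<subseteq> H \<longrightarrow> H = vcarrier V))"

text \<open>A further functional that does not vanish on the intersection of the previous kernels costs one more
  spanning vector, on which it is nonzero.\<close>

lemma finite_codimension_common_kernel:
  assumes V: "real_vector_space V" and "finite \<Phi>"
    and "\<And>\<phi> x y. \<phi> \<in> \<Phi> \<Longrightarrow> x \<in> vcarrier V \<Longrightarrow> y \<in> vcarrier V \<Longrightarrow> \<phi> (vadd V x y) = \<phi> x + (\<phi> y :: real)"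
    and "\<And>\<phi> a x. \<phi> \<in> \<Phi> \<Longrightarrow> x \<in> vcarrier V \<Longrightarrow> \<phi> (vscale V a x) = a * \<phi> x"
  shows "finite_codimension V {x \<in> vcarrier V. \<forall>\<phi>\<in>\<Phi>. \<phi> x = 0}"
  using assms(2-)
proof (induction \<Phi> rule: finite_induct)
  case empty
  show ?case unfolding finite_codimension_def
    by (intro exI[of _ "{}"]) (auto simp: linear_subspace_def)
next
  case (insert \<phi> \<Phi>)
  let ?Z = "{x \<in> vcarrier V. \<forall>\<phi>\<in>\<Phi>. \<phi> x = 0}"
  let ?Z' = "{x \<in> vcarrier V. \<forall>\<phi>\<in>insert \<phi> \<Phi>. \<phi> x = 0}"
  have "finite_codimension V ?Z" by (rule insert.IH) (use insert.prems in auto)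
  then obtain B where B: "finite B" "B \<subseteq> vcarrier V"
      "\<And>H. linear_subspace V H \<Longrightarrow> B \<union> ?Z \<subseteq> H \<Longrightarrow> H = vcarrier V"
    unfolding finite_codimension_def by blast
  have closed: "vadd V x (vscale V a y) \<in> vcarrier V" if "x \<in> vcarrier V" "y \<in> vcarrier V" for x y a
    using that by (intro rvs_add[OF V] rvs_scale[OF V])
  show ?case
  proof (cases "\<exists>b\<in>?Z. \<phi> b \<noteq> 0")
    case False
    then have "?Z' = ?Z" by blast
    with \<open>finite_codimension V ?Z\<close> show ?thesis by simp
  next
    case True
    then obtain b where b: "b \<in> ?Z" "\<phi> b \<noteq> 0" by blast
    have "H = vcarrier V" if H: "linear_subspace V H" "insert b B \<union> ?Z' \<subseteq> H" for H
    proof (rule B(3)[OF H(1)])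
      have "z \<in> H" if z: "z \<in> ?Z" for z
      proof -
        let ?y = "vadd V z (vscale V (- (\<phi> z / \<phi> b)) b)"
        have zb: "z \<in> vcarrier V" "b \<in> vcarrier V" using z b by auto
        have val: "\<psi> ?y = \<psi> z - (\<phi> z / \<phi> b) * \<psi> b" if "\<psi> \<in> insert \<phi> \<Phi>" for \<psi>
        proof -
          have "vscale V (- (\<phi> z / \<phi> b)) b \<in> vcarrier V"
            by (rule rvs_scale[OF V zb(2)])
          then show ?thesis using insert.prems(1)[OF that zb(1)] insert.prems(2)[OF that zb(2)] by simp
        qed
        have "\<psi> ?y = 0" if "\<psi> \<in> insert \<phi> \<Phi>" for \<psi>
          using val[OF that] that b z by auto
        then have "?y \<in> H" using closed[OF zb] H(2) by blast
        moreover have "b \<in> H" using H(2) by blast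
        ultimately have "vadd V ?y (vscale V (\<phi> z / \<phi> b) b) \<in> H"
          using H(1) unfolding linear_subspace_def by blast
        then show ?thesis using vadd_scale_cancel[OF V zb] by simp
      qed
      then show "B \<union> ?Z \<subseteq> H" using H(2) by blast
    qed
    then show ?thesis unfolding finite_codimension_def
      using B(1,2) b(1) by (intro exI[of _ "insert b B"]) blast
  qed
qed

lemma not_infinite_dimensional_image:
  assumes Q: "linear_map_on V W Q" "Q ` vcarrier V = vcarrier W"
    and V: "real_vector_space V" and W: "linear_subspace W (vcarrier W)" and z: "Q (vzero V) = vzero W"
    and Z: "Z \<subseteq> {x \<in> vcarrier V. Q x = vzero W}" "finite_codimension V Z"
  shows "\<not> infinite_dimensional W"
proof -
  obtain B where B: "finite B" "B \<subseteq> vcarrier V"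
      "\<And>H. linear_subspace V H \<Longrightarrow> B \<union> Z \<subseteq> H \<Longrightarrow> H = vcarrier V"
    using Z(2) unfolding finite_codimension_def by blast
  have "linear_subspace W hull (Q ` B) = vcarrier W"
  proof (rule hull_unique)
    show "Q ` B \<subseteq> vcarrier W" using B(2) Q(2) by blast
    show "linear_subspace W (vcarrier W)" by (rule W)
    fix H assume H: "Q ` B \<subseteq> H" "linear_subspace W H"
    have "linear_subspace V ({x \<in> vcarrier V. Q x \<in> H})"
      using Q(1) H(2) z unfolding linear_subspace_def linear_map_on_def
      by (simp add: rvs_zero[OF V] rvs_add[OF V] rvs_scale[OF V])
    moreover have "B \<union> Z \<subseteq> {x \<in> vcarrier V. Q x \<in> H}"
      using B(2) H Z(1) by (auto simp: linear_subspace_def)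
    ultimately have "{x \<in> vcarrier V. Q x \<in> H} = vcarrier V" by (rule B(3))
    then have "Q x \<in> H" if "x \<in> vcarrier V" for x using that by blast
    then show "vcarrier W \<subseteq> H" unfolding Q(2)[symmetric] by blast
  qed
  then show ?thesis unfolding infinite_dimensional_def using B(1,2) Q(2) by blast
qed

text \<open>A biorthogonal sequence excludes a finite spanning set B: the finitely supported combinations of the
  functionals cannot all be detected by the finitely many elements of B, so some nontrivial
  combination vanishes on B, hence everywhere, against biorthogonality. The combinations are
  themselves finitely supported measures on the natural numbers.\<close>

lemma infinite_dimensional_dual_sequence:
  fixes \<phi> :: "nat \<Rightarrow> 'v \<Rightarrow> real"
  assumes zero: "vzero V \<in> vcarrier V" "\<And>n. \<phi> n (vzero V) = 0"
    and closed: "\<And>x y. x \<in> vcarrier V \<Longrightarrow> y \<in> vcarrier V \<Longrightarrow> vadd V x y \<in> vcarrier V"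
      "\<And>a x. x \<in> vcarrier V \<Longrightarrow> vscale V a x \<in> vcarrier V"
    and add: "\<And>n x y. x \<in> vcarrier V \<Longrightarrow> y \<in> vcarrier V \<Longrightarrow> \<phi> n (vadd V x y) = \<phi> n x + \<phi> n y"
    and scale: "\<And>n a x. x \<in> vcarrier V \<Longrightarrow> \<phi> n (vscale V a x) = a * \<phi> n x"
    and v: "\<And>n. v n \<in> vcarrier V" "\<And>n j. \<phi> n (v j) = (if n = j then 1 else 0)"
  shows "infinite_dimensional V"
  unfolding infinite_dimensional_def
proof
  assume "\<exists>B. finite B \<and> B \<subseteq> vcarrier V \<and> linear_subspace V hull B = vcarrier V"
  then obtain B where B: "finite B" "B \<subseteq> vcarrier V" "linear_subspace V hull B = vcarrier V" by blast
  obtain bs where bs: "set bs = B" using finite_list[OF B(1)] by blast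
  define M where "M = {c :: nat \<Rightarrow> real. finite {x. c x \<noteq> 0}}"
  have "\<exists>c\<in>M. (\<forall>b\<in>B. pairing c (\<lambda>n. \<phi> n b) = 0) \<and> c \<noteq> (\<lambda>x. 0)"
  proof (rule ccontr)
    assume none: "\<not> ?thesis"
    have "\<exists>\<Lambda>\<subseteq>M. finite \<Lambda> \<and> (\<forall>f. (\<forall>c\<in>\<Lambda>. pairing c f = 0) \<longrightarrow> (\<forall>c\<in>M. pairing c f = 0))"
    proof (rule finitely_many_functions_detect[of M "map (\<lambda>b n. \<phi> n b) bs"])
      show "(\<lambda>x. c x - a * d x) \<in> M" if "c \<in> M" "d \<in> M" for c d a
      proof -
        have "{x. c x - a * d x \<noteq> 0} \<subseteq> {x. c x \<noteq> 0} \<union> {x. d x \<noteq> 0}" by auto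
        then show ?thesis using that finite_subset unfolding M_def by blast
      qed
      show "c = (\<lambda>x. 0)" if "c \<in> M" "\<And>e. e \<in> set (map (\<lambda>b n. \<phi> n b) bs) \<Longrightarrow> pairing c e = 0" for c
        using none that bs by fastforce
    qed (simp add: M_def)
    then obtain \<Lambda> where \<Lambda>: "\<Lambda> \<subseteq> M" "finite \<Lambda>"
      "\<And>f. (\<forall>c\<in>\<Lambda>. pairing c f = 0) \<Longrightarrow> (\<forall>c\<in>M. pairing c f = 0)" by blast
    have "finite (\<Union>c\<in>\<Lambda>. {x. c x \<noteq> 0})" using \<Lambda>(1,2) by (auto simp: M_def)
    then obtain m where m: "m \<notin> (\<Union>c\<in>\<Lambda>. {x. c x \<noteq> 0})" using ex_new_if_finite infinite_UNIV_nat by metis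
    define e where "e x = (if x = m then 1 else 0 :: real)" for x
    have "\<forall>c\<in>\<Lambda>. pairing c e = 0" unfolding pairing_def
      by (intro ballI sum.neutral) (use m in \<open>auto simp: e_def\<close>)
    moreover have "e \<in> M" by (simp add: M_def e_def)
    ultimately have "pairing e e = 0" using \<Lambda>(3) by blast
    moreover have "{x. e x \<noteq> 0} = {m}" by (auto simp: e_def)
    ultimately show False by (simp add: pairing_def e_def)
  qed
  then obtain c where c: "finite {x. c x \<noteq> 0}" "\<And>b. b \<in> B \<Longrightarrow> pairing c (\<lambda>n. \<phi> n b) = 0" "c \<noteq> (\<lambda>x. 0)"
    by (auto simp: M_def)
  have "linear_subspace V {x \<in> vcarrier V. pairing c (\<lambda>n. \<phi> n x) = 0}"
    using zero closed unfolding linear_subspace_def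
    by (auto simp: add scale pairing_add pairing_scale) (simp add: pairing_def)
  moreover have "B \<subseteq> {x \<in> vcarrier V. pairing c (\<lambda>n. \<phi> n x) = 0}" using B(2) c(2) by blast
  ultimately have "vcarrier V \<subseteq> {x \<in> vcarrier V. pairing c (\<lambda>n. \<phi> n x) = 0}"
    using hull_minimal[of B _ "linear_subspace V"] B(3) by metis
  then have "pairing c (\<lambda>n. \<phi> n (v j)) = 0" for j using v(1) by blast
  moreover have "pairing c (\<lambda>n. \<phi> n (v j)) = c j" for j
  proof -
    have "pairing c (\<lambda>n. \<phi> n (v j)) = (\<Sum>n | c n \<noteq> 0. if n = j then c j else 0)"
      unfolding pairing_def v(2) by (rule sum.cong) auto
    then show ?thesis using c(1) by simp
  qed
  ultimately show False using c(3) by auto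
qed

section \<open>Retractions onto c_0\<close>

lemma real_vector_space_sub_tvs:
  assumes V: "real_vector_space V" and L: "linear_subspace V L"
  shows "real_vector_space (sub_tvs V L)"
proof -
  have c: "vcarrier (sub_tvs V L) = L" by (rule vcarrier_sub_tvs[OF L])
  have o: "vzero (sub_tvs V L) = vzero V" "vadd (sub_tvs V L) = vadd V" "vscale (sub_tvs V L) = vscale V"
    by (simp_all add: sub_tvs_def)
  have LV: "x \<in> vcarrier V" if "x \<in> L" for x using L that by (auto simp: linear_subspace_def)
  have Ls: "vzero V \<in> L" "\<And>x y. x \<in> L \<Longrightarrow> y \<in> L \<Longrightarrow> vadd V x y \<in> L" "\<And>a x. x \<in> L \<Longrightarrow> vscale V a x \<in> L"
    using L by (simp_all add: linear_subspace_def)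
  have inv: "\<exists>y\<in>L. vadd V x y = vzero V" if "x \<in> L" for x
    using vadd_uminus[OF V LV[OF that]] Ls(3)[OF that] by blast
  show ?thesis
    unfolding real_vector_space_def c o
    by (intro conjI ballI allI)
       (auto intro: Ls inv LV rvs_assoc[OF V] rvs_comm[OF V] rvs_zero_left[OF V] rvs_distrib[OF V]
         rvs_distrib_scalar[OF V] rvs_scale_scale[OF V] rvs_one[OF V])
qed

lemma vcarrier_quotient_tvs: "vcarrier (quotient_tvs V Z) = vcoset V Z ` vcarrier V"
  by (simp add: quotient_tvs_def topspace_quotient_topology)

lemma vzero_quotient_tvs:
  assumes V: "real_vector_space V" and Z: "linear_subspace V Z"
  shows "vzero (quotient_tvs V Z) = vcoset V Z (vzero V)"
proof -
  have "vadd V (vzero V) z = z" if "z \<in> Z" for z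
    using that Z rvs_zero_left[OF V] by (auto simp: linear_subspace_def)
  then show ?thesis by (simp add: quotient_tvs_def vcoset_def)
qed

lemma real_vector_space_quotient_tvs:
  assumes V: "real_vector_space V" and Z: "linear_subspace V Z"
  shows "real_vector_space (quotient_tvs V Z)"
proof -
  note add = vadd_quotient_tvs[OF V Z]
  note scale = vscale_quotient_tvs[OF V Z]
  note zero = vzero_quotient_tvs[OF V Z]
  have inv: "\<exists>y\<in>vcarrier V. vcoset V Z (vadd V x y) = vcoset V Z (vzero V)" if "x \<in> vcarrier V" for x
    using vadd_uminus[OF V that] rvs_scale[OF V that] by metis
  have comm: "y \<in> vcoset V Z (vadd V u v)" if "y \<in> vcoset V Z (vadd V v u)" "u \<in> vcarrier V" "v \<in> vcarrier V" for y u v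
    using that rvs_comm[OF V that(2,3)] by simp
  show ?thesis
    unfolding real_vector_space_def vcarrier_quotient_tvs zero
    by (intro conjI ballI allI)
       (auto simp: add scale rvs_zero[OF V] rvs_add[OF V] rvs_scale[OF V] rvs_assoc[OF V]
          rvs_zero_left[OF V] rvs_distrib[OF V] rvs_distrib_scalar[OF V] rvs_scale_scale[OF V]
          rvs_one[OF V] intro: inv comm)
qed

lemma vcoset_add_element:
  assumes V: "real_vector_space V" and Z: "linear_subspace V Z" and x: "x \<in> vcarrier V" and z: "z \<in> Z"
  shows "vcoset V Z (vadd V x z) = vcoset V Z x"
proof -
  have ZV: "u \<in> vcarrier V" if "u \<in> Z" for u using Z that by (auto simp: linear_subspace_def)
  have Zs: "\<And>u v. u \<in> Z \<Longrightarrow> v \<in> Z \<Longrightarrow> vadd V u v \<in> Z" "\<And>a u. u \<in> Z \<Longrightarrow> vscale V a u \<in> Z"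
    using Z by (simp_all add: linear_subspace_def)
  have "vadd V (vadd V x z) u \<in> vcoset V Z x" if "u \<in> Z" for u
    using rvs_assoc[OF V x ZV[OF z] ZV[OF that]] Zs(1)[OF z that] by (simp add: vcoset_def)
  moreover have "vadd V x u \<in> vcoset V Z (vadd V x z)" if u: "u \<in> Z" for u
  proof -
    let ?w = "vadd V u (vscale V (- 1) z)"
    have w: "?w \<in> Z" by (intro Zs u z)
    have "vadd V (vadd V x z) ?w = vadd V x (vadd V z ?w)" by (rule rvs_assoc[OF V x ZV[OF z] ZV[OF w]])
    also have "vadd V z ?w = vadd V ?w (vscale V 1 z)"
      using rvs_comm[OF V ZV[OF z] ZV[OF w]] rvs_one[OF V ZV[OF z]] by simp
    also have "\<dots> = u" by (rule vadd_scale_cancel[OF V ZV[OF u] ZV[OF z]])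
    finally show ?thesis using w unfolding vcoset_def by (metis imageI)
  qed
  ultimately show ?thesis by (auto simp: vcoset_def)
qed

text \<open>A continuous linear map T with a continuous linear right inverse S makes its target W a complemented
  subspace, namely the range of S with projection S o T, and at the same time a quotient, by the
  kernel of T. The map induced on the quotient is a homeomorphism because
  S followed by the quotient map is its continuous inverse.\<close>

context
  fixes V :: "'v tvs" and W :: "'w tvs" and T :: "'v \<Rightarrow> 'w" and S :: "'w \<Rightarrow> 'v"
  assumes V: "real_vector_space V" and W: "real_vector_space W"
    and T: "linear_map_on V W T" "continuous_map (vtop V) (vtop W) T"
    and S: "linear_map_on W V S" "continuous_map (vtop W) (vtop V) S"
    and TS: "\<And>w. w \<in> vcarrier W \<Longrightarrow> T (S w) = w"
begin

private lemma TV: "x \<in> vcarrier V \<Longrightarrow> T x \<in> vcarrier W"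
  and Tadd: "x \<in> vcarrier V \<Longrightarrow> y \<in> vcarrier V \<Longrightarrow> T (vadd V x y) = vadd W (T x) (T y)"
  and Tscale: "x \<in> vcarrier V \<Longrightarrow> T (vscale V a x) = vscale W a (T x)"
  and SW: "w \<in> vcarrier W \<Longrightarrow> S w \<in> vcarrier V"
  and Sadd: "w \<in> vcarrier W \<Longrightarrow> w' \<in> vcarrier W \<Longrightarrow> S (vadd W w w') = vadd V (S w) (S w')"
  and Sscale: "w \<in> vcarrier W \<Longrightarrow> S (vscale W a w) = vscale V a (S w)"
  using T(1) S(1) unfolding linear_map_on_def by blast+

lemma linear_subspace_section: "linear_subspace V (S ` vcarrier W)"
proof -
  have "vadd V (S w) (S w') \<in> S ` vcarrier W" if "w \<in> vcarrier W" "w' \<in> vcarrier W" for w w'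
    using Sadd[OF that] rvs_add[OF W that] by (metis imageI)
  moreover have "vscale V a (S w) \<in> S ` vcarrier W" if "w \<in> vcarrier W" for w a
    using Sscale[OF that] rvs_scale[OF W that] by (metis imageI)
  moreover have "vzero V \<in> S ` vcarrier W"
    using linear_map_vzero[OF W V S(1)] rvs_zero[OF W] by (metis imageI)
  ultimately show ?thesis using SW unfolding linear_subspace_def by blast
qed

lemma complemented_section: "complemented_subspace V (S ` vcarrier W)"
  unfolding complemented_subspace_def
proof (intro conjI exI[of _ "S \<circ> T"] linear_subspace_section)
  show "linear_map_on V V (S \<circ> T)"
    unfolding linear_map_on_def by (auto simp: TV SW Tadd Tscale Sadd Sscale)
  show "continuous_map (vtop V) (vtop V) (S \<circ> T)" by (rule continuous_map_compose[OF T(2) S(2)])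
  show "\<forall>x\<in>vcarrier V. (S \<circ> T) ((S \<circ> T) x) = (S \<circ> T) x" by (simp add: TS TV)
  have "S w \<in> (S \<circ> T) ` vcarrier V" if "w \<in> vcarrier W" for w
    using TS[OF that] SW[OF that] by (metis comp_apply imageI)
  then show "(S \<circ> T) ` vcarrier V = S ` vcarrier W" using TV by auto
qed

lemma isomorphic_section: "isomorphic_tvs (sub_tvs V (S ` vcarrier W)) W"
  unfolding isomorphic_tvs_def homeomorphic_map_maps
proof (intro exI[of _ T] exI[of _ S] conjI)
  show "linear_map_on (sub_tvs V (S ` vcarrier W)) W T"
    unfolding linear_map_on_def vcarrier_sub_tvs[OF linear_subspace_section]
    by (auto simp: sub_tvs_def TS Tadd Tscale SW rvs_add[OF W] rvs_scale[OF W])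
  have "continuous_map (vtop (sub_tvs V (S ` vcarrier W))) (vtop W) T"
    using T(2) by (simp add: sub_tvs_def continuous_map_from_subtopology)
  moreover have "continuous_map (vtop W) (vtop (sub_tvs V (S ` vcarrier W))) S"
    using S(2) by (simp add: sub_tvs_def continuous_map_in_subtopology)
  ultimately show "homeomorphic_maps (vtop (sub_tvs V (S ` vcarrier W))) (vtop W) T S"
    unfolding homeomorphic_maps_def vcarrier_sub_tvs[OF linear_subspace_section] by (auto simp: TS)
qed

lemma linear_subspace_kernel: "linear_subspace V {x \<in> vcarrier V. T x = vzero W}"
  using linear_map_vzero[OF V W T(1)] vscale_0[OF W rvs_zero[OF W]] rvs_scale_scale[OF W rvs_zero[OF W], of _ 0]
  unfolding linear_subspace_def
  by (auto simp: rvs_zero[OF V] rvs_add[OF V] rvs_scale[OF V] Tadd Tscale rvs_zero_left[OF W] rvs_zero[OF W])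

lemma closed_kernel:
  assumes "closedin (vtop W) {vzero W}"
  shows "closed_linear_subspace V {x \<in> vcarrier V. T x = vzero W}"
  using linear_subspace_kernel closedin_continuous_map_preimage[OF T(2) assms]
  by (simp add: closed_linear_subspace_def)

lemma isomorphic_quotient_kernel:
  "isomorphic_tvs (quotient_tvs V {x \<in> vcarrier V. T x = vzero W}) W"
proof -
  define Z where "Z = {x \<in> vcarrier V. T x = vzero W}"
  let ?Q = "quotient_tvs V Z"
  have Z: "linear_subspace V Z" using linear_subspace_kernel by (simp add: Z_def)
  \<comment> \<open>T is constant on cosets of its kernel, so the choice of the representative does not matter.\<close>
  define U where "U A = T (SOME x. x \<in> A)" for A
  have U: "U (vcoset V Z x) = T x" if x: "x \<in> vcarrier V" for x
  proof -
    have "vcoset V Z x \<noteq> {}" using Z by (auto simp: vcoset_def linear_subspace_def)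
    then have "(SOME y. y \<in> vcoset V Z x) \<in> vcoset V Z x" by (simp add: some_in_eq)
    then obtain z where z: "z \<in> Z" "(SOME y. y \<in> vcoset V Z x) = vadd V x z" by (auto simp: vcoset_def)
    have "T (vadd V x z) = T x"
      using z(1) x Tadd[OF x, of z] rvs_zero_right[OF W TV[OF x]] by (simp add: Z_def)
    then show ?thesis by (simp add: U_def z(2))
  qed
  have "linear_map_on ?Q W U"
    unfolding linear_map_on_def vcarrier_quotient_tvs
    by (auto simp: U TV vadd_quotient_tvs[OF V Z] vscale_quotient_tvs[OF V Z] rvs_add[OF V] rvs_scale[OF V]
        Tadd Tscale)
  moreover have "homeomorphic_maps (vtop ?Q) (vtop W) U (vcoset V Z \<circ> S)"
    unfolding homeomorphic_maps_def
  proof (intro conjI ballI)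
    show "continuous_map (vtop ?Q) (vtop W) U"
    proof (rule continuous_compose_quotient_map[OF quotient_map_vcoset])
      show "continuous_map (vtop V) (vtop W) (U \<circ> vcoset V Z)"
        by (rule continuous_map_eq[OF T(2)]) (simp add: U)
    qed
    show "continuous_map (vtop W) (vtop ?Q) (vcoset V Z \<circ> S)"
      by (rule continuous_map_compose[OF S(2) quotient_imp_continuous_map[OF quotient_map_vcoset]])
    show "U ((vcoset V Z \<circ> S) w) = w" if "w \<in> vcarrier W" for w
      using that by (simp add: U SW TS)
    fix A assume "A \<in> vcarrier ?Q"
    then obtain x where x: "x \<in> vcarrier V" "A = vcoset V Z x" by (auto simp: vcarrier_quotient_tvs)
    let ?y = "S (T x)"
    have y: "?y \<in> vcarrier V" "T ?y = T x" using x by (simp_all add: SW TV TS)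
    have x1: "vscale V (-1) x \<in> vcarrier V" by (rule rvs_scale[OF V x(1)])
    let ?z = "vadd V ?y (vscale V (-1) x)"
    have zV: "?z \<in> vcarrier V" by (rule rvs_add[OF V y(1) x1])
    have "T ?z = vadd W (T x) (vscale W (-1) (T x))" using Tadd[OF y(1) x1] Tscale[OF x(1)] y(2) by simp
    then have z: "?z \<in> Z" using zV vadd_uminus[OF W TV[OF x(1)]] by (simp add: Z_def)
    have "vadd V x ?z = vadd V ?z (vscale V 1 x)"
      using rvs_comm[OF V x(1) zV] rvs_one[OF V x(1)] by simp
    also have "\<dots> = ?y" by (rule vadd_scale_cancel[OF V y(1) x(1)])
    finally have "vcoset V Z ?y = vcoset V Z x" using vcoset_add_element[OF V Z x(1) z] by simp
    then show "(vcoset V Z \<circ> S) (U A) = A" by (simp add: x(2) U x(1))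
  qed
  ultimately show ?thesis
    unfolding isomorphic_tvs_def homeomorphic_map_maps Z_def by blast
qed

end

lemma c0_simps:
  "vzero c0_space = (\<lambda>n. 0)" "vadd c0_space s t = (\<lambda>n. s n + t n)" "vscale c0_space a s = (\<lambda>n. a * s n)"
  by (simp_all add: c0_space_def)

lemma continuous_map_into_c0_iff:
  "continuous_map T (vtop c0_space) g \<longleftrightarrow>
     (\<forall>t\<in>topspace T. g t \<longlonglongrightarrow> 0) \<and> (\<forall>n. continuous_map T euclideanreal (\<lambda>t. g t n))"
  by (auto simp: c0_space_def continuous_map_in_subtopology continuous_map_componentwise_UNIV image_subset_iff)

lemma continuous_map_c0_eval: "continuous_map (vtop c0_space) euclideanreal (\<lambda>s. s n)"
  using continuous_map_into_c0_iff[of "vtop c0_space" id] by simp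

lemma continuous_map_into_Cp_iff:
  "continuous_map T (vtop (Cp X)) g \<longleftrightarrow>
     (\<forall>t\<in>topspace T. g t \<in> vcarrier (Cp X)) \<and>
     (\<forall>x\<in>topspace X. continuous_map T euclideanreal (\<lambda>t. g t x))"
proof -
  have "continuous_map T (vtop (Cp X)) g \<longleftrightarrow> continuous_map T (powertop_real (topspace X)) g \<and>
      (\<forall>t\<in>topspace T. continuous_map X euclideanreal (g t))"
    by (auto simp: Cp_def continuous_map_in_subtopology image_subset_iff)
  then show ?thesis
    by (auto simp: continuous_map_componentwise vcarrier_Cp)
qed

text \<open>At each point at most one term of the series is nonzero, so its tail is bounded by the supremum of
  the tail of the null sequence s, and the partial sums converge uniformly.\<close>

lemma disjoint_series_continuous:
  fixes f :: "nat \<Rightarrow> 'a \<Rightarrow> real"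
  assumes f: "\<And>k. continuous_map X euclideanreal (f k)" "\<And>k x. \<bar>f k x\<bar> \<le> 1"
    and disj: "\<And>j k x. f j x \<noteq> 0 \<Longrightarrow> f k x \<noteq> 0 \<Longrightarrow> j = k" and s: "s \<longlonglongrightarrow> 0"
  shows "continuous_map X euclideanreal (\<lambda>x. \<Sum>k | f k x \<noteq> 0. s k * f k x)"
proof -
  let ?g = "\<lambda>x. \<Sum>k | f k x \<noteq> 0. s k * f k x"
  have "continuous_map X Met_TC.mtopology ?g"
  proof (rule Met_TC.continuous_map_uniform_limit[where F=sequentially and f="\<lambda>n x. \<Sum>k<n. s k * f k x"])
    show "\<forall>\<^sub>F n in sequentially. continuous_map X Met_TC.mtopology (\<lambda>x. \<Sum>k<n. s k * f k x)"
      unfolding mtopology_is_euclidean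
      by (intro always_eventually allI continuous_map_sum continuous_map_real_mult_left f) auto
    fix e :: real assume e: "0 < e"
    then have "\<forall>\<^sub>F n in sequentially. \<bar>s n\<bar> < e" using tendstoD[OF s e] by (simp add: dist_real_def)
    then obtain N where N: "\<And>n. n \<ge> N \<Longrightarrow> \<bar>s n\<bar> < e" by (auto simp: eventually_sequentially)
    have "dist (\<Sum>k<n. s k * f k x) (?g x) < e" if n: "n \<ge> N" for n x
    proof (cases "\<exists>k. f k x \<noteq> 0")
      case False
      then have "{k. f k x \<noteq> 0} = {}" "(\<Sum>k<n. s k * f k x) = 0" by auto
      then show ?thesis using e by (simp only: sum.empty dist_self)
    next
      case True
      then obtain i where i: "f i x \<noteq> 0" by blast
      then have "{k. f k x \<noteq> 0} = {i}" and z: "\<And>k. k \<noteq> i \<Longrightarrow> f k x = 0" using disj by blast+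
      then have g: "?g x = s i * f i x" by simp
      have "(\<Sum>k<n. s k * f k x) = (\<Sum>k<n. if k = i then s i * f i x else 0)"
        by (rule sum.cong) (use z in auto)
      then have h: "(\<Sum>k<n. s k * f k x) = (if i < n then s i * f i x else 0)" by simp
      show ?thesis
      proof (cases "i < n")
        case False
        then have "\<bar>s i\<bar> * \<bar>f i x\<bar> < e * 1"
          using N[of i] n f(2)[of i x] i by (intro mult_less_le_imp_less) auto
        then show ?thesis unfolding g h using False by (simp add: dist_real_def abs_mult)
      qed (use e g h in simp)
    qed
    then show "\<forall>\<^sub>F n in sequentially. \<forall>x\<in>topspace X. ?g x \<in> UNIV \<and> dist (\<Sum>k<n. s k * f k x) (?g x) < e"
      unfolding eventually_sequentially by blast
  qed simp
  then show ?thesis by simp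
qed

text \<open>A biorthogonal system (a_k, f_k) gives T g = (a_k(g)) and S s = sum s_k f_k. The map S is
  continuous for the pointwise topologies because only one term matters at a given point, although
  the series converges uniformly for null sequences only.\<close>

lemma JNP_imp_c0_retraction:
  assumes X: "tychonoff_space X" and J: "JNP X"
  obtains T S where "linear_map_on (Cp X) c0_space T" "continuous_map (vtop (Cp X)) (vtop c0_space) T"
    "linear_map_on c0_space (Cp X) S" "continuous_map (vtop c0_space) (vtop (Cp X)) S"
    "\<And>w. w \<in> vcarrier c0_space \<Longrightarrow> T (S w) = w"
proof -
  obtain a f where a: "\<And>k. fin_measure X (a k)" and null: "weakly_null X a"
    and f: "\<And>k. continuous_map X euclideanreal (f k)" "\<And>k x. \<bar>f k x\<bar> \<le> 1"
    and disj: "\<And>j k x. f j x \<noteq> 0 \<Longrightarrow> f k x \<noteq> 0 \<Longrightarrow> j = k"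
    and biorth: "\<And>j k. pairing (a k) (f j) = (if j = k then 1 else 0)"
    by (rule JNP_imp_biorthogonal_system[OF X J]) (rule that; assumption)
  define T where "T g = (\<lambda>k. pairing (a k) g)" for g
  define G where "G s x = (\<Sum>k | f k x \<noteq> 0. s k * f k x)" for s x
  define S where "S s = restrict (G s) (topspace X)" for s
  have fin: "finite {k. f k x \<noteq> 0}" for x
  proof (cases "\<exists>k. f k x \<noteq> 0")
    case True
    then obtain i where "f i x \<noteq> 0" by blast
    then have "{k. f k x \<noteq> 0} \<subseteq> {i}" using disj by blast
    then show ?thesis using finite_subset by blast
  qed simp
  have S_in: "S s \<in> vcarrier (Cp X)" if "s \<longlonglongrightarrow> 0" for s
    unfolding S_def G_def by (rule restrict_in_Cp[OF disjoint_series_continuous[OF f disj that]])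
  have T_in: "T g \<longlonglongrightarrow> 0" if "g \<in> vcarrier (Cp X)" for g
    using null Cp_continuous[OF that] by (simp add: T_def weakly_null_def)
  show thesis
  proof
    show "linear_map_on (Cp X) c0_space T"
      unfolding linear_map_on_def vcarrier_c0_space
    proof (intro conjI ballI allI)
      show "T ` vcarrier (Cp X) \<subseteq> {s. s \<longlonglongrightarrow> 0}" using T_in by blast
      show "T (vadd (Cp X) g h) = vadd c0_space (T g) (T h)" for g h
        unfolding T_def Cp_simps c0_simps by (simp only: pairing_restrict[OF a] pairing_add)
      show "T (vscale (Cp X) t g) = vscale c0_space t (T g)" for t g
        unfolding T_def Cp_simps c0_simps by (simp only: pairing_restrict[OF a] pairing_scale)
    qed
    show "continuous_map (vtop (Cp X)) (vtop c0_space) T"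
      unfolding continuous_map_into_c0_iff using T_in continuous_map_pairing[OF a] by (simp add: T_def)
    show "linear_map_on c0_space (Cp X) S"
      unfolding linear_map_on_def vcarrier_c0_space
    proof (intro conjI ballI allI)
      show "S ` {s. s \<longlonglongrightarrow> 0} \<subseteq> vcarrier (Cp X)" using S_in by blast
      show "S (vadd c0_space s t) = vadd (Cp X) (S s) (S t)" for s t
        unfolding Cp_simps c0_simps S_def
        by (rule restrict_ext) (simp add: G_def algebra_simps sum.distrib)
      show "S (vscale c0_space r s) = vscale (Cp X) r (S s)" for r s
        unfolding Cp_simps c0_simps S_def
        by (rule restrict_ext) (simp add: G_def algebra_simps sum_distrib_left)
    qed
    show "continuous_map (vtop c0_space) (vtop (Cp X)) S"
      unfolding continuous_map_into_Cp_iff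
    proof (intro conjI ballI)
      show "S s \<in> vcarrier (Cp X)" if "s \<in> topspace (vtop c0_space)" for s
        using that S_in by (simp add: vcarrier_c0_space)
      fix x assume x: "x \<in> topspace X"
      have "continuous_map (vtop c0_space) euclideanreal (\<lambda>s. \<Sum>k | f k x \<noteq> 0. s k * f k x)"
        by (intro continuous_map_sum continuous_map_real_mult_right continuous_map_c0_eval fin)
      then show "continuous_map (vtop c0_space) euclideanreal (\<lambda>s. S s x)"
        using x by (simp add: S_def G_def)
    qed
    fix s assume "s \<in> vcarrier c0_space"
    have "pairing (a n) (G s) = s n" for n
    proof -
      let ?J = "insert n (\<Union>x\<in>{x. a n x \<noteq> 0}. {k. f k x \<noteq> 0})"
      have J: "finite ?J" using fin_measure_finite[OF a[of n]] fin by blast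
      have "pairing (a n) (G s) = pairing (a n) (\<lambda>x. \<Sum>k\<in>?J. s k * f k x)"
      proof (rule pairing_cong)
        fix x assume "a n x \<noteq> 0"
        then show "G s x = (\<Sum>k\<in>?J. s k * f k x)"
          unfolding G_def by (intro sum.mono_neutral_left J) auto
      qed
      also have "\<dots> = (\<Sum>k\<in>?J. s k * pairing (a n) (f k))" unfolding pairing_sum pairing_scale ..
      also have "\<dots> = (\<Sum>k\<in>?J. if k = n then s n else 0)" by (rule sum.cong) (auto simp: biorth)
      also have "\<dots> = s n" using sum.delta[OF J, of n "\<lambda>_. s n"] by simp
      finally show ?thesis .
    qed
    then show "T (S s) = s" unfolding T_def S_def pairing_restrict[OF a] by simp
  qed
qed

section \<open>Spaces isomorphic to c_0\<close>

text \<open>The topology of V is the one induced by a single map U. Local convexity and the structure of a Frechet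
  space are inherited along linear maps of this kind, which covers both isomorphisms and the transport
  of a norm to a space of cosets.\<close>

definition initial_topology_on :: "'v tvs \<Rightarrow> ('v \<Rightarrow> 'w) \<Rightarrow> 'w topology \<Rightarrow> bool" where
  "initial_topology_on V U Y \<longleftrightarrow>
     (\<forall>S. openin (vtop V) S \<longleftrightarrow> (\<exists>Q. openin Y Q \<and> S = {x \<in> vcarrier V. U x \<in> Q}))"

lemma continuous_map_initial:
  assumes "initial_topology_on V U Y" "U ` vcarrier V \<subseteq> topspace Y"
  shows "continuous_map (vtop V) Y U"
  unfolding continuous_map_def
proof (intro conjI allI impI)
  show "U \<in> vcarrier V \<rightarrow> topspace Y" using assms(2) by auto
  fix Q assume "openin Y Q"
  then show "openin (vtop V) {x \<in> vcarrier V. U x \<in> Q}"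
    using assms(1) unfolding initial_topology_on_def by metis
qed

lemma continuous_map_into_initial:
  assumes V: "initial_topology_on V U Y" and g: "\<And>t. t \<in> topspace T \<Longrightarrow> g t \<in> vcarrier V"
    and Ug: "continuous_map T Y (\<lambda>t. U (g t))"
  shows "continuous_map T (vtop V) g"
  unfolding continuous_map_def
proof (intro conjI allI impI)
  show "g \<in> topspace T \<rightarrow> vcarrier V" using g by blast
  fix S assume "openin (vtop V) S"
  then obtain Q where Q: "openin Y Q" "S = {x \<in> vcarrier V. U x \<in> Q}"
    using V unfolding initial_topology_on_def by blast
  have "{t \<in> topspace T. g t \<in> S} = {t \<in> topspace T. U (g t) \<in> Q}" using g Q(2) by blast
  then show "openin T {t \<in> topspace T. g t \<in> S}"
    using openin_continuous_map_preimage[OF Ug Q(1)] by simp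
qed

lemma locally_convex_initial:
  assumes W: "locally_convex_space W" and V: "real_vector_space V" and lin: "linear_map_on V W U"
    and init: "initial_topology_on V U (vtop W)"
  shows "locally_convex_space V"
proof -
  have UW: "U ` vcarrier V \<subseteq> vcarrier W"
    and Uadd: "\<And>x y. x \<in> vcarrier V \<Longrightarrow> y \<in> vcarrier V \<Longrightarrow> U (vadd V x y) = vadd W (U x) (U y)"
    and Uscale: "\<And>a x. x \<in> vcarrier V \<Longrightarrow> U (vscale V a x) = vscale W a (U x)"
    using lin unfolding linear_map_on_def by blast+
  have W': "real_vector_space W"
    and Wadd: "continuous_map (prod_topology (vtop W) (vtop W)) (vtop W) (\<lambda>(x, y). vadd W x y)"
    and Wscale: "continuous_map (prod_topology euclideanreal (vtop W)) (vtop W) (\<lambda>(a, x). vscale W a x)"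
    using W by (simp_all add: locally_convex_space_def topological_vector_space_def)
  have Wconv: "\<exists>C. openin (vtop W) C \<and> vzero W \<in> C \<and> C \<subseteq> Q \<and> convex_in W C"
    if "openin (vtop W) Q" "vzero W \<in> Q" for Q
    using W that by (simp add: locally_convex_space_def)
  have cU: "continuous_map (vtop V) (vtop W) U" by (rule continuous_map_initial[OF init UW])
  have cU1: "continuous_map (prod_topology T (vtop V)) (vtop W) (\<lambda>p. U (snd p))" for T :: "'c topology"
    using continuous_map_compose[OF continuous_map_snd cU] by (simp add: o_def)
  have cU2: "continuous_map (prod_topology (vtop V) T) (vtop W) (\<lambda>p. U (fst p))" for T :: "'c topology"
    using continuous_map_compose[OF continuous_map_fst cU] by (simp add: o_def)
  have "topological_vector_space V" unfolding topological_vector_space_def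
  proof (intro conjI V)
    show "continuous_map (prod_topology (vtop V) (vtop V)) (vtop V) (\<lambda>(x, y). vadd V x y)"
    proof (rule continuous_map_into_initial[OF init])
      have "continuous_map (prod_topology (vtop V) (vtop V)) (prod_topology (vtop W) (vtop W)) (\<lambda>p. (U (fst p), U (snd p)))"
        by (intro continuous_map_pairedI cU1 cU2)
      from continuous_map_compose[OF this Wadd]
      show "continuous_map (prod_topology (vtop V) (vtop V)) (vtop W) (\<lambda>p. U (case p of (x, y) \<Rightarrow> vadd V x y))"
      proof (rule continuous_map_eq)
        fix p assume "p \<in> topspace (prod_topology (vtop V) (vtop V))"
        then have "fst p \<in> vcarrier V" "snd p \<in> vcarrier V" by auto
        then show "((\<lambda>(x, y). vadd W x y) \<circ> (\<lambda>p. (U (fst p), U (snd p)))) p = U (case p of (x, y) \<Rightarrow> vadd V x y)"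
          by (simp add: split_def Uadd)
      qed
      fix p assume "p \<in> topspace (prod_topology (vtop V) (vtop V))"
      then have "fst p \<in> vcarrier V" "snd p \<in> vcarrier V" by auto
      then show "(case p of (x, y) \<Rightarrow> vadd V x y) \<in> vcarrier V" by (simp add: split_def rvs_add[OF V])
    qed
    show "continuous_map (prod_topology euclideanreal (vtop V)) (vtop V) (\<lambda>(a, x). vscale V a x)"
    proof (rule continuous_map_into_initial[OF init])
      have "continuous_map (prod_topology euclideanreal (vtop V)) (prod_topology euclideanreal (vtop W)) (\<lambda>p. (fst p, U (snd p)))"
        by (intro continuous_map_pairedI continuous_map_fst cU1)
      from continuous_map_compose[OF this Wscale]
      show "continuous_map (prod_topology euclideanreal (vtop V)) (vtop W) (\<lambda>p. U (case p of (a, x) \<Rightarrow> vscale V a x))"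
      proof (rule continuous_map_eq)
        fix p assume "p \<in> topspace (prod_topology euclideanreal (vtop V))"
        then have "snd p \<in> vcarrier V" by auto
        then show "((\<lambda>(a, x). vscale W a x) \<circ> (\<lambda>p. (fst p, U (snd p)))) p = U (case p of (a, x) \<Rightarrow> vscale V a x)"
          by (simp add: split_def Uscale)
      qed
      fix p assume "p \<in> topspace (prod_topology euclideanreal (vtop V))"
      then have "snd p \<in> vcarrier V" by auto
      then show "(case p of (a, x) \<Rightarrow> vscale V a x) \<in> vcarrier V" by (simp add: split_def rvs_scale[OF V])
    qed
  qed
  moreover have "\<exists>C. openin (vtop V) C \<and> vzero V \<in> C \<and> C \<subseteq> S \<and> convex_in V C"
    if S: "openin (vtop V) S" "vzero V \<in> S" for S
  proof -
    obtain Q where Q: "openin (vtop W) Q" "S = {x \<in> vcarrier V. U x \<in> Q}"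
      using S(1) init unfolding initial_topology_on_def by metis
    have U0: "U (vzero V) = vzero W" by (rule linear_map_vzero[OF V W' lin])
    then have "vzero W \<in> Q" using S(2) Q(2) by auto
    then obtain C where C: "openin (vtop W) C" "vzero W \<in> C" "C \<subseteq> Q" "convex_in W C"
      using Wconv Q(1) by blast
    let ?C = "{x \<in> vcarrier V. U x \<in> C}"
    have "openin (vtop V) ?C" using C(1) init unfolding initial_topology_on_def by metis
    moreover have "convex_in V ?C" unfolding convex_in_def
    proof (intro ballI)
      fix x y and t :: real assume xy: "x \<in> ?C" "y \<in> ?C" and t: "t \<in> {0..1}"
      have x: "x \<in> vcarrier V" and y: "y \<in> vcarrier V" using xy by auto
      have "vadd W (vscale W (1 - t) (U x)) (vscale W t (U y)) \<in> C"
        using C(4) xy t unfolding convex_in_def by blast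
      then show "vadd V (vscale V (1 - t) x) (vscale V t y) \<in> ?C"
        using Uadd[OF rvs_scale[OF V x] rvs_scale[OF V y]] Uscale[OF x] Uscale[OF y]
          rvs_add[OF V rvs_scale[OF V x] rvs_scale[OF V y]] by simp
    qed
    moreover have "vzero V \<in> ?C" "?C \<subseteq> S" using C(2,3) Q(2) U0 rvs_zero[OF V] by auto
    ultimately show ?thesis by (intro exI[of _ ?C] conjI)
  qed
  ultimately show ?thesis by (simp add: locally_convex_space_def)
qed

lemma initial_topology_homeomorphic_map:
  assumes "homeomorphic_map (vtop V) Y U"
  shows "initial_topology_on V U Y"
  unfolding initial_topology_on_def
proof (intro allI iffI)
  fix S assume S: "openin (vtop V) S"
  have "inj_on U (vcarrier V)" using assms homeomorphic_imp_injective_map by blast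
  then have "S = {x \<in> vcarrier V. U x \<in> U ` S}"
  proof (intro equalityI subsetI)
    fix x assume "x \<in> {x \<in> vcarrier V. U x \<in> U ` S}"
    then obtain y where "x \<in> vcarrier V" "y \<in> S" "U x = U y" by blast
    then show "x \<in> S" using \<open>inj_on U (vcarrier V)\<close> openin_subset[OF S] by (metis inj_onD subsetD)
  qed (use openin_subset[OF S] in blast)
  moreover have "openin Y (U ` S)"
    using homeomorphic_map_openness[OF assms openin_subset[OF S]] S by simp
  ultimately show "\<exists>Q. openin Y Q \<and> S = {x \<in> vcarrier V. U x \<in> Q}" by blast
next
  fix S assume "\<exists>Q. openin Y Q \<and> S = {x \<in> vcarrier V. U x \<in> Q}"
  then obtain Q where "openin Y Q" "S = {x \<in> vcarrier V. U x \<in> Q}" by blast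
  then show "openin (vtop V) S"
    using openin_continuous_map_preimage[OF homeomorphic_imp_continuous_map[OF assms]] by simp
qed

lemma locally_convex_c0: "locally_convex_space c0_space"
proof -
  have ev: "continuous_map T euclideanreal (\<lambda>t. g t n)" if "continuous_map T (vtop c0_space) g" for T :: "'b topology" and g n
    using that by (simp add: continuous_map_into_c0_iff)
  have t: "topological_vector_space c0_space" unfolding topological_vector_space_def
  proof (intro conjI real_vector_space_c0_space)
    show "continuous_map (prod_topology (vtop c0_space) (vtop c0_space)) (vtop c0_space) (\<lambda>(x, y). vadd c0_space x y)"
      unfolding continuous_map_into_c0_iff
    proof (intro conjI ballI allI)
      fix n
      have "continuous_map (prod_topology (vtop c0_space) (vtop c0_space)) euclideanreal (\<lambda>p. fst p n + snd p n)"
        by (intro continuous_map_add ev continuous_map_fst continuous_map_snd)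
      then show "continuous_map (prod_topology (vtop c0_space) (vtop c0_space)) euclideanreal
          (\<lambda>p. (case p of (x, y) \<Rightarrow> vadd c0_space x y) n)"
        by (simp add: c0_simps split_def)
    qed (auto simp: vcarrier_c0_space c0_simps intro: tendsto_add_zero)
    show "continuous_map (prod_topology euclideanreal (vtop c0_space)) (vtop c0_space) (\<lambda>(a, x). vscale c0_space a x)"
      unfolding continuous_map_into_c0_iff
    proof (intro conjI ballI allI)
      fix n
      have "continuous_map (prod_topology euclideanreal (vtop c0_space)) euclideanreal (\<lambda>p. fst p * snd p n)"
        by (intro continuous_map_real_mult ev continuous_map_fst continuous_map_snd)
      then show "continuous_map (prod_topology euclideanreal (vtop c0_space)) euclideanreal
          (\<lambda>p. (case p of (a, x) \<Rightarrow> vscale c0_space a x) n)"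
        by (simp add: c0_simps split_def)
    qed (auto simp: vcarrier_c0_space c0_simps intro: tendsto_mult_right_zero)
  qed
  have "\<exists>C. openin (vtop c0_space) C \<and> vzero c0_space \<in> C \<and> C \<subseteq> S \<and> convex_in c0_space C"
    if S: "openin (vtop c0_space) S" "vzero c0_space \<in> S" for S
  proof -
    obtain Q where Q: "openin (powertop_real UNIV) Q" "S = Q \<inter> {s. s \<longlonglongrightarrow> 0}"
      using S(1) by (auto simp: c0_space_def openin_subtopology)
    have "(\<lambda>n. 0) \<in> Q" using S(2) Q(2) by (simp add: c0_simps)
    then have "\<exists>B. finite {i. B i \<noteq> UNIV} \<and> (\<forall>i. open (B i)) \<and> (\<lambda>n. 0) \<in> Pi UNIV B \<and> Pi UNIV B \<subseteq> Q"
      using Q(1) by (simp add: openin_product_topology_alt PiE_UNIV_domain)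
    then obtain B where B: "finite {i. B i \<noteq> UNIV}" "\<And>i. open (B i)" "\<And>i. 0 \<in> B i" "Pi UNIV B \<subseteq> Q"
      by (auto simp: Pi_iff)
    have "\<exists>e>0. ball 0 e \<subseteq> B i" for i using B(2)[of i] B(3)[of i] by (simp add: open_contains_ball)
    then obtain e where e: "\<And>i. e i > 0" "\<And>i. ball 0 (e i) \<subseteq> B i" by metis
    let ?F = "{i. B i \<noteq> UNIV}"
    let ?C = "{s \<in> vcarrier c0_space. \<forall>i\<in>?F. s i \<in> ball 0 (e i)}"
    have "openin (vtop c0_space) ({s \<in> vcarrier c0_space. s i \<in> ball 0 (e i)})" for i
      by (rule openin_continuous_map_preimage[OF continuous_map_c0_eval]) simp
    then have "openin (vtop c0_space) (vcarrier c0_space \<inter> (\<Inter>i\<in>?F. {s \<in> vcarrier c0_space. s i \<in> ball 0 (e i)}))"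
      using B(1) by (cases "?F = {}") (auto intro!: openin_Int openin_INT2)
    moreover have "vcarrier c0_space \<inter> (\<Inter>i\<in>?F. {s \<in> vcarrier c0_space. s i \<in> ball 0 (e i)}) = ?C" by auto
    ultimately have op: "openin (vtop c0_space) ?C" by simp
    have "convex_in c0_space ?C" unfolding convex_in_def
    proof (intro ballI)
      fix x y and u :: real assume x: "x \<in> ?C" and y: "y \<in> ?C" and u: "u \<in> {0..1}"
      have "(1 - u) *\<^sub>R x i + u *\<^sub>R y i \<in> ball 0 (e i)" if "i \<in> ?F" for i
        using x y u that by (intro convexD[OF convex_ball]) auto
      moreover have "(\<lambda>n. (1 - u) * x n + u * y n) \<longlonglongrightarrow> 0"
        using x y by (intro tendsto_add_zero tendsto_mult_right_zero) (auto simp: vcarrier_c0_space)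
      ultimately show "vadd c0_space (vscale c0_space (1 - u) x) (vscale c0_space u y) \<in> ?C"
        by (simp add: c0_simps vcarrier_c0_space)
    qed
    moreover have "vzero c0_space \<in> ?C" using e(1) by (simp add: vcarrier_c0_space c0_simps)
    moreover have "?C \<subseteq> S"
    proof
      fix s assume s: "s \<in> ?C"
      have "s i \<in> B i" for i
      proof (cases "B i = UNIV")
        case False
        then have "s i \<in> ball 0 (e i)" using s by blast
        then show ?thesis using e(2) by blast
      qed simp
      then show "s \<in> S" using B(4) Q(2) s by (auto simp: vcarrier_c0_space)
    qed
    ultimately show ?thesis using op by blast
  qed
  then show ?thesis using t by (simp add: locally_convex_space_def)
qed

definition normed_tvs :: "'b::real_normed_vector tvs" where
  "normed_tvs = \<lparr>vtop = euclidean, vzero = 0, vadd = (+), vscale = scaleR\<rparr>"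

lemma locally_convex_normed_tvs: "locally_convex_space (normed_tvs :: 'b::real_normed_vector tvs)"
proof -
  have "\<exists>y. x + y = 0" for x :: 'b by (rule exI[of _ "- x"]) simp
  then have "real_vector_space (normed_tvs :: 'b tvs)"
    unfolding real_vector_space_def normed_tvs_def
    by (simp add: add.assoc add.commute scaleR_add_right scaleR_add_left)
  moreover have "continuous_map (prod_topology euclidean euclidean) euclidean (\<lambda>(x, y). x + (y::'b))"
    unfolding split_def by (intro continuous_map_add continuous_map_fst continuous_map_snd)
  moreover have "continuous_map (prod_topology euclideanreal euclidean) euclidean (\<lambda>(a, x). a *\<^sub>R (x::'b))"
  proof -
    have "continuous_on UNIV (\<lambda>p::real \<times> 'b. fst p *\<^sub>R snd p)" by (intro continuous_intros)
    then show ?thesis by (simp add: split_def)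
  qed
  ultimately have "topological_vector_space (normed_tvs :: 'b tvs)"
    unfolding topological_vector_space_def by (simp add: normed_tvs_def)
  moreover have "\<exists>C. open C \<and> 0 \<in> C \<and> C \<subseteq> S \<and> convex_in normed_tvs C" if "open S" "0 \<in> S" for S :: "'b set"
  proof -
    have "\<exists>e>0. ball 0 e \<subseteq> S" using that by (simp add: open_contains_ball)
    then obtain e where e: "e > 0" "ball 0 e \<subseteq> S" by blast
    have "convex_in normed_tvs (ball (0::'b) e)"
      unfolding convex_in_def normed_tvs_def
    proof (intro ballI)
      fix x y :: 'b and t :: real assume "x \<in> ball 0 e" "y \<in> ball 0 e" "t \<in> {0..1}"
      then have "(1 - t) *\<^sub>R x + t *\<^sub>R y \<in> ball 0 e" by (intro convexD[OF convex_ball]) auto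
      then show "vadd \<lparr>vtop = euclidean, vzero = 0, vadd = (+), vscale = scaleR\<rparr>
          (vscale \<lparr>vtop = euclidean, vzero = 0, vadd = (+), vscale = scaleR\<rparr> (1 - t) x)
          (vscale \<lparr>vtop = euclidean, vzero = 0, vadd = (+), vscale = scaleR\<rparr> t y) \<in> ball 0 e"
        by (simp only: tvs.simps)
    qed
    then show ?thesis using e by (intro exI[of _ "ball 0 e"]) simp
  qed
  moreover have "vtop normed_tvs = (euclidean :: 'b topology)" "vzero normed_tvs = (0 :: 'b)"
    by (simp_all add: normed_tvs_def)
  ultimately show ?thesis
    unfolding locally_convex_space_def by (simp only: open_openin[symmetric]) blast
qed

text \<open>The metric is the norm distance of the images, which is translation invariant because J is linear.\<close>

lemma frechet_space_initial:
  fixes J :: "'v \<Rightarrow> 'b::real_normed_vector"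
  assumes V: "real_vector_space V" and lin: "linear_map_on V normed_tvs J"
    and inj: "inj_on J (vcarrier V)" and clo: "complete (J ` vcarrier V)"
    and init: "initial_topology_on V J euclidean"
  shows "frechet_space V"
proof -
  have lc: "locally_convex_space V"
    by (rule locally_convex_initial[OF locally_convex_normed_tvs V lin]) (use init in \<open>simp add: normed_tvs_def\<close>)
  have opV: "openin (vtop V) S \<longleftrightarrow> (\<exists>Q. open Q \<and> S = {x \<in> vcarrier V. J x \<in> Q})" for S
    using init unfolding initial_topology_on_def by (simp only: open_openin[symmetric])
  define d where "d x y = dist (J x) (J y)" for x y
  interpret M: Metric_space "vcarrier V" d
  proof
    show "0 \<le> d x y" "d x y = d y x" for x y by (simp_all add: d_def dist_commute)
    show "d x y = 0 \<longleftrightarrow> x = y" if "x \<in> vcarrier V" "y \<in> vcarrier V" for x y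
      using inj_on_eq_iff[OF inj that] by (simp add: d_def)
    show "d x z \<le> d x y + d y z" for x y z by (simp add: d_def dist_triangle)
  qed
  have ball: "M.mball x r = {y \<in> vcarrier V. J y \<in> ball (J x) r}" if "x \<in> vcarrier V" for x r
    using that by (auto simp: M.mball_def d_def)
  have top: "vtop V = M.mtopology"
  proof (rule topology_eq[THEN iffD2], intro allI iffI)
    fix S assume "openin (vtop V) S"
    then obtain Q where Q: "open Q" "S = {x \<in> vcarrier V. J x \<in> Q}"
      using opV by metis
    have "\<exists>r>0. M.mball x r \<subseteq> S" if "x \<in> S" for x
    proof -
      have "J x \<in> Q" using Q(2) that by blast
      then have "\<exists>r>0. ball (J x) r \<subseteq> Q" using Q(1) by (simp add: open_contains_ball)
      then obtain r where "r > 0" "ball (J x) r \<subseteq> Q" by blast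
      moreover have "x \<in> vcarrier V" using that Q(2) by blast
      ultimately have "M.mball x r \<subseteq> S" unfolding ball[OF \<open>x \<in> vcarrier V\<close>] Q(2) by blast
      then show ?thesis using \<open>r > 0\<close> by blast
    qed
    moreover have "S \<subseteq> vcarrier V" using Q(2) by blast
    ultimately show "openin M.mtopology S" unfolding M.openin_mtopology by simp
  next
    fix S assume "openin M.mtopology S"
    then have S: "S \<subseteq> vcarrier V" "\<And>x. x \<in> S \<Longrightarrow> \<exists>r>0. M.mball x r \<subseteq> S"
      unfolding M.openin_mtopology by simp_all
    obtain r where r: "\<And>x. x \<in> S \<Longrightarrow> r x > 0" "\<And>x. x \<in> S \<Longrightarrow> M.mball x (r x) \<subseteq> S" using S(2) by metis
    have "S = {x \<in> vcarrier V. J x \<in> (\<Union>x\<in>S. ball (J x) (r x))}"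
    proof (intro equalityI subsetI)
      fix x assume "x \<in> S"
      then show "x \<in> {x \<in> vcarrier V. J x \<in> (\<Union>x\<in>S. ball (J x) (r x))}" using S(1) r(1) centre_in_ball by fastforce
    next
      fix x assume "x \<in> {x \<in> vcarrier V. J x \<in> (\<Union>x\<in>S. ball (J x) (r x))}"
      then obtain y where y: "y \<in> S" "x \<in> vcarrier V" "J x \<in> ball (J y) (r y)" by blast
      have "y \<in> vcarrier V" using y(1) S(1) by blast
      then have "x \<in> M.mball y (r y)" unfolding ball[OF \<open>y \<in> vcarrier V\<close>] using y(2,3) by simp
      then show "x \<in> S" using r(2)[OF y(1)] by blast
    qed
    moreover have "open (\<Union>x\<in>S. ball (J x) (r x))" by auto
    ultimately show "openin (vtop V) S" using opV by metis
  qed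
  have "M.mcomplete" unfolding M.mcomplete_def
  proof (intro allI impI)
    fix \<sigma> assume s: "M.MCauchy \<sigma>"
    then have sV: "\<sigma> n \<in> vcarrier V" for n unfolding M.MCauchy_def by blast
    have "Cauchy (\<lambda>n. J (\<sigma> n))"
      unfolding Cauchy_def
    proof (intro allI impI)
      fix e :: real assume "0 < e"
      then obtain N where "\<forall>n n'. N \<le> n \<longrightarrow> N \<le> n' \<longrightarrow> d (\<sigma> n) (\<sigma> n') < e"
        using s unfolding M.MCauchy_def by metis
      then show "\<exists>M. \<forall>m\<ge>M. \<forall>n\<ge>M. dist (J (\<sigma> m)) (J (\<sigma> n)) < e"
        by (intro exI[of _ N]) (simp add: d_def)
    qed
    moreover have "J (\<sigma> n) \<in> J ` vcarrier V" for n using sV by blast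
    ultimately obtain l where l: "(\<lambda>n. J (\<sigma> n)) \<longlonglongrightarrow> l" and "l \<in> J ` vcarrier V"
      using clo unfolding complete_def by metis
    then obtain x where x: "x \<in> vcarrier V" "l = J x" by blast
    have "limitin M.mtopology \<sigma> x sequentially"
      unfolding M.limitin_metric using x(1)
    proof (intro conjI allI impI)
      fix e :: real assume "e > 0"
      then have "\<forall>\<^sub>F n in sequentially. dist (J (\<sigma> n)) l < e" using l by (rule tendstoD[rotated])
      then show "\<forall>\<^sub>F n in sequentially. \<sigma> n \<in> vcarrier V \<and> d (\<sigma> n) x < e"
        by eventually_elim (use sV x(2) in \<open>simp add: d_def\<close>)
    qed
    then show "\<exists>x. limitin M.mtopology \<sigma> x sequentially" by blast
  qed
  moreover have "d (vadd V x z) (vadd V y z) = d x y"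
    if "x \<in> vcarrier V" "y \<in> vcarrier V" "z \<in> vcarrier V" for x y z
  proof -
    have "J (vadd V u z) = J u + J z" if "u \<in> vcarrier V" for u
      using lin that \<open>z \<in> vcarrier V\<close> unfolding linear_map_on_def by (simp add: normed_tvs_def)
    then show ?thesis using that by (simp add: d_def dist_norm)
  qed
  ultimately show ?thesis
    unfolding frechet_space_def using lc M.Metric_space_axioms top by (intro conjI exI[of _ d]) simp_all
qed

lemma real_vector_space_vtop_update:
  "topspace T = vcarrier V \<Longrightarrow> real_vector_space (V\<lparr>vtop := T\<rparr>) \<longleftrightarrow> real_vector_space V"
  by (simp add: real_vector_space_def)

lemma rational_null_sequences_countable:
  "countable {s :: nat \<Rightarrow> real. (\<forall>i. s i \<in> \<rat>) \<and> (\<exists>N. \<forall>i\<ge>N. s i = 0)}"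
proof (rule countable_subset)
  show "countable (\<Union>N::nat. (\<lambda>f i. if i < N then f i else 0) ` PiE {..<N} (\<lambda>_. \<rat> :: real set))"
    by (intro countable_UN[OF countableI_type] countable_image countable_PiE countable_rat) auto
  show "{s :: nat \<Rightarrow> real. (\<forall>i. s i \<in> \<rat>) \<and> (\<exists>N. \<forall>i\<ge>N. s i = 0)} \<subseteq>
      (\<Union>N::nat. (\<lambda>f i. if i < N then f i else 0) ` PiE {..<N} (\<lambda>_. \<rat>))"
  proof
    fix s :: "nat \<Rightarrow> real" assume "s \<in> {s. (\<forall>i. s i \<in> \<rat>) \<and> (\<exists>N. \<forall>i\<ge>N. s i = 0)}"
    then obtain N where N: "\<And>i. s i \<in> \<rat>" "\<And>i. i \<ge> N \<Longrightarrow> s i = 0" by blast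
    have "s = (\<lambda>i. if i < N then restrict s {..<N} i else 0)" using N(2) by (auto simp: fun_eq_iff)
    moreover have "restrict s {..<N} \<in> PiE {..<N} (\<lambda>_. \<rat>)" using N(1) by auto
    ultimately show "s \<in> (\<Union>N. (\<lambda>f i. if i < N then f i else 0) ` PiE {..<N} (\<lambda>_. \<rat>))" by blast
  qed
qed

lemma null_sequence_bcontfun:
  assumes "(s :: nat \<Rightarrow> real) \<longlonglongrightarrow> 0"
  shows "s \<in> bcontfun"
  using convergent_imp_bounded[OF assms] by (simp add: bcontfun_def continuous_on_discrete)

lemma closed_null_sequences: "closed {b :: nat \<Rightarrow>\<^sub>C real. apply_bcontfun b \<longlonglongrightarrow> 0}"
  unfolding closed_sequential_limits
proof (intro allI impI, elim conjE)
  fix x :: "nat \<Rightarrow> nat \<Rightarrow>\<^sub>C real" and l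
  assume x: "\<forall>n. x n \<in> {b. apply_bcontfun b \<longlonglongrightarrow> 0}" and l: "x \<longlonglongrightarrow> l"
  have "apply_bcontfun l \<longlonglongrightarrow> 0"
  proof (rule LIMSEQ_I)
    fix r :: real assume r: "0 < r"
    then obtain n where n: "dist (x n) l < r / 2"
      using l unfolding lim_sequentially by (metis half_gt_zero order_refl)
    have "apply_bcontfun (x n) \<longlonglongrightarrow> 0" using x by blast
    then obtain N where N: "\<And>i. i \<ge> N \<Longrightarrow> \<bar>apply_bcontfun (x n) i\<bar> < r / 2"
      using LIMSEQ_D[of "apply_bcontfun (x n)" 0 "r/2"] r by auto
    have "\<bar>apply_bcontfun l i\<bar> < r" if "i \<ge> N" for i
      using N[OF that] dist_fun_lt_imp_dist_val_lt[OF n, of i] unfolding dist_real_def by linarith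
    then show "\<exists>N. \<forall>i\<ge>N. norm (apply_bcontfun l i - 0) < r" by auto
  qed
  then show "l \<in> {b. apply_bcontfun b \<longlonglongrightarrow> 0}" by simp
qed

lemma complete_null_sequences: "complete {b :: nat \<Rightarrow>\<^sub>C real. apply_bcontfun b \<longlonglongrightarrow> 0}"
  unfolding complete_def
proof (intro allI impI, elim conjE)
  fix x :: "nat \<Rightarrow> nat \<Rightarrow>\<^sub>C real"
  assume x: "\<forall>n. x n \<in> {b. apply_bcontfun b \<longlonglongrightarrow> 0}" and C: "Cauchy x"
  have "uniformly_Cauchy_on UNIV (\<lambda>n. apply_bcontfun (x n))"
    unfolding uniformly_Cauchy_on_def
  proof (intro allI impI)
    fix e :: real assume "0 < e"
    then obtain M where "\<forall>m\<ge>M. \<forall>n\<ge>M. dist (x m) (x n) < e" using C unfolding Cauchy_def by metis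
    then show "\<exists>M. \<forall>i\<in>UNIV. \<forall>m\<ge>M. \<forall>n\<ge>M. dist (x m i) (x n i) < e"
      by (intro exI[of _ M]) (simp add: dist_fun_lt_imp_dist_val_lt)
  qed
  then have "uniformly_convergent_on UNIV (\<lambda>n. apply_bcontfun (x n))"
    by (rule Cauchy_uniformly_convergent)
  then obtain l where "uniform_limit UNIV (\<lambda>n. apply_bcontfun (x n)) l sequentially"
    unfolding uniformly_convergent_on_def by metis
  then obtain l' where "x \<longlonglongrightarrow> l'"
    using uniform_limit_bcontfunE[of x l sequentially] trivial_limit_sequentially by metis
  moreover have "l' \<in> {b. apply_bcontfun b \<longlonglongrightarrow> 0}"
    using closed_sequentially[OF closed_null_sequences, of x l'] x \<open>x \<longlonglongrightarrow> l'\<close> by metis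
  ultimately show "\<exists>l\<in>{b. apply_bcontfun b \<longlonglongrightarrow> 0}. x \<longlonglongrightarrow> l" by (rule bexI)
qed

text \<open>The finer topology is the sup-norm topology of c_0, obtained by viewing null sequences as bounded
  (continuous) functions on the natural numbers. Finite rational sequences are dense in it.\<close>

lemma polishable_isomorphic_c0:
  assumes V: "real_vector_space V" and iso: "isomorphic_tvs V c0_space"
  shows "polishable V"
proof -
  obtain U where lin: "linear_map_on V c0_space U" and hom: "homeomorphic_map (vtop V) (vtop c0_space) U"
    using iso unfolding isomorphic_tvs_def by blast
  have lcV: "locally_convex_space V"
    by (rule locally_convex_initial[OF locally_convex_c0 V lin initial_topology_homeomorphic_map[OF hom]])
  have inj: "inj_on U (vcarrier V)" using hom homeomorphic_imp_injective_map by blast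
  have img: "U ` vcarrier V = {s. s \<longlonglongrightarrow> 0}"
    using homeomorphic_imp_surjective_map[OF hom] by (simp add: vcarrier_c0_space)
  have Unull: "U x \<longlonglongrightarrow> 0" if "x \<in> vcarrier V" for x using img that by blast
  have Uadd: "\<And>x y. x \<in> vcarrier V \<Longrightarrow> y \<in> vcarrier V \<Longrightarrow> U (vadd V x y) = (\<lambda>n. U x n + U y n)"
    and Uscale: "\<And>a x. x \<in> vcarrier V \<Longrightarrow> U (vscale V a x) = (\<lambda>n. a * U x n)"
    using lin unfolding linear_map_on_def by (simp_all add: c0_simps)
  define J where "J x = Bcontfun (U x)" for x
  have J: "apply_bcontfun (J x) = U x" if "x \<in> vcarrier V" for x
    unfolding J_def by (rule Bcontfun_inverse[OF null_sequence_bcontfun[OF Unull[OF that]]])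
  define T where "T = pullback_topology (vcarrier V) J euclidean"
  have openT: "openin T S \<longleftrightarrow> (\<exists>Q. open Q \<and> S = {x \<in> vcarrier V. J x \<in> Q})" for S
    unfolding T_def openin_pullback_topology by (auto simp: vimage_def Int_def conj_commute)
  have topT: "topspace T = vcarrier V" by (simp add: T_def topspace_pullback_topology)
  let ?V = "V\<lparr>vtop := T\<rparr>"
  have "frechet_space ?V"
  proof (rule frechet_space_initial[where J=J])
    show "real_vector_space ?V" using V real_vector_space_vtop_update[OF topT] by simp
    show "linear_map_on ?V normed_tvs J"
      unfolding linear_map_on_def
      by (auto simp: topT normed_tvs_def J Uadd Uscale rvs_add[OF V] rvs_scale[OF V] intro!: bcontfun_eqI)
    show "inj_on J (vcarrier ?V)"
      using inj J unfolding inj_on_def by (simp add: topT) metis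
    have "J ` vcarrier V = {b. apply_bcontfun b \<longlonglongrightarrow> 0}"
    proof (intro equalityI subsetI)
      fix b :: "nat \<Rightarrow>\<^sub>C real" assume "b \<in> {b. apply_bcontfun b \<longlonglongrightarrow> 0}"
      then obtain x where x: "x \<in> vcarrier V" "U x = apply_bcontfun b" using img by (metis imageE mem_Collect_eq)
      then have "J x = b" by (simp add: J_def apply_bcontfun_inverse)
      then show "b \<in> J ` vcarrier V" using x(1) by blast
    qed (auto simp: J Unull)
    then show "complete (J ` vcarrier ?V)" using complete_null_sequences by (simp add: topT)
    show "initial_topology_on ?V J euclidean"
      unfolding initial_topology_on_def by (simp add: topT openT)
  qed
  moreover have "openin T S" if S: "openin (vtop V) S" for S
  proof -
    have "continuous_map T euclideanreal (\<lambda>x. U x n)" for n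
    proof -
      have "continuous_on UNIV (\<lambda>b::nat \<Rightarrow>\<^sub>C real. apply_bcontfun b n)"
        unfolding continuous_on_iff using dist_fun_lt_imp_dist_val_lt by blast
      then have "continuous_map T euclideanreal ((\<lambda>b. apply_bcontfun b n) \<circ> J)"
        unfolding T_def by (intro continuous_map_pullback) simp
      then show ?thesis by (rule continuous_map_eq) (simp add: topT J)
    qed
    then have c: "continuous_map T (vtop c0_space) U"
      unfolding continuous_map_into_c0_iff using Unull by (simp add: topT)
    obtain Q where Q: "openin (vtop c0_space) Q" "S = {x \<in> vcarrier V. U x \<in> Q}"
      using S initial_topology_homeomorphic_map[OF hom] unfolding initial_topology_on_def by metis
    show ?thesis using openin_continuous_map_preimage[OF c Q(1)] by (simp add: topT Q(2))
  qed
  moreover have "separable_space T"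
  proof -
    let ?R = "{s :: nat \<Rightarrow> real. (\<forall>i. s i \<in> \<rat>) \<and> (\<exists>N. \<forall>i\<ge>N. s i = 0)}"
    let ?D = "{x \<in> vcarrier V. U x \<in> ?R}"
    have "countable (U ` ?D)" by (rule countable_subset[OF _ rational_null_sequences_countable]) blast
    moreover have "inj_on U ?D" using inj by (rule inj_on_subset) blast
    ultimately have "countable ?D" by (rule countable_image_inj_on)
    moreover have "x \<in> T closure_of ?D" if x: "x \<in> vcarrier V" for x
      unfolding in_closure_of
    proof (intro conjI allI impI)
      show "x \<in> topspace T" using x topT by simp
      fix S assume "x \<in> S \<and> openin T S"
      then obtain Q where Q: "open Q" "S = {x \<in> vcarrier V. J x \<in> Q}" "J x \<in> Q" by (auto simp: openT)
      then have "\<exists>e>0. ball (J x) e \<subseteq> Q" by (simp add: open_contains_ball)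
      then obtain e where e: "e > 0" "ball (J x) e \<subseteq> Q" by blast
      obtain N where N: "\<And>i. i \<ge> N \<Longrightarrow> \<bar>U x i\<bar> < e / 2"
        using LIMSEQ_D[OF Unull[OF x], of "e/2"] e(1) by auto
      have "\<exists>q\<in>\<rat>. \<bar>U x i - q\<bar> < e / 2" for i
      proof -
        have "U x i < U x i + e / 2" using e(1) by simp
        then obtain q where "q \<in> \<rat>" "U x i < q" "q < U x i + e / 2" using Rats_dense_in_real by blast
        then show ?thesis by (intro bexI[of _ q]) auto
      qed
      then obtain q where q: "\<And>i. q i \<in> \<rat>" "\<And>i. \<bar>U x i - q i\<bar> < e / 2" by metis
      define s where "s i = (if i < N then q i else 0)" for i
      have "s \<longlonglongrightarrow> 0"
        by (rule tendsto_eventually) (auto simp: s_def eventually_sequentially intro!: exI[of _ N])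
      then obtain y where y: "y \<in> vcarrier V" "U y = s" using img by (metis imageE mem_Collect_eq)
      have "dist (J x) (J y) \<le> e / 2"
      proof (rule dist_bound)
        fix i
        show "dist (J x i) (J y i) \<le> e / 2"
          using N[of i] q(2)[of i] by (auto simp: J x y s_def dist_real_def)
      qed
      then have "J y \<in> Q" using e by auto
      moreover have "U y \<in> ?R" using q(1) y(2) by (auto simp: s_def intro!: exI[of _ N])
      ultimately show "\<exists>y. y \<in> ?D \<and> y \<in> S" using y(1) Q(2) by blast
    qed
    then have "T closure_of ?D = topspace T" using topT closure_of_subset_topspace[of T ?D] by blast
    ultimately show ?thesis unfolding separable_space_def topT by blast
  qed
  ultimately show ?thesis
    unfolding polishable_def using lcV topT by (intro conjI exI[of _ T]) auto
qed

lemma infinite_dimensional_isomorphic_c0: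
  assumes V: "real_vector_space V" and iso: "isomorphic_tvs V c0_space"
  shows "infinite_dimensional V"
proof -
  obtain U where lin: "linear_map_on V c0_space U" and hom: "homeomorphic_map (vtop V) (vtop c0_space) U"
    using iso unfolding isomorphic_tvs_def by blast
  have img: "U ` vcarrier V = {s. s \<longlonglongrightarrow> 0}"
    using homeomorphic_imp_surjective_map[OF hom] by (simp add: vcarrier_c0_space)
  have "\<exists>x\<in>vcarrier V. U x = (\<lambda>n. if n = j then 1 else 0)" for j :: nat
  proof -
    have "(\<lambda>n. if n = j then 1 else 0 :: real) \<longlonglongrightarrow> 0"
      by (rule tendsto_eventually) (use eventually_gt_at_top[of j] in \<open>eventually_elim, auto\<close>)
    then have "(\<lambda>n. if n = j then 1 else 0) \<in> U ` vcarrier V" unfolding img by simp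
    then obtain x where "(\<lambda>n. if n = j then 1 else 0) = U x" "x \<in> vcarrier V" by (rule imageE)
    then show ?thesis by (intro bexI[of _ x]) simp_all
  qed
  then obtain v where v: "\<And>j. v j \<in> vcarrier V" "\<And>j. U (v j) = (\<lambda>n. if n = j then 1 else 0)" by metis
  show ?thesis
  proof (rule infinite_dimensional_dual_sequence[of V "\<lambda>n x. U x n" v])
    show "U (vzero V) n = 0" for n
      using linear_map_vzero[OF V real_vector_space_c0_space lin] by (simp add: c0_simps)
  qed (use lin v in \<open>auto simp: linear_map_on_def c0_simps rvs_zero[OF V] rvs_add[OF V] rvs_scale[OF V]\<close>)
qed

lemma metrizable_c0: "metrizable_space (vtop c0_space)"
  unfolding c0_space_def by (simp add: metrizable_space_subtopology metrizable_space_product_topology metrizable_space_euclidean)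

lemma isomorphic_imp_homeomorphic_space: "isomorphic_tvs V W \<Longrightarrow> vtop V homeomorphic_space vtop W"
  unfolding isomorphic_tvs_def homeomorphic_space_def homeomorphic_map_maps by blast

lemma polishable_imp_separable: "polishable V \<Longrightarrow> separable_space (vtop V)"
proof -
  assume "polishable V"
  then obtain T where T: "topspace T = vcarrier V" "\<And>U. openin (vtop V) U \<Longrightarrow> openin T U" "separable_space T"
    unfolding polishable_def by blast
  have "continuous_map T (vtop V) (\<lambda>x. x)"
    using T(1,2) by (auto simp: continuous_map_def openin_subset Int_def[symmetric] dest: openin_subset)
  then show ?thesis
    by (rule separable_space_continuous_map_image[OF T(3)]) (simp add: T(1))
qed

section \<open>Polishable quotients\<close>

lemma finite_codimension_mono:
  "finite_codimension V Z \<Longrightarrow> Z \<subseteq> Z' \<Longrightarrow> finite_codimension V Z'"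
  unfolding finite_codimension_def by (meson Un_mono order_refl order_trans)

text \<open>A function f outside the closed set Z has a basic neighbourhood missing Z, so already on a finite set F
  no element of Z agrees with f; separation happens among the functions on F.\<close>

lemma closed_subspace_separation:
  assumes Z: "closed_linear_subspace (Cp X) Z" and f: "f \<in> vcarrier (Cp X)" "f \<notin> Z"
  obtains c where "fin_measure X c" "\<And>z. z \<in> Z \<Longrightarrow> pairing c z = 0" "pairing c f \<noteq> 0"
proof -
  have lin: "linear_subspace (Cp X) Z" and clo: "closedin (vtop (Cp X)) Z"
    using Z by (simp_all add: closed_linear_subspace_def)
  have op: "openin (vtop (Cp X)) (vcarrier (Cp X) - Z)" using clo by (simp add: closedin_def)
  obtain F e where F: "finite F" "F \<subseteq> topspace X" "0 < e"
    and e: "\<And>g. g \<in> vcarrier (Cp X) \<Longrightarrow> (\<And>x. x \<in> F \<Longrightarrow> \<bar>g x - f x\<bar> < e) \<Longrightarrow> g \<in> vcarrier (Cp X) - Z"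
    using Cp_neighbourhood[OF op, of f] f by blast
  define N where "N = {g. \<exists>z\<in>Z. \<forall>x\<in>F. g x = z x}"
  have ZN: "z \<in> N" if "z \<in> Z" for z using that by (auto simp: N_def)
  have "\<exists>c. {x. c x \<noteq> 0} \<subseteq> F \<and> (\<forall>g\<in>N. pairing c g = 0) \<and> pairing c f \<noteq> 0"
  proof (rule separating_functional[OF F(1)])
    show "N \<noteq> {}" using ZN lin by (auto simp: linear_subspace_def)
    show "(\<lambda>x. g x - a * h x) \<in> N" if gh: "g \<in> N" "h \<in> N" for g h a
    proof -
      obtain z w where z: "z \<in> Z" "\<forall>x\<in>F. g x = z x" and w: "w \<in> Z" "\<forall>x\<in>F. h x = w x"
        using gh by (auto simp: N_def)
      have "vadd (Cp X) z (vscale (Cp X) (- a) w) \<in> Z" using lin z(1) w(1) by (simp add: linear_subspace_def)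
      moreover have "\<forall>x\<in>F. g x - a * h x = vadd (Cp X) z (vscale (Cp X) (- a) w) x"
        using z(2) w(2) F(2) by (auto simp: Cp_simps)
      ultimately show ?thesis unfolding N_def by blast
    qed
    show "\<not> (\<exists>g\<in>N. \<forall>x\<in>F. g x = f x)"
    proof
      assume "\<exists>g\<in>N. \<forall>x\<in>F. g x = f x"
      then obtain z where z: "z \<in> Z" "\<forall>x\<in>F. z x = f x" by (auto simp: N_def)
      have "z \<in> vcarrier (Cp X)" using lin z(1) by (auto simp: linear_subspace_def)
      from e[OF this] z F(3) show False by simp
    qed
  qed
  then obtain c where c: "{x. c x \<noteq> 0} \<subseteq> F" "\<forall>g\<in>N. pairing c g = 0" "pairing c f \<noteq> 0" by blast
  show thesis
  proof
    show "fin_measure X c" using c(1) F finite_subset unfolding fin_measure_def by blast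
  qed (use c ZN in auto)
qed

text \<open>If Z is closed of infinite codimension, the space M of measures annihilating Z is
  infinite-dimensional: finitely many members of M with no common zeros outside Z would exhibit Z as
  a finite intersection of kernels. Hence for each n some member of norm 1 vanishes on any n prescribed
  functions. These functions play the role of a dense sequence below.\<close>

lemma annihilating_measures:
  fixes es :: "nat \<Rightarrow> 'a \<Rightarrow> real"
  assumes Z: "closed_linear_subspace (Cp X) Z" and inf: "\<not> finite_codimension (Cp X) Z"
  obtains c where "\<And>n. fin_measure X (c n)" "\<And>n. mass (c n) UNIV = 1"
    "\<And>n z. z \<in> Z \<Longrightarrow> pairing (c n) z = 0" "\<And>i n. i < n \<Longrightarrow> pairing (c n) (es i) = 0"
proof -
  define M where "M = {c. fin_measure X c \<and> (\<forall>z\<in>Z. pairing c z = 0)}"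
  have Mfin: "finite {x. c x \<noteq> 0}" if "c \<in> M" for c using that fin_measure_finite by (auto simp: M_def)
  have "\<exists>c\<in>M. (\<forall>i<n. pairing c (es i) = 0) \<and> c \<noteq> (\<lambda>x. 0)" for n
  proof (rule ccontr)
    assume none: "\<not> ?thesis"
    have "\<exists>\<Lambda>\<subseteq>M. finite \<Lambda> \<and> (\<forall>f. (\<forall>c\<in>\<Lambda>. pairing c f = 0) \<longrightarrow> (\<forall>c\<in>M. pairing c f = 0))"
    proof (rule finitely_many_functions_detect[of M "map es [0..<n]"])
      show "(\<lambda>x. c x - a * d x) \<in> M" if "c \<in> M" "d \<in> M" for c d a
      proof -
        have c: "fin_measure X c" "fin_measure X (\<lambda>x. a * d x)"
          using that by (auto simp: M_def intro: fin_measure_scale)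
        show ?thesis
          using fin_measure_diff[OF c] pairing_diff_left[OF c[THEN fin_measure_finite]] that
          by (simp add: M_def pairing_scale_left)
      qed
      show "c = (\<lambda>x. 0)" if "c \<in> M" "\<And>e. e \<in> set (map es [0..<n]) \<Longrightarrow> pairing c e = 0" for c
        using none that by auto
    qed (rule Mfin)
    then obtain \<Lambda> where \<Lambda>: "\<Lambda> \<subseteq> M" "finite \<Lambda>"
      "\<And>f. (\<forall>c\<in>\<Lambda>. pairing c f = 0) \<Longrightarrow> (\<forall>c\<in>M. pairing c f = 0)" by blast
    have fm: "fin_measure X c" if "c \<in> \<Lambda>" for c using that \<Lambda>(1) by (auto simp: M_def)
    have "finite_codimension (Cp X) {f \<in> vcarrier (Cp X). \<forall>\<phi>\<in>pairing ` \<Lambda>. \<phi> f = 0}"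
    proof (rule finite_codimension_common_kernel[OF real_vector_space_Cp finite_imageI[OF \<Lambda>(2)]])
      show "\<phi> (vadd (Cp X) f g) = \<phi> f + \<phi> g" if "\<phi> \<in> pairing ` \<Lambda>" for \<phi> f g
        using that pairing_restrict[OF fm] unfolding Cp_simps by (auto simp: pairing_add simp del: restrict_apply)
      show "\<phi> (vscale (Cp X) a f) = a * \<phi> f" if "\<phi> \<in> pairing ` \<Lambda>" for \<phi> a f
        using that pairing_restrict[OF fm] unfolding Cp_simps by (auto simp: pairing_scale simp del: restrict_apply)
    qed
    moreover have "{f \<in> vcarrier (Cp X). \<forall>\<phi>\<in>pairing ` \<Lambda>. \<phi> f = 0} \<subseteq> Z"
    proof
      fix f assume f: "f \<in> {f \<in> vcarrier (Cp X). \<forall>\<phi>\<in>pairing ` \<Lambda>. \<phi> f = 0}"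
      then have ann: "\<forall>c\<in>M. pairing c f = 0" using \<Lambda>(3) by simp
      show "f \<in> Z"
      proof (rule ccontr)
        assume "f \<notin> Z"
        then obtain c where "fin_measure X c" "\<And>z. z \<in> Z \<Longrightarrow> pairing c z = 0" "pairing c f \<noteq> 0"
          using closed_subspace_separation[OF Z, of f] f by blast
        then show False using ann by (simp add: M_def)
      qed
    qed
    ultimately show False using inf finite_codimension_mono by blast
  qed
  then obtain m where m: "\<And>n. m n \<in> M" "\<And>n i. i < n \<Longrightarrow> pairing (m n) (es i) = 0" "\<And>n. m n \<noteq> (\<lambda>x. 0)"
    by metis
  have mm: "fin_measure X (m n)" "\<And>z. z \<in> Z \<Longrightarrow> pairing (m n) z = 0" for n
    using m(1)[of n] by (simp_all add: M_def)
  have pos: "mass (m n) UNIV > 0" for n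
    using mass_pos_iff[OF fin_measure_finite[OF mm(1)[of n]]] m(3)[of n] by auto
  show thesis
  proof
    show "fin_measure X (\<lambda>x. (1 / mass (m n) UNIV) * m n x)" for n by (rule fin_measure_scale[OF mm(1)])
    show "mass (\<lambda>x. (1 / mass (m n) UNIV) * m n x) UNIV = 1" for n
      unfolding mass_scale using pos[of n] by simp
    show "pairing (\<lambda>x. (1 / mass (m n) UNIV) * m n x) z = 0" if "z \<in> Z" for n z
      unfolding pairing_scale_left mm(2)[OF that] by simp
    show "pairing (\<lambda>x. (1 / mass (m n) UNIV) * m n x) (es i) = 0" if "i < n" for i n
      unfolding pairing_scale_left m(2)[OF that] by simp
  qed
qed

text \<open>Banach-Steinhaus. By Baire's theorem a pointwise bounded sequence of functionals is uniformly bounded on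
  a nonempty open set, so convergence to 0 on a dense set spreads to the whole space.\<close>

lemma tends_to_zero_on_separable_frechet:
  fixes \<mu> :: "nat \<Rightarrow> 'v \<Rightarrow> real"
  assumes V: "frechet_space V"
    and cont: "\<And>n. continuous_map (vtop V) euclideanreal (\<mu> n)"
    and add: "\<And>n x y. x \<in> vcarrier V \<Longrightarrow> y \<in> vcarrier V \<Longrightarrow> \<mu> n (vadd V x y) = \<mu> n x + \<mu> n y"
    and scale: "\<And>n a x. x \<in> vcarrier V \<Longrightarrow> \<mu> n (vscale V a x) = a * \<mu> n x"
    and bdd: "\<And>x. x \<in> vcarrier V \<Longrightarrow> \<exists>K. \<forall>n. \<bar>\<mu> n x\<bar> \<le> K"
    and D: "vtop V closure_of D = vcarrier V" "\<And>x. x \<in> D \<Longrightarrow> (\<lambda>n. \<mu> n x) \<longlonglongrightarrow> 0"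
    and y: "y \<in> vcarrier V"
  shows "(\<lambda>n. \<mu> n y) \<longlonglongrightarrow> 0"
proof -
  obtain d where d: "Metric_space (vcarrier V) d" "vtop V = Metric_space.mtopology (vcarrier V) d"
      "Metric_space.mcomplete (vcarrier V) d" and lc: "locally_convex_space V"
    using V unfolding frechet_space_def by metis
  have tvs: "topological_vector_space V" using lc by (simp add: locally_convex_space_def)
  have rvs: "real_vector_space V" using tvs by (simp add: topological_vector_space_def)
  have cadd: "continuous_map (prod_topology (vtop V) (vtop V)) (vtop V) (\<lambda>(x, y). vadd V x y)"
    and cscale: "continuous_map (prod_topology euclideanreal (vtop V)) (vtop V) (\<lambda>(a, x). vscale V a x)"
    using tvs by (simp_all add: topological_vector_space_def)
  define E where "E k = {x \<in> vcarrier V. \<forall>n. \<mu> n x \<in> {- real k..real k}}" for k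
  have Eclo: "closedin (vtop V) (E k)" for k
  proof -
    have "closedin (vtop V) {x \<in> vcarrier V. \<mu> n x \<in> {- real k..real k}}" for n
      by (rule closedin_continuous_map_preimage[OF cont]) simp
    then have "closedin (vtop V) (\<Inter>n. {x \<in> vcarrier V. \<mu> n x \<in> {- real k..real k}})"
      by (intro closedin_Inter) auto
    moreover have "(\<Inter>n. {x \<in> vcarrier V. \<mu> n x \<in> {- real k..real k}}) = E k" by (auto simp: E_def)
    ultimately show ?thesis by simp
  qed
  have "\<exists>k. vtop V interior_of E k \<noteq> {}"
  proof (rule ccontr)
    assume "\<not> ?thesis"
    then have int: "vtop V interior_of E k = {}" for k by blast
    have "vtop V interior_of \<Union>(range E) = {}"
    proof (rule Metric_space.metric_Baire_category_alt[OF d(1,3), folded d(2)])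
      show "closedin (vtop V) T \<and> vtop V interior_of T = {}" if "T \<in> range E" for T
        using that Eclo int by blast
    qed simp
    moreover have "\<Union>(range E) = vcarrier V"
    proof (intro equalityI subsetI)
      fix x assume x: "x \<in> vcarrier V"
      then obtain K where K: "\<And>n. \<bar>\<mu> n x\<bar> \<le> K" using bdd by blast
      obtain k where "K \<le> real k" using real_arch_simple by blast
      then have "\<bar>\<mu> n x\<bar> \<le> real k" for n using K[of n] by linarith
      then have "x \<in> E k" using x by (auto simp: E_def abs_le_iff minus_le_iff)
      then show "x \<in> \<Union>(range E)" by blast
    qed (auto simp: E_def)
    ultimately show False using y by simp
  qed
  then obtain k u where u: "u \<in> vtop V interior_of E k" by blast
  define K where "K = max 1 (real k)"
  have uV: "u \<in> vcarrier V" using u interior_of_subset_topspace[of "vtop V" "E k"] by blast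
  have E: "\<bar>\<mu> n x\<bar> \<le> K" if "x \<in> vtop V interior_of E k" for n x
  proof -
    have "x \<in> E k" using that interior_of_subset[of "vtop V" "E k"] by blast
    then have "\<mu> n x \<in> {- real k..real k}" unfolding E_def by blast
    then show ?thesis by (auto simp: K_def)
  qed
  show ?thesis
  proof (rule LIMSEQ_I)
    fix e :: real assume e: "0 < e"
    \<comment> \<open>Blowing up by t moves points close to y into the open set near u, where all functionals are bounded by K.\<close>
    define t where "t = 4 * K / e"
    have t: "t > 0" using e by (simp add: t_def K_def)
    define g where "g x = vadd V u (vscale V t (vadd V x (vscale V (- 1) y)))" for x
    have y1: "vscale V (- 1) y \<in> vcarrier V" by (rule rvs_scale[OF rvs y])
    have "continuous_map (vtop V) (vtop V) (\<lambda>x. (\<lambda>(x, y). vadd V x y) (x, vscale V (- 1) y))"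
      using continuous_map_compose[OF _ cadd, of "vtop V" "\<lambda>x. (x, vscale V (- 1) y)"] y1
      by (simp add: o_def continuous_map_paired)
    then have "continuous_map (vtop V) (vtop V) (\<lambda>x. (\<lambda>(a, x). vscale V a x) (t, vadd V x (vscale V (- 1) y)))"
      using continuous_map_compose[OF _ cscale, of "vtop V" "\<lambda>x. (t, vadd V x (vscale V (- 1) y))"]
      by (simp add: o_def continuous_map_paired)
    then have gc: "continuous_map (vtop V) (vtop V) g"
      using continuous_map_compose[OF _ cadd, of "vtop V" "\<lambda>x. (u, vscale V t (vadd V x (vscale V (- 1) y)))"] uV
      by (simp add: o_def continuous_map_paired g_def[abs_def])
    have "g y = u"
      unfolding g_def vadd_uminus[OF rvs y] using vscale_0[OF rvs rvs_zero[OF rvs]]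
        rvs_scale_scale[OF rvs rvs_zero[OF rvs], of t 0] rvs_zero_right[OF rvs uV] by simp
    have op: "openin (vtop V) {x \<in> vcarrier V. g x \<in> vtop V interior_of E k}"
      by (rule openin_continuous_map_preimage[OF gc openin_interior_of])
    have yin: "y \<in> {x \<in> vcarrier V. g x \<in> vtop V interior_of E k}" using y u \<open>g y = u\<close> by simp
    have dense: "\<exists>x. x \<in> D \<and> x \<in> Q" if "y \<in> Q" "openin (vtop V) Q" for Q
    proof -
      have "y \<in> vtop V closure_of D" using y D(1) by simp
      then show ?thesis using that by (simp add: in_closure_of)
    qed
    obtain x where x: "x \<in> D" "x \<in> vcarrier V" "g x \<in> vtop V interior_of E k"
      using dense[OF yin op] by blast
    have close: "\<bar>\<mu> n x - \<mu> n y\<bar> \<le> e / 2" for n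
    proof -
      have "\<mu> n (g x) = \<mu> n u + t * (\<mu> n x - \<mu> n y)"
        unfolding g_def using add scale rvs_scale[OF rvs] rvs_add[OF rvs] y1 uV x(2) y by simp
      then have "t * (\<mu> n x - \<mu> n y) = \<mu> n (g x) - \<mu> n u" by simp
      then have "t * \<bar>\<mu> n x - \<mu> n y\<bar> = \<bar>\<mu> n (g x) - \<mu> n u\<bar>" using t by (metis abs_mult abs_of_pos)
      also have "\<dots> \<le> 2 * K" using E[OF x(3), of n] E[OF u, of n] by linarith
      finally have "\<bar>\<mu> n x - \<mu> n y\<bar> \<le> 2 * K / t" using t by (simp add: pos_le_divide_eq mult.commute)
      moreover have "K > 0" by (simp add: K_def)
      then have "2 * K / t = e / 2" using e by (simp add: t_def)
      ultimately show ?thesis by simp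
    qed
    obtain N where N: "\<And>n. n \<ge> N \<Longrightarrow> \<bar>\<mu> n x\<bar> < e / 2"
      using LIMSEQ_D[OF D(2)[OF x(1)], of "e / 2"] e by auto
    have "\<bar>\<mu> n y\<bar> < e" if "n \<ge> N" for n using N[OF that] close[of n] by linarith
    then show "\<exists>N. \<forall>n\<ge>N. norm (\<mu> n y - 0) < e" by (intro exI[of _ N]) simp
  qed
qed

lemma pseudocompact_bounded:
  assumes "pseudocompact_space X" "continuous_map X euclideanreal f"
  obtains K where "\<And>x. x \<in> topspace X \<Longrightarrow> \<bar>f x\<bar> \<le> K"
proof -
  have "bounded (f ` topspace X)" using assms by (simp add: pseudocompact_space_def)
  then obtain K where "\<forall>y\<in>f ` topspace X. norm y \<le> K" unfolding bounded_iff by blast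
  then show thesis by (intro that[of K]) simp
qed

text \<open>The measures annihilating Z act on the quotient, continuously for the quotient topology and hence for the
  finer Frechet topology. On a pseudocompact space norm-one measures are pointwise bounded, so it is
  enough that they tend to 0 on a sequence dense in the Frechet topology.\<close>

lemma polishable_quotient_imp_JNP:
  assumes pc: "pseudocompact_space X" and Z: "closed_linear_subspace (Cp X) Z"
    and inf: "infinite_dimensional (quotient_tvs (Cp X) Z)" and pol: "polishable (quotient_tvs (Cp X) Z)"
  shows "JNP X"
proof -
  let ?Y = "quotient_tvs (Cp X) Z" and ?V = "Cp X" and ?q = "vcoset (Cp X) Z"
  have lin: "linear_subspace ?V Z" using Z by (simp add: closed_linear_subspace_def)
  note rvs = real_vector_space_Cp[of X]
  note rvsY = real_vector_space_quotient_tvs[OF rvs lin]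
  have carY: "vcarrier ?Y = ?q ` vcarrier ?V" by (rule vcarrier_quotient_tvs)
  have qlin: "linear_map_on ?V ?Y ?q"
    unfolding linear_map_on_def carY by (auto simp: vadd_quotient_tvs[OF rvs lin] vscale_quotient_tvs[OF rvs lin])
  have "\<not> finite_codimension ?V Z"
  proof
    assume fc: "finite_codimension ?V Z"
    have "Z \<subseteq> {x \<in> vcarrier ?V. ?q x = vzero ?Y}"
    proof
      fix z assume z: "z \<in> Z"
      then have zV: "z \<in> vcarrier ?V" using lin by (auto simp: linear_subspace_def)
      have "?q (vadd ?V (vzero ?V) z) = ?q (vzero ?V)"
        by (rule vcoset_add_element[OF rvs lin rvs_zero[OF rvs] z])
      then show "z \<in> {x \<in> vcarrier ?V. ?q x = vzero ?Y}"
        using zV rvs_zero_left[OF rvs zV] vzero_quotient_tvs[OF rvs lin] by simp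
    qed
    from not_infinite_dimensional_image[OF qlin carY[symmetric] rvs linear_subspace_vcarrier[OF rvsY] _ this fc]
    show False using inf linear_map_vzero[OF rvs rvsY qlin] by blast
  qed
  obtain T where T: "topspace T = vcarrier ?Y" "\<And>U. openin (vtop ?Y) U \<Longrightarrow> openin T U"
      "separable_space T" "frechet_space (?Y\<lparr>vtop := T\<rparr>)"
    using pol unfolding polishable_def by metis
  obtain D where D: "countable D" "D \<subseteq> vcarrier ?Y" "T closure_of D = vcarrier ?Y"
    using T(1,3) unfolding separable_space_def by metis
  have "D \<noteq> {}"
  proof
    assume "D = {}"
    then have "vcarrier ?Y = {}" using D(3) by simp
    then show False using rvs_zero[OF rvsY] by blast
  qed
  define rep where "rep A = (SOME f. f \<in> vcarrier ?V \<and> A = ?q f)" for A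
  have rep: "rep A \<in> vcarrier ?V" "A = ?q (rep A)" if "A \<in> vcarrier ?Y" for A
    using someI_ex[of "\<lambda>f. f \<in> vcarrier ?V \<and> A = ?q f"] that unfolding carY rep_def by auto
  obtain c where c: "\<And>n. fin_measure X (c n)" "\<And>n. mass (c n) UNIV = 1"
    and ann: "\<And>n z. z \<in> Z \<Longrightarrow> pairing (c n) z = 0"
    and kill: "\<And>i n. i < n \<Longrightarrow> pairing (c n) (rep (from_nat_into D i)) = 0"
    using annihilating_measures[OF Z \<open>\<not> finite_codimension ?V Z\<close>, of "\<lambda>i. rep (from_nat_into D i)"] by metis
  have padd: "pairing (c n) (vadd ?V f g) = pairing (c n) f + pairing (c n) g" for n f g
    unfolding Cp_simps by (simp only: pairing_restrict[OF c(1)] pairing_add)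
  have pscale: "pairing (c n) (vscale ?V a f) = a * pairing (c n) f" for n a f
    unfolding Cp_simps by (simp only: pairing_restrict[OF c(1)] pairing_scale)
  define \<mu> where "\<mu> n A = pairing (c n) (rep A)" for n A
  have \<mu>: "\<mu> n (?q f) = pairing (c n) f" if f: "f \<in> vcarrier ?V" for n f
  proof -
    have A: "?q f \<in> vcarrier ?Y" using f carY by blast
    have "vadd ?V f (vzero ?V) \<in> ?q f" using lin by (auto simp: vcoset_def linear_subspace_def)
    then have "f \<in> ?q (rep (?q f))" using rvs_zero_right[OF rvs f] rep(2)[OF A] by simp
    then obtain z where "z \<in> Z" "f = vadd ?V (rep (?q f)) z" by (auto simp: vcoset_def)
    then have "pairing (c n) f = pairing (c n) (rep (?q f)) + 0" using padd ann by metis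
    then show ?thesis by (simp add: \<mu>_def)
  qed
  have TY: "continuous_map T (vtop ?Y) (\<lambda>A. A)"
    unfolding continuous_map_def
  proof (intro conjI allI impI)
    fix U assume U: "openin (vtop ?Y) U"
    have "{A \<in> topspace T. A \<in> U} = U" using openin_subset[OF U] T(1) by blast
    then show "openin T {A \<in> topspace T. A \<in> U}" using T(2)[OF U] by simp
  qed (simp add: T(1))
  have cont: "continuous_map T euclideanreal (\<mu> n)" for n
  proof -
    have "continuous_map (vtop ?V) euclideanreal (\<mu> n \<circ> ?q)"
      by (rule continuous_map_eq[OF continuous_map_pairing[OF c(1)]]) (simp add: \<mu>)
    then have "continuous_map (vtop ?Y) euclideanreal (\<mu> n)"
      by (rule continuous_compose_quotient_map[OF quotient_map_vcoset])
    from continuous_map_compose[OF TY this] show ?thesis by (simp add: o_def)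
  qed
  have lim: "(\<lambda>n. \<mu> n A) \<longlonglongrightarrow> 0" if A: "A \<in> vcarrier ?Y" for A
  proof (rule tends_to_zero_on_separable_frechet[OF T(4)])
    show "continuous_map (vtop (?Y\<lparr>vtop := T\<rparr>)) euclideanreal (\<mu> n)" for n using cont by simp
    show "\<mu> n (vadd (?Y\<lparr>vtop := T\<rparr>) x y) = \<mu> n x + \<mu> n y"
      if xy: "x \<in> vcarrier (?Y\<lparr>vtop := T\<rparr>)" "y \<in> vcarrier (?Y\<lparr>vtop := T\<rparr>)" for n x y
    proof -
      obtain f g where "f \<in> vcarrier ?V" "x = ?q f" "g \<in> vcarrier ?V" "y = ?q g"
        using xy T(1) carY by auto
      then show ?thesis by (simp add: vadd_quotient_tvs[OF rvs lin] \<mu> rvs_add[OF rvs] padd)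
    qed
    show "\<mu> n (vscale (?Y\<lparr>vtop := T\<rparr>) a x) = a * \<mu> n x" if x: "x \<in> vcarrier (?Y\<lparr>vtop := T\<rparr>)" for n a x
    proof -
      obtain f where "f \<in> vcarrier ?V" "x = ?q f" using x T(1) carY by auto
      then show ?thesis by (simp add: vscale_quotient_tvs[OF rvs lin] \<mu> rvs_scale[OF rvs] pscale)
    qed
    show "\<exists>K. \<forall>n. \<bar>\<mu> n x\<bar> \<le> K" if x: "x \<in> vcarrier (?Y\<lparr>vtop := T\<rparr>)" for x
    proof -
      obtain f where f: "f \<in> vcarrier ?V" "x = ?q f" using x T(1) carY by auto
      obtain K where K: "\<And>x. x \<in> topspace X \<Longrightarrow> \<bar>f x\<bar> \<le> K"
        using pseudocompact_bounded[OF pc Cp_continuous[OF f(1)]] by blast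
      have "\<bar>pairing (c n) f\<bar> \<le> max 0 K * mass (c n) UNIV" for n
        by (rule abs_pairing_le_norm[OF fin_measure_finite[OF c(1)]])
           (use K c(1) in \<open>auto simp: fin_measure_def le_max_iff_disj\<close>)
      then show ?thesis using c(2) f by (auto simp: \<mu>)
    qed
    show "vtop (?Y\<lparr>vtop := T\<rparr>) closure_of D = vcarrier (?Y\<lparr>vtop := T\<rparr>)" using D(3) T(1) by simp
    show "A \<in> vcarrier (?Y\<lparr>vtop := T\<rparr>)" using A T(1) by simp
    show "(\<lambda>n. \<mu> n B) \<longlonglongrightarrow> 0" if B: "B \<in> D" for B
    proof -
      obtain i where i: "B = from_nat_into D i" using from_nat_into_surj[OF D(1) B] by metis
      have z: "\<mu> n B = 0" if "n > i" for n using kill[OF that] i by (simp add: \<mu>_def)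
      have "\<forall>\<^sub>F n in sequentially. \<mu> n B = 0"
        by (rule eventually_mono[OF eventually_gt_at_top[of i]]) (rule z)
      then show ?thesis by (rule tendsto_eventually)
    qed
  qed
  have "weakly_null X c" unfolding weakly_null_def
  proof (intro allI impI)
    fix f assume "continuous_map X euclideanreal f"
    then have f: "restrict f (topspace X) \<in> vcarrier ?V" by (rule restrict_in_Cp)
    then have "?q (restrict f (topspace X)) \<in> vcarrier ?Y" using carY by blast
    from lim[OF this] show "(\<lambda>n. pairing (c n) f) \<longlonglongrightarrow> 0"
      unfolding \<mu>[OF f] pairing_restrict[OF c(1)] .
  qed
  then show ?thesis unfolding JNP_iff using c by blast
qed

section \<open>Separable and metrizable complements\<close>

text \<open>Countably many continuous functions on a pseudocompact space attain simultaneously any limit along a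
  sequence of points. If they did not, the weighted sum h of the distances to the limits would be
  positive with infimum 0, and 1/h would be continuous and unbounded.\<close>

lemma pseudocompact_limit_attained:
  fixes g :: "nat \<Rightarrow> 'a \<Rightarrow> real"
  assumes pc: "pseudocompact_space X" and g: "\<And>i. continuous_map X euclideanreal (g i)"
    and x: "\<And>n. x n \<in> topspace X" and lim: "\<And>i. (\<lambda>n. g i (x n)) \<longlonglongrightarrow> a i"
  obtains p where "p \<in> topspace X" "\<And>i. g i p = a i"
proof -
  define t where "t i y = (1/2)^i * min 1 \<bar>g i y - a i\<bar>" for i y
  \<comment> \<open>A summable weighting of the distances, zero exactly where all the limits are attained.\<close>
  define h where "h y = suminf (\<lambda>i. t i y)" for y
  have half: "summable (\<lambda>i. (1/2::real)^i)" by (rule summable_geometric) simp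
  have t0: "0 \<le> t i y" for i y by (simp add: t_def)
  have t1: "norm (t i y) \<le> (1/2)^i" for i y
    using t0[of i y] mult_left_mono[of "min 1 \<bar>g i y - a i\<bar>" 1 "(1/2)^i"] by (simp add: t_def)
  have tsum: "summable (\<lambda>i. t i y)" for y by (rule summable_comparison_test'[OF half]) (rule t1)
  have "uniform_limit (topspace X) (\<lambda>n y. \<Sum>i<n. t i y) h sequentially"
    unfolding h_def by (rule Weierstrass_m_test[OF t1 half])
  then have unif: "\<forall>\<^sub>F n in sequentially. \<forall>y\<in>topspace X. dist (\<Sum>i<n. t i y) (h y) < e" if "e > 0" for e
    using that by (rule uniform_limitD)
  have tc: "continuous_map X euclideanreal (t i)" for i
    unfolding t_def
    by (intro continuous_map_real_mult_left continuous_map_real_min continuous_map_real_abs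
        continuous_map_diff g) auto
  have hc: "continuous_map X euclideanreal h"
  proof -
    have "continuous_map X Met_TC.mtopology h"
    proof (rule Met_TC.continuous_map_uniform_limit[where F=sequentially and f="\<lambda>n y. \<Sum>i<n. t i y"])
      show "\<forall>\<^sub>F n in sequentially. continuous_map X Met_TC.mtopology (\<lambda>y. \<Sum>i<n. t i y)"
        unfolding mtopology_is_euclidean by (intro always_eventually allI continuous_map_sum tc) auto
      show "\<forall>\<^sub>F n in sequentially. \<forall>y\<in>topspace X. h y \<in> UNIV \<and> dist (\<Sum>i<n. t i y) (h y) < e" if "e > 0" for e
        using unif[OF that] by simp
    qed simp
    then show ?thesis by simp
  qed
  have "((\<lambda>n. suminf (\<lambda>i. t i (x n))) \<longlongrightarrow> suminf (\<lambda>i. 0)) sequentially"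
  proof (rule tannerys_theorem[where a="\<lambda>i n. t i (x n)" and b="\<lambda>_. 0" and F=sequentially and
        M="\<lambda>i. (1/2)^i", THEN conjunct2, THEN conjunct2])
    show "(\<lambda>n. t i (x n)) \<longlonglongrightarrow> 0" for i
    proof (rule Lim_null_comparison)
      have "norm (t i (x n)) \<le> (1/2)^i * \<bar>g i (x n) - a i\<bar>" for n
        using t0[of i "x n"] mult_left_mono[of "min 1 \<bar>g i (x n) - a i\<bar>" "\<bar>g i (x n) - a i\<bar>" "(1/2)^i"]
        by (simp add: t_def)
      then show "\<forall>\<^sub>F n in sequentially. norm (t i (x n)) \<le> (1/2)^i * \<bar>g i (x n) - a i\<bar>"
        by (rule always_eventually[OF allI])
      show "(\<lambda>n. (1/2)^i * \<bar>g i (x n) - a i\<bar>) \<longlonglongrightarrow> 0"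
        by (intro tendsto_mult_right_zero tendsto_rabs_zero) (use LIM_zero[OF lim] in simp)
    qed
    show "\<forall>\<^sub>F (i, n) in sequentially \<times>\<^sub>F sequentially. norm (t i (x n)) \<le> (1/2)^i"
      using t1 by (intro always_eventually) (simp add: split_def)
  qed (use half in simp_all)
  then have hlim: "(\<lambda>n. h (x n)) \<longlonglongrightarrow> 0" by (simp add: h_def)
  have "\<exists>p\<in>topspace X. h p = 0"
  proof (rule ccontr)
    assume "\<not> ?thesis"
    then have nz: "h y \<noteq> 0" if "y \<in> topspace X" for y using that by blast
    have hpos: "0 < h y" if "y \<in> topspace X" for y
      using nz[OF that] suminf_nonneg[OF tsum t0, of y] by (simp add: h_def)
    have "continuous_map X euclideanreal (\<lambda>y. 1 / h y)"
      by (rule continuous_map_real_divide[OF _ hc]) (use nz in auto)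
    then obtain K where K: "\<And>y. y \<in> topspace X \<Longrightarrow> \<bar>1 / h y\<bar> \<le> K"
      by (rule pseudocompact_bounded[OF pc]) blast
    have K1: "1 / (\<bar>K\<bar> + 1) > 0" by simp
    have "\<forall>\<^sub>F n in sequentially. h (x n) < 1 / (\<bar>K\<bar> + 1)" by (rule order_tendstoD(2)[OF hlim K1])
    then obtain n where n: "h (x n) < 1 / (\<bar>K\<bar> + 1)"
      using eventually_happens trivial_limit_sequentially by blast
    have "h (x n) > 0" using hpos x by blast
    then have "\<bar>K\<bar> + 1 < 1 / h (x n)" using n by (simp add: field_simps)
    moreover have "1 / h (x n) \<le> K" by (rule abs_le_D1[OF K[OF x[of n]]])
    ultimately show False by simp
  qed
  then obtain p where p: "p \<in> topspace X" "h p = 0" by blast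
  have "t i p = 0" for i using suminf_eq_zero_iff[OF tsum t0, of p] p(2) by (simp add: h_def)
  then have "g i p = a i" for i
  proof -
    have "min 1 \<bar>g i p - a i\<bar> = 0" using \<open>t i p = 0\<close> by (simp add: t_def)
    then show ?thesis by (simp add: min_def split: if_splits)
  qed
  with p(1) show thesis by (rule that)
qed

text \<open>A function in the pointwise closure of the d_i is uniformly determined by finitely many of them. Two
  sequences of points that violate this have limits attained at points p and q, by the preceding lemma;
  all d_i agree at p and q, but f does not, so f is not in the pointwise closure.\<close>

lemma pointwise_closure_uniformly_determined:
  fixes d :: "nat \<Rightarrow> 'a \<Rightarrow> real"
  assumes pc: "pseudocompact_space X" and d: "\<And>i. continuous_map X euclideanreal (d i)"
    and f: "continuous_map X euclideanreal f"
    and approx: "\<And>p q e. p \<in> topspace X \<Longrightarrow> q \<in> topspace X \<Longrightarrow> e > 0 \<Longrightarrow>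
        \<exists>i. \<bar>d i p - f p\<bar> < e \<and> \<bar>d i q - f q\<bar> < e"
    and e: "e > 0"
  shows "\<exists>m. \<forall>p\<in>topspace X. \<forall>q\<in>topspace X. (\<forall>i<m. \<bar>d i p - d i q\<bar> < 1 / real (Suc m)) \<longrightarrow> \<bar>f p - f q\<bar> < e"
proof (rule ccontr)
  assume "\<not> ?thesis"
  then have "\<exists>p q. p \<in> topspace X \<and> q \<in> topspace X \<and> (\<forall>i<m. \<bar>d i p - d i q\<bar> < 1 / real (Suc m)) \<and> \<not> \<bar>f p - f q\<bar> < e" for m
    by blast
  then obtain x y where x: "\<And>m. x m \<in> topspace X" and y: "\<And>m. y m \<in> topspace X"
    and close: "\<And>m i. i < m \<Longrightarrow> \<bar>d i (x m) - d i (y m)\<bar> < 1 / real (Suc m)"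
    and far: "\<And>m. \<not> \<bar>f (x m) - f (y m)\<bar> < e" by metis
  \<comment> \<open>The values of f at both points and of all d k at the first one, packed into one double sequence for a single extraction.\<close>
  define a where "a m i = (case i of 0 \<Rightarrow> f (x m) | Suc j \<Rightarrow> (case j of 0 \<Rightarrow> f (y m) | Suc k \<Rightarrow> d k (x m)))" for m i
  have "\<exists>B. \<forall>m. \<bar>a m i\<bar> \<le> B" for i
  proof -
    have bd: "\<exists>B. \<forall>p\<in>topspace X. \<bar>h p\<bar> \<le> B" if "continuous_map X euclideanreal h" for h
      using pseudocompact_bounded[OF pc that] by metis
    show ?thesis
    proof (cases i)
      case 0
      then show ?thesis using bd[OF f] x by (auto simp: a_def)
    next
      case (Suc j)
      show ?thesis
      proof (cases j)
        case 0
        then show ?thesis using Suc bd[OF f] y by (auto simp: a_def)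
      next
        case (Suc k)
        then show ?thesis using \<open>i = Suc j\<close> bd[OF d[of k]] x by (auto simp: a_def)
      qed
    qed
  qed
  then obtain B where B: "\<And>m i. \<bar>a m i\<bar> \<le> B i" by metis
  obtain r :: "nat \<Rightarrow> nat" and l where r: "strict_mono r" "\<And>i. (\<lambda>n. a (r n) i) \<longlonglongrightarrow> l i"
    using pointwise_convergent_subsequence[of a B, OF B] by metis
  have fx: "(\<lambda>n. f (x (r n))) \<longlonglongrightarrow> l 0" using r(2)[of 0] by (simp add: a_def)
  have fy: "(\<lambda>n. f (y (r n))) \<longlonglongrightarrow> l 1" using r(2)[of 1] by (simp add: a_def)
  have dx: "(\<lambda>n. d k (x (r n))) \<longlonglongrightarrow> l (Suc (Suc k))" for k using r(2)[of "Suc (Suc k)"] by (simp add: a_def)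
  have dy: "(\<lambda>n. d k (y (r n))) \<longlonglongrightarrow> l (Suc (Suc k))" for k
  proof -
    have "(\<lambda>m. d k (x m) - d k (y m)) \<longlonglongrightarrow> 0"
    proof (rule Lim_null_comparison)
      show "\<forall>\<^sub>F m in sequentially. norm (d k (x m) - d k (y m)) \<le> 1 / real (Suc m)"
        using eventually_gt_at_top[of k] by eventually_elim (use close less_imp_le in fastforce)
      show "(\<lambda>m. 1 / real (Suc m)) \<longlonglongrightarrow> 0" using LIMSEQ_inverse_real_of_nat by (simp add: inverse_eq_divide)
    qed
    from LIMSEQ_subseq_LIMSEQ[OF this r(1)] have "(\<lambda>n. d k (x (r n)) - d k (y (r n))) \<longlonglongrightarrow> 0" by (simp add: o_def)
    from tendsto_diff[OF dx[of k] this] show ?thesis by simp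
  qed
  define g where "g i = (case i of 0 \<Rightarrow> f | Suc k \<Rightarrow> d k)" for i
  have gc: "continuous_map X euclideanreal (g i)" for i using f d by (simp add: g_def split: nat.split)
  define lp lq where "lp i = (case i of 0 \<Rightarrow> l 0 | Suc k \<Rightarrow> l (Suc (Suc k)))"
    and "lq i = (case i of 0 \<Rightarrow> l 1 | Suc k \<Rightarrow> l (Suc (Suc k)))" for i
  have limp: "(\<lambda>n. g i (x (r n))) \<longlonglongrightarrow> lp i" for i
    using fx dx by (simp add: g_def lp_def split: nat.split)
  have limq: "(\<lambda>n. g i (y (r n))) \<longlonglongrightarrow> lq i" for i
    using fy dy by (simp add: g_def lq_def split: nat.split)
  obtain p where p: "p \<in> topspace X" "\<And>i. g i p = lp i"
    using pseudocompact_limit_attained[of X g "\<lambda>n. x (r n)" lp, OF pc gc x limp] by metis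
  obtain q where q: "q \<in> topspace X" "\<And>i. g i q = lq i"
    using pseudocompact_limit_attained[of X g "\<lambda>n. y (r n)" lq, OF pc gc y limq] by metis
  have fp: "f p = l 0" "f q = l 1" and dpq: "d k p = d k q" for k
    using p(2)[of 0] q(2)[of 0] p(2)[of "Suc k"] q(2)[of "Suc k"] by (simp_all add: g_def lp_def lq_def)
  have "(\<lambda>n. \<bar>f (x (r n)) - f (y (r n))\<bar>) \<longlonglongrightarrow> \<bar>l 0 - l 1\<bar>" by (intro tendsto_rabs tendsto_diff fx fy)
  then have "e \<le> \<bar>l 0 - l 1\<bar>"
    by (rule tendsto_lowerbound) (use far in \<open>auto simp: not_less\<close>)
  moreover obtain i where "\<bar>d i p - f p\<bar> < e / 2" "\<bar>d i q - f q\<bar> < e / 2"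
    using approx[OF p(1) q(1), of "e / 2"] e by auto
  ultimately show False using dpq[of i] fp by linarith
qed

text \<open>Let d be dense in L for the pointwise topology and Z the kernel of the projection. Density in the
  sup norm would be needed in order to conclude directly from measures that vanish on more and more of
  the d_i. Instead they are made to vanish on the indicator functions of the cells on which the integer
  parts of k d_0, ..., k d_{m-1} are constant, a countable family. By the preceding lemma every f in L
  varies little on the cells of some (k, m); finitely many cells cover X because the d_i are bounded, so
  f is uniformly close to a combination of indicators. Outside L nothing is lost, since f and P f differ
  by an element of Z.\<close>

lemma separable_complement_imp_JNP:
  assumes pc: "pseudocompact_space X" and L: "complemented_subspace (Cp X) L"
    and inf: "infinite_dimensional (sub_tvs (Cp X) L)" and sep: "separable_space (vtop (sub_tvs (Cp X) L))"
  shows "JNP X"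
proof -
  let ?V = "Cp X" and ?W = "sub_tvs (Cp X) L"
  note rvs = real_vector_space_Cp[of X]
  obtain P where lin: "linear_subspace ?V L" and P: "linear_map_on ?V ?V P" "continuous_map (vtop ?V) (vtop ?V) P"
      "\<And>x. x \<in> vcarrier ?V \<Longrightarrow> P (P x) = P x" "P ` vcarrier ?V = L"
    using L unfolding complemented_subspace_def by metis
  have PV: "P f \<in> vcarrier ?V" if "f \<in> vcarrier ?V" for f using P(1) that by (auto simp: linear_map_on_def)
  note carW = vcarrier_sub_tvs[OF lin]
  note rvsW = real_vector_space_sub_tvs[OF rvs lin]
  have LV: "f \<in> vcarrier ?V" if "f \<in> L" for f using lin that by (auto simp: linear_subspace_def)
  have Plin: "linear_map_on ?V ?W P"
    using P(1,4) unfolding linear_map_on_def carW by (simp add: sub_tvs_def)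
  define Z where "Z = {f \<in> vcarrier ?V. P f = vzero ?V}"
  have t1: "closedin (vtop ?V) {vzero ?V}"
  proof -
    have "Hausdorff_space (vtop ?V)"
      unfolding Cp_def tvs.simps
      by (intro Hausdorff_space_subtopology) (simp add: Hausdorff_space_product_topology)
    then show ?thesis by (rule closedin_Hausdorff_singleton[OF _ rvs_zero[OF rvs]])
  qed
  have Z: "closed_linear_subspace ?V Z"
  proof -
    have "linear_subspace ?V Z"
      unfolding linear_subspace_def
    proof (intro conjI ballI allI)
      show "Z \<subseteq> vcarrier ?V" by (auto simp: Z_def)
      show "vzero ?V \<in> Z" using rvs_zero[OF rvs] linear_map_vzero[OF rvs rvs P(1)] by (simp add: Z_def)
      show "vadd ?V f g \<in> Z" if "f \<in> Z" "g \<in> Z" for f g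
        using that P(1) rvs_zero_left[OF rvs rvs_zero[OF rvs]] rvs_add[OF rvs]
        unfolding Z_def linear_map_on_def by simp
      show "vscale ?V a f \<in> Z" if "f \<in> Z" for a f
      proof -
        have "vscale ?V a (vzero ?V) = vzero ?V"
          using vscale_0[OF rvs rvs_zero[OF rvs]] rvs_scale_scale[OF rvs rvs_zero[OF rvs], of a 0] by simp
        then show ?thesis using that P(1) rvs_scale[OF rvs] unfolding Z_def linear_map_on_def by simp
      qed
    qed
    then show ?thesis
      using closedin_continuous_map_preimage[OF P(2) t1] by (simp add: closed_linear_subspace_def Z_def)
  qed
  have notfc: "\<not> finite_codimension ?V Z"
  proof
    assume fc: "finite_codimension ?V Z"
    have "P ` vcarrier ?V = vcarrier ?W" using P(4) carW by simp
    moreover have "Z \<subseteq> {f \<in> vcarrier ?V. P f = vzero ?W}" by (auto simp: Z_def sub_tvs_def)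
    ultimately have "\<not> infinite_dimensional ?W"
      using not_infinite_dimensional_image[OF Plin _ rvs linear_subspace_vcarrier[OF rvsW]
          linear_map_vzero[OF rvs rvsW Plin] _ fc] by blast
    then show False using inf by blast
  qed
  obtain D where D: "countable D" "D \<subseteq> L" "vtop ?W closure_of D = L"
    using sep unfolding separable_space_def carW by metis
  have "D \<noteq> {}"
  proof
    assume "D = {}"
    then show False using D(3) lin by (simp add: linear_subspace_def)
  qed
  define d where "d i = from_nat_into D i" for i
  have dD: "d i \<in> D" for i unfolding d_def by (rule from_nat_into[OF \<open>D \<noteq> {}\<close>])
  have dc: "continuous_map X euclideanreal (d i)" for i
    using dD[of i] D(2) LV Cp_continuous by blast
  define cell where "cell k m p = map (\<lambda>i. \<lfloor>real k * d i p\<rfloor>) [0..<m]" for k m :: nat and p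
  \<comment> \<open>The index (k, m, rs) ranges over a countable type, and so it can be enumerated by natural numbers.\<close>
  define ind where "ind = (\<lambda>(k, m, rs) p. if cell k m p = rs then 1 else 0 :: real)"
  obtain c where c: "\<And>n. fin_measure X (c n)" "\<And>n. mass (c n) UNIV = 1"
    and ann: "\<And>n z. z \<in> Z \<Longrightarrow> pairing (c n) z = 0"
    and kill: "\<And>i n. i < n \<Longrightarrow> pairing (c n) (ind (from_nat i)) = 0"
    using annihilating_measures[OF Z notfc, of "\<lambda>i. ind (from_nat i)"] by metis
  have onL: "(\<lambda>n. pairing (c n) f) \<longlonglongrightarrow> 0" if fL: "f \<in> L" for f
  proof (rule LIMSEQ_I)
    fix e :: real assume e: "0 < e"
    have fc: "continuous_map X euclideanreal f" using Cp_continuous[OF LV[OF fL]] .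
    have dense: "\<exists>i. \<bar>d i p - f p\<bar> < u \<and> \<bar>d i q - f q\<bar> < u"
      if pq: "p \<in> topspace X" "q \<in> topspace X" and u: "u > 0" for p q u
    proof -
      have ev: "continuous_map (vtop ?W) euclideanreal (\<lambda>h. h p)" if "p \<in> topspace X" for p
        using continuous_map_Cp_eval[OF that] by (simp add: sub_tvs_def continuous_map_from_subtopology)
      have "openin (vtop ?W) {h \<in> vcarrier ?W. h p \<in> ball (f p) u}"
        "openin (vtop ?W) {h \<in> vcarrier ?W. h q \<in> ball (f q) u}"
        by (rule openin_continuous_map_preimage[OF ev]; use pq in simp)+
      then have op: "openin (vtop ?W) ({h \<in> vcarrier ?W. h p \<in> ball (f p) u} \<inter> {h \<in> vcarrier ?W. h q \<in> ball (f q) u})"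
        by (rule openin_Int)
      have "f \<in> vtop ?W closure_of D" using D(3) fL by simp
      then have cl: "\<exists>h. h \<in> D \<and> h \<in> T" if "f \<in> T" "openin (vtop ?W) T" for T
        using that by (simp add: in_closure_of)
      have fin: "f \<in> {h \<in> vcarrier ?W. h p \<in> ball (f p) u} \<inter> {h \<in> vcarrier ?W. h q \<in> ball (f q) u}"
        using fL u by (simp add: carW)
      obtain h where h: "h \<in> D" "h \<in> {h \<in> vcarrier ?W. h p \<in> ball (f p) u} \<inter> {h \<in> vcarrier ?W. h q \<in> ball (f q) u}"
        using cl[OF fin op] by blast
      obtain i where "h = d i" unfolding d_def using from_nat_into_surj[OF D(1) h(1)] by metis
      then show ?thesis using h(2) by (intro exI[of _ i]) (auto simp: dist_real_def abs_minus_commute)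
    qed
    have "e / 2 > 0" using e by simp
    from pointwise_closure_uniformly_determined[OF pc dc fc dense this]
    obtain m where m: "\<And>p q. p \<in> topspace X \<Longrightarrow> q \<in> topspace X \<Longrightarrow>
        (\<forall>i<m. \<bar>d i p - d i q\<bar> < 1 / real (Suc m)) \<Longrightarrow> \<bar>f p - f q\<bar> < e / 2" by metis
    define \<kappa> where "\<kappa> = cell (Suc m) m"
    have same: "\<bar>f p - f q\<bar> < e / 2" if "p \<in> topspace X" "q \<in> topspace X" "\<kappa> p = \<kappa> q" for p q
    proof (rule m[OF that(1,2)], intro allI impI)
      fix i assume "i < m"
      then have "\<lfloor>real (Suc m) * d i p\<rfloor> = \<lfloor>real (Suc m) * d i q\<rfloor>"
        using that(3) by (auto simp: \<kappa>_def cell_def)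
      then have "\<bar>real (Suc m) * d i p - real (Suc m) * d i q\<bar> < 1" by linarith
      moreover have "real (Suc m) * d i p - real (Suc m) * d i q = real (Suc m) * (d i p - d i q)"
        by (simp add: algebra_simps)
      ultimately have "real (Suc m) * \<bar>d i p - d i q\<bar> < 1" by (simp add: abs_mult del: of_nat_Suc)
      then show "\<bar>d i p - d i q\<bar> < 1 / real (Suc m)" by (simp add: field_simps del: of_nat_Suc)
    qed
    have fin: "finite (\<kappa> ` topspace X)"
    proof -
      have "\<exists>K. \<forall>p\<in>topspace X. \<bar>d i p\<bar> \<le> K" for i using pseudocompact_bounded[OF pc dc[of i]] by metis
      then obtain K where K: "\<And>i p. p \<in> topspace X \<Longrightarrow> \<bar>d i p\<bar> \<le> K i" by metis
      define B where "B = (\<Sum>i<m. \<lceil>real (Suc m) * \<bar>K i\<bar>\<rceil> + 1)"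
      have B: "\<bar>\<lfloor>real (Suc m) * d i p\<rfloor>\<bar> \<le> B" if "i < m" "p \<in> topspace X" for i p
      proof -
        have "\<bar>real (Suc m) * d i p\<bar> \<le> real (Suc m) * \<bar>K i\<bar>"
          unfolding abs_mult using K[OF that(2), of i] by (intro mult_mono) auto
        then have "\<bar>\<lfloor>real (Suc m) * d i p\<rfloor>\<bar> \<le> \<lceil>real (Suc m) * \<bar>K i\<bar>\<rceil> + 1" by linarith
        also have "\<dots> \<le> B" unfolding B_def
        proof (rule member_le_sum)
          fix j
          have "0 \<le> real (Suc m) * \<bar>K j\<bar>" by simp
          then show "0 \<le> \<lceil>real (Suc m) * \<bar>K j\<bar>\<rceil> + 1" by linarith
        qed (use that in auto)
        finally show ?thesis .
      qed
      have "\<kappa> ` topspace X \<subseteq> {rs. set rs \<subseteq> {-B..B} \<and> length rs = m}"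
        using B by (auto simp: \<kappa>_def cell_def abs_le_iff minus_le_iff)
      then show ?thesis by (rule finite_subset) (rule finite_lists_length_eq, simp)
    qed
    define rep where "rep r = (SOME p. p \<in> topspace X \<and> \<kappa> p = r)" for r
    have rep: "rep (\<kappa> p) \<in> topspace X" "\<kappa> (rep (\<kappa> p)) = \<kappa> p" if "p \<in> topspace X" for p
      using someI_ex[of "\<lambda>q. q \<in> topspace X \<and> \<kappa> q = \<kappa> p"] that unfolding rep_def by auto
    define g where "g p = (\<Sum>r\<in>\<kappa> ` topspace X. f (rep r) * ind (Suc m, m, r) p)" for p
    have g: "\<bar>f p - g p\<bar> \<le> e / 2" if p: "p \<in> topspace X" for p
    proof -
      have "g p = (\<Sum>r\<in>\<kappa> ` topspace X. if r = \<kappa> p then f (rep (\<kappa> p)) else 0)"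
        unfolding g_def ind_def by (rule sum.cong) (auto simp: \<kappa>_def)
      also have "\<dots> = f (rep (\<kappa> p))" using fin p by simp
      finally show ?thesis using same[OF p rep(1)[OF p]] rep(2)[OF p] by simp
    qed
    \<comment> \<open>From N on, the measures vanish on every indicator used in g; the inserted 0 covers an empty set of cells.\<close>
    define N where "N = Suc (Max (insert 0 ((\<lambda>r. to_nat (Suc m, m, r)) ` (\<kappa> ` topspace X))))"
    have "\<bar>pairing (c n) f\<bar> < e" if n: "n \<ge> N" for n
    proof -
      have "pairing (c n) (ind (Suc m, m, r)) = 0" if r: "r \<in> \<kappa> ` topspace X" for r
      proof -
        have "to_nat (Suc m, m, r) \<le> Max (insert 0 ((\<lambda>r. to_nat (Suc m, m, r)) ` (\<kappa> ` topspace X)))"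
          using fin r by (intro Max_ge) auto
        then have "to_nat (Suc m, m, r) < n" using n by (simp add: N_def)
        from kill[OF this] show ?thesis by simp
      qed
      then have "pairing (c n) g = 0"
        unfolding g_def pairing_sum pairing_scale by (intro sum.neutral) simp
      then have "pairing (c n) f = pairing (c n) (\<lambda>p. f p - g p)" by (simp add: pairing_diff)
      also have "\<bar>\<dots>\<bar> \<le> e / 2 * mass (c n) UNIV"
        by (rule abs_pairing_le_norm[OF fin_measure_finite[OF c(1)]])
           (use g c(1) e in \<open>auto simp: fin_measure_def\<close>)
      finally show ?thesis using c(2) e by simp
    qed
    then show "\<exists>N. \<forall>n\<ge>N. norm (pairing (c n) f - 0) < e" by (intro exI[of _ N]) simp
  qed
  have "weakly_null X c" unfolding weakly_null_def
  proof (intro allI impI)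
    fix h assume "continuous_map X euclideanreal h"
    then have f: "restrict h (topspace X) \<in> vcarrier ?V" by (rule restrict_in_Cp)
    define f where "f = restrict h (topspace X)"
    note f = f[folded f_def]
    let ?z = "vadd ?V f (vscale ?V (-1) (P f))"
    have s: "vscale ?V (-1) (P f) \<in> vcarrier ?V" by (rule rvs_scale[OF rvs PV[OF f]])
    have "P ?z = vadd ?V (P f) (vscale ?V (-1) (P (P f)))"
      using P(1) f s PV[OF f] unfolding linear_map_on_def by simp
    then have "P ?z = vzero ?V" using P(3)[OF f] vadd_uminus[OF rvs PV[OF f]] by simp
    then have "?z \<in> Z" using rvs_add[OF rvs f s] by (simp add: Z_def)
    then have "pairing (c n) ?z = 0" for n by (rule ann)
    moreover have "pairing (c n) ?z = pairing (c n) f + (- 1) * pairing (c n) (P f)" for n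
      unfolding Cp_simps by (simp only: pairing_restrict[OF c(1)] pairing_add pairing_scale)
    ultimately have "pairing (c n) f = pairing (c n) (P f)" for n by simp
    moreover have "(\<lambda>n. pairing (c n) (P f)) \<longlonglongrightarrow> 0" by (rule onL) (use P(4) f in blast)
    ultimately have "(\<lambda>n. pairing (c n) f) \<longlonglongrightarrow> 0" by simp
    then show "(\<lambda>n. pairing (c n) h) \<longlonglongrightarrow> 0" unfolding f_def pairing_restrict[OF c(1)] .
  qed
  then show ?thesis unfolding JNP_iff using c by blast
qed

text \<open>A countable neighbourhood base of 0 in L involves only countably many finite sets F of points.
  Choosing, for each of them, elements of L near all rational-valued functions on F gives a countable
  dense set, because neighbourhoods of other points of L are translates.\<close>

lemma first_countable_subspace_separable:
  assumes lin: "linear_subspace (Cp X) L" and fc: "first_countable (vtop (sub_tvs (Cp X) L))"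
  shows "separable_space (vtop (sub_tvs (Cp X) L))"
proof -
  let ?V = "Cp X" and ?W = "sub_tvs (Cp X) L"
  note carW = vcarrier_sub_tvs[OF lin]
  have LV: "f \<in> vcarrier ?V" if "f \<in> L" for f using lin that by (auto simp: linear_subspace_def)
  have L0: "vzero ?V \<in> L" using lin by (simp add: linear_subspace_def)
  obtain \<B> where \<B>: "countable \<B>" "\<And>U. U \<in> \<B> \<Longrightarrow> openin (vtop ?W) U"
    "\<And>U. openin (vtop ?W) U \<Longrightarrow> vzero ?V \<in> U \<Longrightarrow> \<exists>B\<in>\<B>. vzero ?V \<in> B \<and> B \<subseteq> U"
    using fc L0 unfolding first_countable_def carW by metis
  have nb: "\<exists>F e. finite F \<and> F \<subseteq> topspace X \<and> 0 < e \<and> (\<forall>g\<in>L. (\<forall>x\<in>F. \<bar>g x - f x\<bar> < e) \<longrightarrow> g \<in> U)"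
    if U: "openin (vtop ?W) U" "f \<in> U" for U f
  proof -
    obtain W where W: "openin (vtop ?V) W" "U = W \<inter> L"
      using U(1) by (auto simp: sub_tvs_def openin_subtopology)
    have "f \<in> W" using U(2) W(2) by blast
    from Cp_neighbourhood[OF W(1) this] obtain F e where "finite F" "F \<subseteq> topspace X" "0 < e"
      and e: "\<And>g. g \<in> vcarrier ?V \<Longrightarrow> (\<And>x. x \<in> F \<Longrightarrow> \<bar>g x - f x\<bar> < e) \<Longrightarrow> g \<in> W" by metis
    moreover have "\<forall>g\<in>L. (\<forall>x\<in>F. \<bar>g x - f x\<bar> < e) \<longrightarrow> g \<in> U" using e LV W(2) by blast
    ultimately show ?thesis by blast
  qed
  define \<B>0 where "\<B>0 = {B \<in> \<B>. vzero ?V \<in> B}"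
  have "\<exists>F e. finite F \<and> F \<subseteq> topspace X \<and> 0 < e \<and> (\<forall>g\<in>L. (\<forall>x\<in>F. \<bar>g x - vzero ?V x\<bar> < e) \<longrightarrow> g \<in> B)"
    if "B \<in> \<B>0" for B by (rule nb) (use that \<B>(2) in \<open>auto simp: \<B>0_def\<close>)
  then obtain F e where F: "\<And>B. B \<in> \<B>0 \<Longrightarrow> finite (F B)" "\<And>B. B \<in> \<B>0 \<Longrightarrow> F B \<subseteq> topspace X"
    "\<And>B. B \<in> \<B>0 \<Longrightarrow> 0 < e B"
    and Fe: "\<And>B g. B \<in> \<B>0 \<Longrightarrow> g \<in> L \<Longrightarrow> (\<forall>x\<in>F B. \<bar>g x - vzero ?V x\<bar> < e B) \<Longrightarrow> g \<in> B" by metis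
  \<comment> \<open>Pairs of a basic neighbourhood of 0 and a rational function on its finite set of points.\<close>
  define I where "I = (SIGMA B:\<B>0. PiE (F B) (\<lambda>_. \<rat> :: real set))"
  have I: "countable I" unfolding I_def
  proof (rule countable_SIGMA)
    show "countable \<B>0" unfolding \<B>0_def using \<B>(1) by (rule countable_subset[rotated]) blast
    show "countable (PiE (F B) (\<lambda>_. \<rat> :: real set))" if "B \<in> \<B>0" for B
      by (rule countable_PiE[OF F(1)[OF that]]) (rule countable_rat)
  qed
  define near where "near = (\<lambda>(B, q) g. g \<in> L \<and> (\<forall>x\<in>F B. \<bar>g x - q x\<bar> < e B / 2))"
  define pick where "pick s = (SOME g. near s g)" for s
  define D where "D = pick ` {s \<in> I. \<exists>g. near s g}"
  have pick: "near s (pick s)" if "\<exists>g. near s g" for s unfolding pick_def using that by (rule someI_ex)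
  have "countable D" unfolding D_def by (intro countable_image countable_Collect I)
  moreover have DL: "D \<subseteq> L" unfolding D_def using pick by (auto simp: near_def split_def)
  moreover have "f \<in> vtop ?W closure_of D" if f: "f \<in> L" for f
    unfolding in_closure_of
  proof (intro conjI allI impI)
    show "f \<in> vcarrier ?W" using f carW by simp
    fix U assume "f \<in> U \<and> openin (vtop ?W) U"
    then obtain G u where G: "finite G" "G \<subseteq> topspace X" "0 < u" and Gu: "\<forall>g\<in>L. (\<forall>x\<in>G. \<bar>g x - f x\<bar> < u) \<longrightarrow> g \<in> U"
      using nb[of U f] by metis
    have "openin (vtop ?W) {g \<in> vcarrier ?W. g x \<in> ball 0 u}" if "x \<in> G" for x
    proof (rule openin_continuous_map_preimage)
      show "continuous_map (vtop ?W) euclideanreal (\<lambda>g. g x)"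
        using continuous_map_Cp_eval[of x X] that G(2)
        by (auto simp: sub_tvs_def intro: continuous_map_from_subtopology)
    qed simp
    then have "openin (vtop ?W) (vcarrier ?W \<inter> (\<Inter>x\<in>G. {g \<in> vcarrier ?W. g x \<in> ball 0 u}))"
      using G(1) by (cases "G = {}") (auto intro!: openin_Int openin_INT2)
    moreover have "vzero ?V \<in> vcarrier ?W \<inter> (\<Inter>x\<in>G. {g \<in> vcarrier ?W. g x \<in> ball 0 u})"
      using L0 G(2,3) by (auto simp: carW Cp_simps)
    ultimately obtain B where B: "B \<in> \<B>" "vzero ?V \<in> B"
        and BU: "B \<subseteq> vcarrier ?W \<inter> (\<Inter>x\<in>G. {g \<in> vcarrier ?W. g x \<in> ball 0 u})"
      using \<B>(3) by meson
    have B0: "B \<in> \<B>0" using B by (simp add: \<B>0_def)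
    have "\<exists>q\<in>\<rat>. \<bar>f x - q\<bar> < e B / 2" for x
    proof -
      have "f x < f x + e B / 2" using F(3)[OF B0] by simp
      then obtain q where "q \<in> \<rat>" "f x < q" "q < f x + e B / 2" using Rats_dense_in_real by blast
      then show ?thesis by (intro bexI[of _ q]) auto
    qed
    then obtain q where q: "\<And>x. q x \<in> \<rat>" "\<And>x. \<bar>f x - q x\<bar> < e B / 2" by metis
    let ?s = "(B, restrict q (F B))"
    have sI: "?s \<in> I" using B0 q(1) by (simp add: I_def)
    have nf: "near ?s f" using f q(2) by (simp add: near_def)
    define g where "g = pick ?s"
    have gD: "g \<in> D" unfolding D_def g_def using sI nf by blast
    have gn: "near ?s g" unfolding g_def using nf by (intro pick) blast
    then have gL: "g \<in> L" and gq: "\<And>x. x \<in> F B \<Longrightarrow> \<bar>g x - q x\<bar> < e B / 2" by (auto simp: near_def)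
    define h where "h = vadd ?V g (vscale ?V (-1) f)"
    have hL: "h \<in> L" using lin gL f by (simp add: h_def linear_subspace_def)
    have hx: "h x = g x - f x" if "x \<in> topspace X" for x using that by (simp add: h_def Cp_simps)
    have "h \<in> B"
    proof (rule Fe[OF B0 hL], intro ballI)
      fix x assume x: "x \<in> F B"
      then have xX: "x \<in> topspace X" using F(2)[OF B0] by blast
      have "\<bar>g x - f x\<bar> < e B" using gq[OF x] q(2)[of x] by linarith
      then show "\<bar>h x - vzero ?V x\<bar> < e B" using xX hx[OF xX] by (simp add: Cp_simps)
    qed
    then have "h \<in> (\<Inter>x\<in>G. {g \<in> vcarrier ?W. g x \<in> ball 0 u})" using BU by blast
    then have "\<bar>h x\<bar> < u" if "x \<in> G" for x using that by auto
    then have "\<bar>g x - f x\<bar> < u" if "x \<in> G" for x using \<open>\<And>x. x \<in> G \<Longrightarrow> \<bar>h x\<bar> < u\<close>[OF that] hx[OF subsetD[OF G(2) that]] by simp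
    then have "g \<in> U" using Gu gL by blast
    then show "\<exists>y. y \<in> D \<and> y \<in> U" using gD by blast
  qed
  then have "vtop ?W closure_of D = L"
    using closure_of_subset_topspace[of "vtop ?W" D] carW by blast
  ultimately show ?thesis unfolding separable_space_def carW by blast
qed

section \<open>The equivalences\<close>

theorem theorem1:
  fixes X :: "'a topology"
  assumes "tychonoff_space X"
  shows
    "(JNP X \<longleftrightarrow>
        (\<exists>L. complemented_subspace (Cp X) L \<and> isomorphic_tvs (sub_tvs (Cp X) L) c0_space)) \<and>
     (JNP X \<longleftrightarrow>
        (\<exists>Z. closed_linear_subspace (Cp X) Z \<and> isomorphic_tvs (quotient_tvs (Cp X) Z) c0_space)) \<and>
     (pseudocompact_space X \<longrightarrow>
        (JNP X \<longleftrightarrow>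
          (\<exists>L. complemented_subspace (Cp X) L \<and> infinite_dimensional (sub_tvs (Cp X) L) \<and>
               metrizable_space (vtop (sub_tvs (Cp X) L)))) \<and>
        (JNP X \<longleftrightarrow>
          (\<exists>L. complemented_subspace (Cp X) L \<and> infinite_dimensional (sub_tvs (Cp X) L) \<and>
               separable_space (vtop (sub_tvs (Cp X) L)))) \<and>
        (JNP X \<longleftrightarrow>
          (\<exists>Z. closed_linear_subspace (Cp X) Z \<and> infinite_dimensional (quotient_tvs (Cp X) Z) \<and>
               polishable (quotient_tvs (Cp X) Z))))"
proof -
  note rvs = real_vector_space_Cp[of X]
  have c0_closed: "closedin (vtop c0_space) {vzero c0_space}"
  proof -
    have "Hausdorff_space (vtop c0_space)"
      using metrizable_c0 by (rule metrizable_imp_Hausdorff_space)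
    then show ?thesis
      by (rule closedin_Hausdorff_singleton[OF _ rvs_zero[OF real_vector_space_c0_space]])
  qed
  have sub: "\<exists>L. complemented_subspace (Cp X) L \<and> isomorphic_tvs (sub_tvs (Cp X) L) c0_space" if J: "JNP X"
  proof (rule JNP_imp_c0_retraction[OF assms J])
    fix T S
    assume TS: "linear_map_on (Cp X) c0_space T" "continuous_map (vtop (Cp X)) (vtop c0_space) T"
      "linear_map_on c0_space (Cp X) S" "continuous_map (vtop c0_space) (vtop (Cp X)) S"
      "\<And>w. w \<in> vcarrier c0_space \<Longrightarrow> T (S w) = w"
    show ?thesis
      using complemented_section[of "Cp X" c0_space T S, OF rvs real_vector_space_c0_space TS]
        isomorphic_section[of "Cp X" c0_space T S, OF rvs real_vector_space_c0_space TS] by blast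
  qed
  have quot: "\<exists>Z. closed_linear_subspace (Cp X) Z \<and> isomorphic_tvs (quotient_tvs (Cp X) Z) c0_space" if J: "JNP X"
  proof (rule JNP_imp_c0_retraction[OF assms J])
    fix T S
    assume TS: "linear_map_on (Cp X) c0_space T" "continuous_map (vtop (Cp X)) (vtop c0_space) T"
      "linear_map_on c0_space (Cp X) S" "continuous_map (vtop c0_space) (vtop (Cp X)) S"
      "\<And>w. w \<in> vcarrier c0_space \<Longrightarrow> T (S w) = w"
    show ?thesis
      using closed_kernel[of "Cp X" c0_space T S, OF rvs real_vector_space_c0_space TS c0_closed]
        isomorphic_quotient_kernel[of "Cp X" c0_space T S, OF rvs real_vector_space_c0_space TS] by blast
  qed
  have sub_JNP: "JNP X" if L: "complemented_subspace (Cp X) L" "isomorphic_tvs (sub_tvs (Cp X) L) c0_space" for L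
  proof -
    obtain P where lin: "linear_subspace (Cp X) L" and P: "linear_map_on (Cp X) (Cp X) P"
        "continuous_map (vtop (Cp X)) (vtop (Cp X)) P" "P ` vcarrier (Cp X) = L"
      using L(1) unfolding complemented_subspace_def by metis
    obtain T where T: "linear_map_on (sub_tvs (Cp X) L) c0_space T"
        "homeomorphic_map (vtop (sub_tvs (Cp X) L)) (vtop c0_space) T"
      using L(2) unfolding isomorphic_tvs_def by metis
    note car = vcarrier_sub_tvs[OF lin]
    have PL: "P f \<in> L" if "f \<in> vcarrier (Cp X)" for f using P(3) that by blast
    show ?thesis
    proof (rule c0_image_imp_JNP[OF assms])
      show "linear_map_on (Cp X) c0_space (T \<circ> P)"
        using P(1) T(1) PL unfolding linear_map_on_def car by (auto simp: sub_tvs_def)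
      have "continuous_map (vtop (Cp X)) (vtop (sub_tvs (Cp X) L)) P"
        using P(2) PL by (simp add: sub_tvs_def continuous_map_in_subtopology image_subset_iff)
      then show "continuous_map (vtop (Cp X)) (vtop c0_space) (T \<circ> P)"
        by (rule continuous_map_compose[OF _ homeomorphic_imp_continuous_map[OF T(2)]])
      show "(T \<circ> P) ` vcarrier (Cp X) = vcarrier c0_space"
        using homeomorphic_imp_surjective_map[OF T(2)] unfolding image_comp[symmetric] P(3) car .
    qed
  qed
  have quot_JNP: "JNP X" if Z: "closed_linear_subspace (Cp X) Z" "isomorphic_tvs (quotient_tvs (Cp X) Z) c0_space" for Z
  proof -
    have lin: "linear_subspace (Cp X) Z" using Z(1) by (simp add: closed_linear_subspace_def)
    obtain T where T: "linear_map_on (quotient_tvs (Cp X) Z) c0_space T"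
        "homeomorphic_map (vtop (quotient_tvs (Cp X) Z)) (vtop c0_space) T"
      using Z(2) unfolding isomorphic_tvs_def by metis
    show ?thesis
    proof (rule c0_image_imp_JNP[OF assms])
      show "linear_map_on (Cp X) c0_space (T \<circ> vcoset (Cp X) Z)"
        using T(1) unfolding linear_map_on_def vcarrier_quotient_tvs
        by (auto simp: vadd_quotient_tvs[OF rvs lin, symmetric] vscale_quotient_tvs[OF rvs lin, symmetric])
      show "continuous_map (vtop (Cp X)) (vtop c0_space) (T \<circ> vcoset (Cp X) Z)"
        by (rule continuous_map_compose[OF quotient_imp_continuous_map[OF quotient_map_vcoset]
              homeomorphic_imp_continuous_map[OF T(2)]])
      show "(T \<circ> vcoset (Cp X) Z) ` vcarrier (Cp X) = vcarrier c0_space"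
        using homeomorphic_imp_surjective_map[OF T(2)]
        unfolding image_comp[symmetric] vcarrier_quotient_tvs .
    qed
  qed
  have sub_props: "\<exists>L. complemented_subspace (Cp X) L \<and> infinite_dimensional (sub_tvs (Cp X) L) \<and>
      metrizable_space (vtop (sub_tvs (Cp X) L)) \<and> separable_space (vtop (sub_tvs (Cp X) L))" if J: "JNP X"
  proof -
    obtain L where L: "complemented_subspace (Cp X) L" "isomorphic_tvs (sub_tvs (Cp X) L) c0_space"
      using sub[OF J] by blast
    have "linear_subspace (Cp X) L" using L(1) by (simp add: complemented_subspace_def)
    from real_vector_space_sub_tvs[OF rvs this] have r: "real_vector_space (sub_tvs (Cp X) L)" .
    have "metrizable_space (vtop (sub_tvs (Cp X) L))"
      using homeomorphic_metrizable_space[OF isomorphic_imp_homeomorphic_space[OF L(2)]] metrizable_c0 by simp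
    then show ?thesis
      using L(1) infinite_dimensional_isomorphic_c0[OF r L(2)]
        polishable_imp_separable[OF polishable_isomorphic_c0[OF r L(2)]] by blast
  qed
  have quot_props: "\<exists>Z. closed_linear_subspace (Cp X) Z \<and> infinite_dimensional (quotient_tvs (Cp X) Z) \<and>
      polishable (quotient_tvs (Cp X) Z)" if J: "JNP X"
  proof -
    obtain Z where Z: "closed_linear_subspace (Cp X) Z" "isomorphic_tvs (quotient_tvs (Cp X) Z) c0_space"
      using quot[OF J] by blast
    have "linear_subspace (Cp X) Z" using Z(1) by (simp add: closed_linear_subspace_def)
    from real_vector_space_quotient_tvs[OF rvs this] have r: "real_vector_space (quotient_tvs (Cp X) Z)" .
    show ?thesis
      using Z(1) infinite_dimensional_isomorphic_c0[OF r Z(2)] polishable_isomorphic_c0[OF r Z(2)] by blast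
  qed
  have metrizable_JNP: "JNP X"
    if "pseudocompact_space X" "complemented_subspace (Cp X) L" "infinite_dimensional (sub_tvs (Cp X) L)"
      "metrizable_space (vtop (sub_tvs (Cp X) L))" for L
  proof (rule separable_complement_imp_JNP[OF that(1-3)])
    have "linear_subspace (Cp X) L" using that(2) by (simp add: complemented_subspace_def)
    then show "separable_space (vtop (sub_tvs (Cp X) L))"
      by (rule first_countable_subspace_separable[OF _ metrizable_imp_first_countable[OF that(4)]])
  qed
  show ?thesis
  proof (intro conjI impI)
    show "JNP X \<longleftrightarrow> (\<exists>L. complemented_subspace (Cp X) L \<and> isomorphic_tvs (sub_tvs (Cp X) L) c0_space)"
      using sub sub_JNP by blast
    show "JNP X \<longleftrightarrow> (\<exists>Z. closed_linear_subspace (Cp X) Z \<and> isomorphic_tvs (quotient_tvs (Cp X) Z) c0_space)"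
      using quot quot_JNP by blast
    assume pc: "pseudocompact_space X"
    show "JNP X \<longleftrightarrow> (\<exists>L. complemented_subspace (Cp X) L \<and> infinite_dimensional (sub_tvs (Cp X) L) \<and>
        metrizable_space (vtop (sub_tvs (Cp X) L)))"
      using sub_props metrizable_JNP[OF pc] by blast
    show "JNP X \<longleftrightarrow> (\<exists>L. complemented_subspace (Cp X) L \<and> infinite_dimensional (sub_tvs (Cp X) L) \<and>
        separable_space (vtop (sub_tvs (Cp X) L)))"
      using sub_props separable_complement_imp_JNP[OF pc] by blast
    show "JNP X \<longleftrightarrow> (\<exists>Z. closed_linear_subspace (Cp X) Z \<and> infinite_dimensional (quotient_tvs (Cp X) Z) \<and>
        polishable (quotient_tvs (Cp X) Z))"
      using quot_props polishable_quotient_imp_JNP[OF pc] by blast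
  qed
qed

end
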